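(* Let $n\ge p$, and let $X$ ($m\times p$) and $S$ ($p\times p$) be independent with $X\sim \mathcal N_{m\times p}(\Theta, I_m\otimes\Sigma)$ and $S\sim\mathcal W_p(n,\Sigma)$. Assume $p>m+1$. Let $a=n-p-2m$ and $k_0=\{n-(c+m+1)\}/n$, let $\widehat\Sigma_0=n^{-1}S$, and consider the generalized Bayes estimators $$\widehat\Theta^{GB}=X-k_0X\{I_p+(1-k_0)S^{-1}X^\top X\}^{-1},\qquad \widehat\Sigma^{GB}=\widehat\Sigma_0+n^{-1}k_0X^\top\{I_m+(1-k_0)XS^{-1}X^\top\}^{-1}X.$$ Then $(\widehat\Theta^{GB},\widehat\Sigma^{GB})$ dominates $(X,\widehat\Sigma_0)$ relative to the Kullback-Leibler divergence if $c$ satisfies $-2<c<n-2m$ and $$c_{low}:=\frac{n^2-(p-m)n-(p-1)(m+1)}{n+p-1}\le c.$$ Moreover, there exists a $c$ satisfying these conditions if $n>(p-1)(m-1)/(2p-3m-1)$ and $p>(3m+1)/2$.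
   Context: $\mathcal N_{m\times p}(M,A\otimes\Sigma)$ denotes the matrix normal distribution with density proportional to $\exp[-\tfrac12\mathrm{tr}\{A^{-1}(X-M)\Sigma^{-1}(X-M)^\top\}]$; $\phi(\cdot\mid\Theta,\Sigma)$ is the density of $\mathcal N_{m\times p}(\Theta,I_m\otimes\Sigma)$; $\mathcal W_p(n,\Sigma)$ is the Wishart distribution with $n$ degrees of freedom and scale matrix $\Sigma$ ($p\times p$ positive definite). Both $\Theta$ and $\Sigma$ are unknown. The estimators are the generalized Bayes estimators $\widehat\Theta=E[\Theta\Sigma^{-1}\mid X,S]\{E[\Sigma^{-1}\mid X,S]\}^{-1}$ and $\widehat\Sigma=(E[\Sigma^{-1}\mid X,S])^{-1}$ for the hierarchical prior $\Theta\mid\Sigma,\Omega\sim\mathcal N_{m\times p}(0,\Omega\otimes\Sigma)$, $\pi(\Omega)\propto|I_m+\Omega|^{-a/2-m}|\Omega|^{c/2}$ ($\Omega$ positive definite $m\times m$), $\pi(\Sigma^{-1})\propto|\Sigma^{-1}|^{(b-1)/2}$ with $b=a+m-n$; for the present claim they are given by the displayed formulas. The Kullback-Leibler loss of $(\widehat\Theta,\widehat\Sigma)$ is $$D_{KL}=\int\log\frac{\phi(Y\mid\widehat\Theta,\widehat\Sigma)}{\phi(Y\mid\Theta,\Sigma)}\,\phi(Y\mid\widehat\Theta,\widehat\Sigma)\,dY=\frac m2\{\mathrm{tr}(\widehat\Sigma\Sigma^{-1})-\log|\widehat\Sigma\Sigma^{-1}|-p\}+\frac12\mathrm{tr}\{(\widehat\Theta-\Theta)\Sigma^{-1}(\widehat\Theta-\Theta)^\top\},$$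 and the risk is its expectation over $(X,S)$. One estimator dominates another if its risk is at most that of the other for all $(\Theta,\Sigma)$ with strict inequality for some $(\Theta,\Sigma)$. *)

theory Defs
  imports "HOL-Probability.Probability"
begin

text \<open>
  An \<open>m \<times> p\<close> matrix is an element of \<^typ>\<open>real ^ 'p ^ 'm\<close>, with
  \<open>m = CARD('m)\<close> and \<open>p = CARD('p)\<close>.
\<close>

definition pos_def :: "real ^ 'n ^ 'n \<Rightarrow> bool" where
  "pos_def A \<longleftrightarrow> transpose A = A \<and> (\<forall>x. x \<noteq> 0 \<longrightarrow> x \<bullet> (A *v x) > 0)"

text \<open>
  The matrix normal distribution \<open>N\<^bsub>m\<times>p\<^esub>(M, A \<otimes> \<Sigma>)\<close>. The Lebesgue measure \<^const>\<open>lborel\<close> on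
  \<^typ>\<open>real ^ 'p ^ 'm\<close> is the product of the Lebesgue measures of the \<open>m p\<close> entries, and
  \<open>det (A \<otimes> \<Sigma>) = (det A) ^ p * (det \<Sigma>) ^ m\<close>.
\<close>

definition matrix_normal_density ::
    "real ^ 'p ^ 'm \<Rightarrow> real ^ 'm ^ 'm \<Rightarrow> real ^ 'p ^ 'p \<Rightarrow> real ^ 'p ^ 'm \<Rightarrow> real" where
  "matrix_normal_density M A \<Sigma> X =
     exp (- (1 / 2) * trace (matrix_inv A ** (X - M) ** matrix_inv \<Sigma> ** transpose (X - M)))
     / sqrt ((2 * pi) ^ (CARD('m) * CARD('p)) * det A ^ CARD('p) * det \<Sigma> ^ CARD('m))"

definition matrix_normal ::
    "real ^ 'p ^ 'm \<Rightarrow> real ^ 'm ^ 'm \<Rightarrow> real ^ 'p ^ 'p \<Rightarrow> (real ^ 'p ^ 'm) measure" where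
  "matrix_normal M A \<Sigma> = density lborel (\<lambda>X. ennreal (matrix_normal_density M A \<Sigma> X))"

text \<open>
  The Wishart distribution \<open>W\<^sub>p(n, \<Sigma>)\<close> is the law of \<open>\<Sum>i<n. z\<^sub>i\<^sup>T z\<^sub>i\<close>, where \<open>z\<^sub>0, \<dots>, z\<^bsub>n-1\<^esub>\<close>
  are independent \<open>N(0, \<Sigma>)\<close> row vectors, that is, \<open>1 \<times> p\<close> matrices.
\<close>

definition wishart :: "nat \<Rightarrow> real ^ 'p ^ 'p \<Rightarrow> (real ^ 'p ^ 'p) measure" where
  "wishart n \<Sigma> =
     distr (\<Pi>\<^sub>M i\<in>{..<n}. matrix_normal (0 :: real ^ 'p ^ 1) (mat 1) \<Sigma>) borel
       (\<lambda>z. \<Sum>i<n. transpose (z i) ** z i)"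

text \<open>
  The Kullback-Leibler loss of the estimate \<open>(\<Theta>', \<Sigma>')\<close> of \<open>(\<Theta>, \<Sigma>)\<close>; the integration is with
  respect to the estimated density.
\<close>

definition kl_loss ::
    "(real ^ 'p ^ 'm) \<times> (real ^ 'p ^ 'p) \<Rightarrow> (real ^ 'p ^ 'm) \<times> (real ^ 'p ^ 'p) \<Rightarrow> real" where
  "kl_loss = (\<lambda>(\<Theta>', \<Sigma>') (\<Theta>, \<Sigma>).
     \<integral>Y. ln (matrix_normal_density \<Theta>' (mat 1) \<Sigma>' Y / matrix_normal_density \<Theta> (mat 1) \<Sigma> Y)
         * matrix_normal_density \<Theta>' (mat 1) \<Sigma>' Y \<partial>lborel)"

text \<open>
  The expected loss over independent \<open>X \<sim> N\<^bsub>m\<times>p\<^esub>(\<Theta>, I\<^sub>m \<otimes> \<Sigma>)\<close> and \<open>S \<sim> W\<^sub>p(n, \<Sigma>)\<close>.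
  The loss is nonnegative when the estimate of \<open>\<Sigma>\<close> is positive definite, so its expectation is
  taken in \<^typ>\<open>ennreal\<close>, where a risk without finite value is \<open>\<infinity>\<close> and not \<open>0\<close>.
\<close>

definition kl_risk ::
    "nat \<Rightarrow> (real ^ 'p ^ 'm \<Rightarrow> real ^ 'p ^ 'p \<Rightarrow> (real ^ 'p ^ 'm) \<times> (real ^ 'p ^ 'p)) \<Rightarrow>
     real ^ 'p ^ 'm \<Rightarrow> real ^ 'p ^ 'p \<Rightarrow> ennreal" where
  "kl_risk n \<delta> \<Theta> \<Sigma> =
     (\<integral>\<^sup>+(X, S). ennreal (kl_loss (\<delta> X S) (\<Theta>, \<Sigma>))
        \<partial>(matrix_normal \<Theta> (mat 1) \<Sigma> \<Otimes>\<^sub>M wishart n \<Sigma>))"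

definition kl_dominates ::
    "nat \<Rightarrow> (real ^ 'p ^ 'm \<Rightarrow> real ^ 'p ^ 'p \<Rightarrow> (real ^ 'p ^ 'm) \<times> (real ^ 'p ^ 'p)) \<Rightarrow>
     (real ^ 'p ^ 'm \<Rightarrow> real ^ 'p ^ 'p \<Rightarrow> (real ^ 'p ^ 'm) \<times> (real ^ 'p ^ 'p)) \<Rightarrow> bool" where
  "kl_dominates n \<delta> \<delta>' \<longleftrightarrow>
     (\<forall>\<Theta> \<Sigma>. pos_def \<Sigma> \<longrightarrow> kl_risk n \<delta> \<Theta> \<Sigma> \<le> kl_risk n \<delta>' \<Theta> \<Sigma>) \<and>
     (\<exists>\<Theta> \<Sigma>. pos_def \<Sigma> \<and> kl_risk n \<delta> \<Theta> \<Sigma> < kl_risk n \<delta>' \<Theta> \<Sigma>)"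

definition Sigma0 :: "nat \<Rightarrow> real ^ 'p ^ 'p \<Rightarrow> real ^ 'p ^ 'p" where
  "Sigma0 n S = (1 / real n) *\<^sub>R S"

definition usual_estimator ::
    "nat \<Rightarrow> real ^ 'p ^ 'm \<Rightarrow> real ^ 'p ^ 'p \<Rightarrow> (real ^ 'p ^ 'm) \<times> (real ^ 'p ^ 'p)" where
  "usual_estimator n X S = (X, Sigma0 n S)"

text \<open>
  The closed forms of the generalized Bayes estimators
  \<open>E[\<Theta> \<Sigma>\<^sup>-\<^sup>1 | X, S] (E[\<Sigma>\<^sup>-\<^sup>1 | X, S])\<^sup>-\<^sup>1\<close> and \<open>(E[\<Sigma>\<^sup>-\<^sup>1 | X, S])\<^sup>-\<^sup>1\<close> for the prior
  \<open>\<Theta> | \<Sigma>, \<Omega> \<sim> N\<^bsub>m\<times>p\<^esub>(0, \<Omega> \<otimes> \<Sigma>)\<close>,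
  \<open>\<pi>(\<Omega>) \<propto> |I + \<Omega>|\<^bsup>-a/2-m\<^esup> |\<Omega>|\<^bsup>c/2\<^esup>\<close>, \<open>\<pi>(\<Sigma>\<^sup>-\<^sup>1) \<propto> |\<Sigma>\<^sup>-\<^sup>1|\<^bsup>(a+m-n-1)/2\<^esup>\<close>
  in the case \<open>a = n - p - 2 m\<close>. Among the hyperparameters only \<open>c\<close> remains, in \<open>k\<^sub>0\<close>.
\<close>

definition k0 :: "nat \<Rightarrow> nat \<Rightarrow> real \<Rightarrow> real" where
  "k0 n m c = (real n - (c + real m + 1)) / real n"

definition Theta_GB :: "nat \<Rightarrow> real \<Rightarrow> real ^ 'p ^ 'm \<Rightarrow> real ^ 'p ^ 'p \<Rightarrow> real ^ 'p ^ 'm" where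
  "Theta_GB n c X S =
     (let k = k0 n CARD('m) c
      in X - k *\<^sub>R (X ** matrix_inv (mat 1 + (1 - k) *\<^sub>R (matrix_inv S ** transpose X ** X))))"

definition Sigma_GB :: "nat \<Rightarrow> real \<Rightarrow> real ^ 'p ^ 'm \<Rightarrow> real ^ 'p ^ 'p \<Rightarrow> real ^ 'p ^ 'p" where
  "Sigma_GB n c X S =
     (let k = k0 n CARD('m) c
      in Sigma0 n S + (k / real n) *\<^sub>R
           (transpose X ** matrix_inv (mat 1 + (1 - k) *\<^sub>R (X ** matrix_inv S ** transpose X)) ** X))"

definition GB_estimator ::
    "nat \<Rightarrow> real \<Rightarrow> real ^ 'p ^ 'm \<Rightarrow> real ^ 'p ^ 'p \<Rightarrow> (real ^ 'p ^ 'm) \<times> (real ^ 'p ^ 'p)" where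
  "GB_estimator n c X S = (Theta_GB n c X S, Sigma_GB n c X S)"

definition c_low :: "nat \<Rightarrow> nat \<Rightarrow> nat \<Rightarrow> real" where
  "c_low n m p =
     ((real n)\<^sup>2 - (real p - real m) * real n - (real p - 1) * (real m + 1)) / (real n + real p - 1)"

end

theory Submission imports Defs begin

text \<open>
  Put \<open>K = X\<^sup>T X\<close>, \<open>k = k\<^sub>0\<close>, \<open>\<lambda> = 1 - k\<close> and \<open>A = S + \<lambda> K\<close>. The estimators are the
  shrinkage rules \<open>X - k X A\<^sup>-\<^sup>1 S\<close> and \<open>n\<^sup>-\<^sup>1 (S + k K A\<^sup>-\<^sup>1 S)\<close> (\<open>Theta_GB_eq\<close>, \<open>Sigma_GB_eq\<close>).
  With the closed form of the loss (\<open>kl_loss_eq\<close>), the loss difference of the two estimators is an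
  explicit function of \<open>X\<close> and \<open>S\<close> (\<open>kl_formula_difference\<close>), in which the unknown parameters
  occur only in
  \<open>tr (\<Sigma>\<^sup>-\<^sup>1 K A\<^sup>-\<^sup>1 S)\<close>, \<open>tr (\<Sigma>\<^sup>-\<^sup>1 K A\<^sup>-\<^sup>1 K A\<^sup>-\<^sup>1 S)\<close> and \<open>\<Sum>\<^sub>i \<Sigma>\<^sup>-\<^sup>1 (x\<^sub>i - \<theta>\<^sub>i) \<bullet> S A\<^sup>-\<^sup>1 x\<^sub>i\<close>.

  Gaussian integration by parts removes them. The third term is the inner product of the score of
  a row \<open>x\<^sub>i\<close> of \<open>X\<close> with a vector field. So are the first two, for the rows of the Gaussian matrix
  behind the Wishart distribution: \<open>S = \<Sum>\<^sub>i z\<^sub>i z\<^sub>i\<^sup>T\<close> gives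
  \<open>tr (\<Sigma>\<^sup>-\<^sup>1 K A\<^sup>-\<^sup>1 S) = \<Sum>\<^sub>i \<Sigma>\<^sup>-\<^sup>1 z\<^sub>i \<bullet> K A\<^sup>-\<^sup>1 z\<^sub>i\<close>, and neither the density of \<open>S\<close> nor derivatives with
  respect to \<open>S\<close> are involved. As a function of one row, \<open>A\<^sup>-\<^sup>1\<close> is a rank-one update of a fixed
  inverse, so the fields are smooth with bounded derivatives and Stein's identity replaces each term
  by a divergence (\<open>stein_mvn\<close>, \<open>stein_fields\<close>, \<open>integral_by_parts_rows\<close>,
  \<open>integral_by_parts_scatter\<close>). When one of the \<open>n \<ge> p\<close> rows is fixed, the other \<open>n - 1\<close> may not span;
  the missing direction comes from \<open>K\<close> (\<open>AE_pos_def_plus_scatter\<close>).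

  The result is a function of \<open>X\<close> and \<open>S\<close> alone, and it is negative pointwise. Diagonalize
  \<open>S = C (1 - V) C\<^sup>T\<close> and \<open>\<lambda> K = C V C\<^sup>T\<close> with \<open>V = diag (v\<^sub>j)\<close> and \<open>0 \<le> v\<^sub>j < 1\<close>. All traces become
  polynomials in \<open>s = \<Sum> v\<^sub>j\<close>, \<open>q = \<Sum> v\<^sub>j\<^sup>2\<close>, \<open>r = \<Sum> v\<^sub>j\<^sup>3\<close>, and the determinant ratio is
  \<open>\<Prod> (1 + k v\<^sub>j / \<lambda>)\<close>. Since \<open>m - 2 s + q\<close> is the squared Frobenius norm of \<open>I\<^sub>m - \<lambda> X A\<^sup>-\<^sup>1 X\<^sup>T\<close>, it is
  nonnegative (\<open>gap_nonneg\<close>). The bound \<open>c \<ge> c\<^sub>l\<^sub>o\<^sub>w\<close> says \<open>n - p + 2 m + 1 \<le> \<lambda> (n + p - 1)\<close>.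
  Together with \<open>ln (1 + y) \<ge> 2 y / (2 + y)\<close> these give the upper bound
  \<open>- 2 k ((m - s)\<^sup>2 + (m - 2 s + q)) < 0\<close> (\<open>risk_difference_negative\<close>).

  This bounds the expected loss difference, and subtracting risks is legitimate because the risk of
  the usual estimator is finite. The only delicate term is \<open>E (- ln det S)\<close>; it is controlled by
  \<open>E \<bar>det Z\<bar>\<^sup>-\<^sup>1\<^sup>/\<^sup>2 < \<infinity>\<close> for a square Gaussian matrix \<open>Z\<close> (\<open>nn_integral_inv_sqrt_det\<close>), which also shows that
  \<open>S\<close> is almost surely positive definite. Finally, \<open>c\<^sub>l\<^sub>o\<^sub>w < n - 2 m\<close> is equivalent to the stated lower
  bound on \<open>n\<close>, and this leaves room for \<open>c\<close> (\<open>shrinkage_exists\<close>).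
\<close>

section \<open>Symmetric matrices\<close>

lemma matrix_inv_inverse:
  fixes A :: "real ^ 'n ^ 'n"
  assumes "invertible A"
  shows "A ** matrix_inv A = mat 1" "matrix_inv A ** A = mat 1"
  using assms unfolding invertible_def matrix_inv_def
  by (metis (mono_tags, lifting) someI_ex)+

lemma matrix_inv_eqI:
  fixes A :: "real ^ 'n ^ 'n"
  assumes "A ** B = mat 1"
  shows "matrix_inv A = B" "invertible A" "B ** A = mat 1"
proof -
  show BA: "B ** A = mat 1" using assms by (simp add: matrix_left_right_inverse)
  show "invertible A" using assms BA unfolding invertible_def by blast
  then show "matrix_inv A = B"
    by (metis BA matrix_inv_inverse(1) matrix_mul_assoc matrix_mul_lid matrix_mul_rid)
qed

lemma invertible_iff_kernel:
  fixes A :: "real ^ 'n ^ 'n"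
  shows "invertible A \<longleftrightarrow> (\<forall>x. A *v x = 0 \<longrightarrow> x = 0)"
  by (simp add: invertible_left_inverse matrix_left_invertible_ker)

lemma inner_matrix_vector: "x \<bullet> (A *v y) = (transpose A *v x) \<bullet> (y :: real ^ 'n)"
  for A :: "real ^ 'n ^ 'm"
  by (simp add: dot_lmul_matrix)

lemma pos_def_sym: "pos_def A \<Longrightarrow> transpose A = A"
  by (simp add: pos_def_def)

lemma pos_def_pos: "pos_def A \<Longrightarrow> x \<noteq> 0 \<Longrightarrow> 0 < x \<bullet> (A *v x)"
  by (simp add: pos_def_def)

lemma pos_def_nonneg: "pos_def A \<Longrightarrow> 0 \<le> x \<bullet> (A *v x)"
  by (cases "x = 0") (auto simp: pos_def_def less_imp_le)

lemma pos_def_invertible: "pos_def A \<Longrightarrow> invertible A"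
  unfolding invertible_iff_kernel pos_def_def by (metis inner_zero_right less_irrefl)

lemma transpose_matrix_inv:
  fixes A :: "real ^ 'n ^ 'n"
  assumes "invertible A"
  shows "transpose (matrix_inv A) = matrix_inv (transpose A)"
  by (metis assms matrix_inv_eqI(1) matrix_inv_inverse(2) matrix_transpose_mul transpose_mat)

lemma pos_def_matrix_inv:
  assumes "pos_def A"
  shows "pos_def (matrix_inv A)"
proof -
  note inv = pos_def_invertible[OF assms]
  have sym: "transpose (matrix_inv A) = matrix_inv A"
    using transpose_matrix_inv[OF inv] assms by (simp add: pos_def_sym)
  moreover have "0 < x \<bullet> (matrix_inv A *v x)" if "x \<noteq> 0" for x
  proof -
    define y where "y = matrix_inv A *v x"
    have x: "x = A *v y"
      unfolding y_def by (simp add: matrix_vector_mul_assoc matrix_inv_inverse[OF inv])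
    with that have "y \<noteq> 0" by auto
    then have "0 < y \<bullet> (A *v y)" using assms by (simp add: pos_def_pos)
    then show ?thesis by (metis x y_def inner_commute)
  qed
  ultimately show ?thesis by (simp add: pos_def_def)
qed

definition diag_mat :: "real ^ 'n \<Rightarrow> real ^ 'n ^ 'n" where
  "diag_mat d = (\<chi> i j. if i = j then d $ i else 0)"

lemma diag_mat_mult: "diag_mat a ** diag_mat b = diag_mat (\<chi> i. a $ i * b $ i)"
  unfolding diag_mat_def matrix_matrix_mult_def
  by (simp add: vec_eq_iff if_distrib[where f = "\<lambda>x. x * _"] cong: if_cong)

lemma diag_mat_vector: "diag_mat d *v x = (\<chi> i. d $ i * x $ i)"
  unfolding diag_mat_def matrix_vector_mult_def
  by (simp add: vec_eq_iff if_distrib[where f = "\<lambda>x. x * _"] cong: if_cong)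

lemma transpose_diag_mat [simp]: "transpose (diag_mat d) = diag_mat d"
  unfolding diag_mat_def transpose_def by (simp add: vec_eq_iff)

lemma trace_diag_mat: "trace (diag_mat d) = (\<Sum>i\<in>UNIV. d $ i)"
  unfolding diag_mat_def trace_def by simp

lemma det_diag_mat: "det (diag_mat d) = (\<Prod>i\<in>UNIV. d $ i)"
  by (subst det_diagonal) (auto simp: diag_mat_def)

lemma diag_mat_one: "(\<And>i. d $ i = 1) \<Longrightarrow> diag_mat d = mat 1"
  unfolding diag_mat_def mat_def by (simp add: vec_eq_iff)

lemma diag_mat_add: "diag_mat a + diag_mat b = diag_mat (a + b)"
  unfolding diag_mat_def by (simp add: vec_eq_iff)

lemma diag_mat_scaleR: "c *\<^sub>R diag_mat a = diag_mat (c *\<^sub>R a)"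
  unfolding diag_mat_def by (simp add: vec_eq_iff)

text \<open>
  A vector maximizing the quadratic form on the unit sphere of the orthogonal complement of known
  eigenvectors is again an eigenvector: the first variation of the Rayleigh quotient vanishes, and
  the complement is invariant.
\<close>

lemma extend_orthonormal_eigenvectors:
  fixes A :: "real ^ 'n ^ 'n"
  assumes sym: "transpose A = A"
    and B: "finite B" "card B < CARD('n)" "\<And>b. b \<in> B \<Longrightarrow> \<exists>c. A *v b = c *\<^sub>R b"
  shows "\<exists>v. norm v = 1 \<and> (\<forall>b\<in>B. orthogonal b v) \<and> (\<exists>c. A *v v = c *\<^sub>R v)"
proof -
  define W where "W = {y. \<forall>b\<in>B. orthogonal b y}"
  have Wadd: "x + t *\<^sub>R y \<in> W" if "x \<in> W" "y \<in> W" for x y t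
    using that by (simp add: W_def orthogonal_def inner_add_right)
  have "dim B < DIM(real ^ 'n)"
    using B dim_le_card'[of B] by simp
  then obtain w where w: "w \<noteq> 0" "\<And>y. y \<in> span B \<Longrightarrow> orthogonal w y"
    using orthogonal_to_subspace_exists[of B] by blast
  have wW: "w \<in> W"
    using w(2) by (auto simp: W_def orthogonal_commute span_base)
  have "closed W"
    unfolding W_def orthogonal_def Collect_ball_eq
    by (intro closed_INT ballI closed_Collect_eq continuous_intros)
  then have "compact (W \<inter> sphere 0 1)" by (simp add: closed_Int_compact)
  moreover have cont: "continuous_on (W \<inter> sphere 0 1) (\<lambda>y. y \<bullet> (A *v y))"
    by (intro continuous_intros matrix_vector_mult_linear_continuous_on)
  moreover have "w /\<^sub>R norm w \<in> W \<inter> sphere 0 1"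
    using wW w(1) by (simp add: W_def orthogonal_def)
  ultimately obtain v where v: "v \<in> W" "norm v = 1"
    and max: "\<And>y. y \<in> W \<Longrightarrow> norm y = 1 \<Longrightarrow> y \<bullet> (A *v y) \<le> v \<bullet> (A *v v)"
    using continuous_attains_sup[of "W \<inter> sphere 0 1" "\<lambda>y. y \<bullet> (A *v y)"] cont by fastforce
  define \<mu> where "\<mu> = v \<bullet> (A *v v)"
  have le: "y \<bullet> (A *v y) \<le> \<mu> * (y \<bullet> y)" if "y \<in> W" for y
  proof (cases "y = 0")
    case False
    have "(y /\<^sub>R norm y) \<bullet> (A *v (y /\<^sub>R norm y)) \<le> \<mu>"
      unfolding \<mu>_def using that False by (intro max) (auto simp: W_def orthogonal_def)
    then have "y \<bullet> (A *v y) / (norm y)\<^sup>2 \<le> \<mu>"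
      by (simp add: matrix_vector_mult_scaleR power2_eq_square divide_simps)
    then show ?thesis using False by (simp add: divide_simps power2_norm_eq_inner)
  qed simp
  define z where "z = A *v v - \<mu> *\<^sub>R v"
  have symA: "x \<bullet> (A *v y) = y \<bullet> (A *v x)" for x y
    by (metis inner_commute inner_matrix_vector sym)
  have zW: "z \<in> W"
  proof -
    have "b \<bullet> (A *v v) = 0" if "b \<in> B" for b
    proof -
      obtain c where c: "A *v b = c *\<^sub>R b" using B(3) \<open>b \<in> B\<close> by blast
      have "b \<bullet> (A *v v) = v \<bullet> (A *v b)" by (rule symA)
      also have "\<dots> = 0" using v(1) that by (simp add: c W_def orthogonal_def inner_commute)
      finally show ?thesis .
    qed
    then show ?thesis using v(1) by (simp add: W_def z_def orthogonal_def inner_diff_right)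
  qed
  have "z = 0"
  proof (rule ccontr)
    assume "z \<noteq> 0"
    \<comment> \<open>Along v + t z the linear term 2 t (z \<bullet> z) wins over t^2 q once t is this small.\<close>
    define q where "q = z \<bullet> (A *v z) - \<mu> * (z \<bullet> z)"
    define t where "t = (z \<bullet> z) / (1 + \<bar>q\<bar>)"
    have zz: "z \<bullet> z > 0" using \<open>z \<noteq> 0\<close> by simp
    have "(v + t *\<^sub>R z) \<bullet> (A *v (v + t *\<^sub>R z)) \<le> \<mu> * ((v + t *\<^sub>R z) \<bullet> (v + t *\<^sub>R z))"
      by (intro le Wadd v zW)
    then have "2 * t * (z \<bullet> (A *v v) - \<mu> * (z \<bullet> v)) + t\<^sup>2 * q \<le> 0"
      using symA[of v z] v(2)
      by (simp add: matrix_vector_right_distrib matrix_vector_mult_scaleR inner_add_left inner_add_right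
          q_def \<mu>_def algebra_simps power2_eq_square inner_commute norm_eq_1)
    moreover have "z \<bullet> (A *v v) - \<mu> * (z \<bullet> v) = z \<bullet> z"
      by (simp add: z_def inner_diff_right inner_diff_left)
    ultimately have "t * (2 * (z \<bullet> z) + t * q) \<le> 0" by (simp add: algebra_simps power2_eq_square)
    moreover have "t > 0" using zz by (simp add: t_def add_pos_nonneg)
    moreover have "\<bar>t * q\<bar> \<le> z \<bullet> z"
      using zz by (simp add: t_def abs_mult divide_simps algebra_simps)
    ultimately show False using zz
      by (smt (verit) zero_less_mult_iff)
  qed
  then have "A *v v = \<mu> *\<^sub>R v" by (simp add: z_def)
  then show ?thesis using v by (auto simp: W_def)
qed

lemma orthonormal_eigenvectors:
  fixes A :: "real ^ 'n ^ 'n"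
  assumes "transpose A = A" "k \<le> CARD('n)"
  shows "\<exists>B. finite B \<and> card B = k \<and> (\<forall>b\<in>B. norm b = 1 \<and> (\<exists>c. A *v b = c *\<^sub>R b)) \<and>
    (\<forall>b\<in>B. \<forall>b'\<in>B. b \<noteq> b' \<longrightarrow> b \<bullet> b' = 0)"
  using assms(2)
proof (induction k)
  case (Suc k)
  then obtain B where B: "finite B" "card B = k"
    "\<And>b. b \<in> B \<Longrightarrow> norm b = 1 \<and> (\<exists>c. A *v b = c *\<^sub>R b)"
    "\<And>b b'. b \<in> B \<Longrightarrow> b' \<in> B \<Longrightarrow> b \<noteq> b' \<Longrightarrow> b \<bullet> b' = 0" by auto
  obtain v where v: "norm v = 1" "\<And>b. b \<in> B \<Longrightarrow> b \<bullet> v = 0" "\<exists>c. A *v v = c *\<^sub>R v"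
    using extend_orthonormal_eigenvectors[OF assms(1) B(1)] B Suc.prems
    by (auto simp: orthogonal_def)
  have "v \<notin> B" using v(1) v(2)[of v] by (auto simp: norm_eq_1)
  then have "card (insert v B) = Suc k" using B by simp
  moreover have "b \<bullet> b' = 0" if "b \<in> insert v B" "b' \<in> insert v B" "b \<noteq> b'" for b b'
    using that B(4) v(2) by (auto simp: inner_commute)
  ultimately show ?case using B(1,3) v
    by (intro exI[of _ "insert v B"]) auto
qed (auto intro: exI[of _ "{}"])

theorem spectral_theorem:
  fixes A :: "real ^ 'n ^ 'n"
  assumes "transpose A = A"
  shows "\<exists>(U :: real ^ 'n ^ 'n) d. transpose U ** U = mat 1 \<and> A = U ** diag_mat d ** transpose U"
proof -
  obtain B where B: "finite B" "card B = CARD('n)"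
    "\<And>b. b \<in> B \<Longrightarrow> norm b = 1 \<and> (\<exists>c. A *v b = c *\<^sub>R b)"
    "\<And>b b'. b \<in> B \<Longrightarrow> b' \<in> B \<Longrightarrow> b \<noteq> b' \<Longrightarrow> b \<bullet> b' = 0"
    using orthonormal_eigenvectors[OF assms order_refl] by metis
  obtain f :: "'n \<Rightarrow> real ^ 'n" where f: "bij_betw f UNIV B"
    using finite_same_card_bij[of "UNIV :: 'n set" B] B by auto
  have fB: "f i \<in> B" for i using f by (auto simp: bij_betw_def)
  have inj: "f i = f j \<longleftrightarrow> i = j" for i j using f by (auto simp: bij_betw_def inj_on_def)
  obtain d where d: "\<And>i. A *v f i = d i *\<^sub>R f i" using B(3)[OF fB] by metis
  define U :: "real ^ 'n ^ 'n" where "U = (\<chi> i j. f j $ i)"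
  have "(transpose U ** U) $ i $ j = (mat 1 :: real ^ 'n ^ 'n) $ i $ j" for i j
  proof -
    have "(transpose U ** U) $ i $ j = f i \<bullet> f j"
      by (simp add: U_def transpose_def matrix_matrix_mult_def inner_vec_def)
    also have "\<dots> = (if i = j then 1 else 0)"
      using B(3)[OF fB] B(4)[OF fB fB] inj by (auto simp: norm_eq_1)
    finally show ?thesis by (simp add: mat_def)
  qed
  then have 1: "transpose U ** U = mat 1" by (simp add: vec_eq_iff)
  have "(A ** U) $ i $ j = (U ** diag_mat (\<chi> i. d i)) $ i $ j" for i j
  proof -
    have "(A ** U) $ i $ j = (A *v f j) $ i"
      by (simp add: U_def matrix_matrix_mult_def matrix_vector_mult_def)
    also have "\<dots> = d j * f j $ i" by (simp add: d)
    also have "\<dots> = (U ** diag_mat (\<chi> i. d i)) $ i $ j"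
      by (simp add: U_def diag_mat_def matrix_matrix_mult_def if_distrib[where f = "\<lambda>x. _ * x"]
          cong: if_cong)
    finally show ?thesis .
  qed
  then have "A ** U = U ** diag_mat (\<chi> i. d i)" by (simp add: vec_eq_iff)
  moreover have "U ** transpose U = mat 1" using 1 by (simp add: matrix_left_right_inverse)
  ultimately have "A = U ** diag_mat (\<chi> i. d i) ** transpose U"
    by (metis matrix_mul_assoc matrix_mul_rid)
  then show ?thesis using 1 by blast
qed

lemma congruent_diag_entry:
  fixes C Ci :: "real ^ 'n ^ 'n"
  assumes "Ci ** C = mat 1" "S = C ** diag_mat d ** transpose C"
  shows "d $ i = (transpose Ci *v axis i 1) \<bullet> (S *v (transpose Ci *v axis i 1))"
proof -
  have "transpose C ** transpose Ci = mat 1"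
    using assms(1) by (metis matrix_transpose_mul transpose_mat)
  then have "transpose C *v (transpose Ci *v axis i 1) = axis i 1"
    by (metis matrix_vector_mul_assoc matrix_vector_mul_lid)
  then have "S *v (transpose Ci *v axis i 1) = C *v (diag_mat d *v axis i 1)"
    unfolding assms(2) by (metis matrix_vector_mul_assoc)
  then have "(transpose Ci *v axis i 1) \<bullet> (S *v (transpose Ci *v axis i 1)) =
      axis i 1 \<bullet> (diag_mat d *v axis i 1)"
    by (metis \<open>transpose C *v (transpose Ci *v axis i 1) = axis i 1\<close> inner_matrix_vector)
  then show ?thesis by (simp add: diag_mat_vector inner_axis')
qed

text \<open>
  With \<open>A = U r\<^sup>2 U\<^sup>T\<close> from the spectral theorem, the coordinates \<open>C0 = U r\<close> turn \<open>A\<close> into the identity;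
  \<open>S\<close> is then diagonalized orthogonally in these coordinates.
\<close>

theorem simultaneous_diagonalization:
  fixes A S :: "real ^ 'n ^ 'n"
  assumes A: "pos_def A" and S: "transpose S = S"
  shows "\<exists>(C :: real ^ 'n ^ 'n) Ci d. C ** Ci = mat 1 \<and> Ci ** C = mat 1 \<and> A = C ** transpose C \<and>
    S = C ** diag_mat d ** transpose C"
proof -
  obtain U :: "real ^ 'n ^ 'n" and a where U: "transpose U ** U = mat 1" and A_eq: "A = U ** diag_mat a ** transpose U"
    using spectral_theorem[OF pos_def_sym[OF A]] by blast
  have UU: "U ** transpose U = mat 1" using U by (simp add: matrix_left_right_inverse)
  have "a $ i > 0" for i
  proof -
    have "transpose (transpose U) *v axis i 1 \<noteq> 0"
      by (metis U axis_eq_0_iff invertible_def invertible_iff_kernel matrix_left_right_inverse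
          transpose_transpose zero_neq_one)
    then show ?thesis
      unfolding congruent_diag_entry[OF U A_eq] using pos_def_pos[OF A] by blast
  qed
  then have a: "a $ i > 0" "sqrt (a $ i) > 0" for i by auto
  define r where "r = diag_mat (\<chi> i. sqrt (a $ i))"
  define ri where "ri = diag_mat (\<chi> i. 1 / sqrt (a $ i))"
  have r: "r ** ri = mat 1" "ri ** r = mat 1"
    unfolding r_def ri_def diag_mat_mult using a(2)[THEN less_imp_neq, symmetric]
    by (auto intro!: diag_mat_one)
  have rr: "r ** r = diag_mat a"
    unfolding r_def diag_mat_mult
    by (intro arg_cong[where f = diag_mat]) (simp add: vec_eq_iff less_imp_le[OF a(1)])
  define C0 where "C0 = U ** r"
  define Ci0 where "Ci0 = ri ** transpose U"
  have c0: "C0 ** Ci0 = mat 1"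
    unfolding C0_def Ci0_def by (metis UU matrix_mul_assoc matrix_mul_rid r(1))
  then have c0': "Ci0 ** C0 = mat 1" by (simp add: matrix_left_right_inverse)
  have "transpose r = r" by (simp add: r_def)
  then have AC0: "A = C0 ** transpose C0"
    unfolding A_eq C0_def rr[symmetric] by (simp add: matrix_transpose_mul matrix_mul_assoc)
  define T where "T = Ci0 ** S ** transpose Ci0"
  have "transpose T = T" unfolding T_def by (simp add: matrix_transpose_mul S matrix_mul_assoc)
  then obtain V :: "real ^ 'n ^ 'n" and d where V: "transpose V ** V = mat 1" and T: "T = V ** diag_mat d ** transpose V"
    using spectral_theorem by blast
  have VV: "V ** transpose V = mat 1" using V by (simp add: matrix_left_right_inverse)
  have tC: "transpose Ci0 ** transpose C0 = mat 1"
    using c0 by (metis matrix_transpose_mul transpose_mat)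
  have "S = C0 ** T ** transpose C0"
    unfolding T_def by (metis c0 tC matrix_mul_assoc matrix_mul_lid matrix_mul_rid)
  then have "S = (C0 ** V) ** diag_mat d ** transpose (C0 ** V)"
    by (simp add: T matrix_transpose_mul matrix_mul_assoc)
  moreover have "A = (C0 ** V) ** transpose (C0 ** V)"
    unfolding AC0 matrix_transpose_mul by (metis VV matrix_mul_assoc matrix_mul_rid)
  moreover have "(C0 ** V) ** (transpose V ** Ci0) = mat 1"
    by (metis VV c0 matrix_mul_assoc matrix_mul_rid)
  moreover have "(transpose V ** Ci0) ** (C0 ** V) = mat 1"
    by (metis V c0' matrix_mul_assoc matrix_mul_rid)
  ultimately show ?thesis by blast
qed

lemma pos_def_factorization:
  fixes A :: "real ^ 'n ^ 'n"
  assumes "pos_def A"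
  obtains C :: "real ^ 'n ^ 'n" where "invertible C" "A = C ** transpose C"
  using simultaneous_diagonalization[OF assms pos_def_sym[OF assms]] unfolding invertible_def by blast

lemma pos_def_congruence:
  fixes C Ci :: "real ^ 'n ^ 'n"
  assumes "C ** Ci = mat 1" and d: "\<And>i. d $ i > 0"
  shows "pos_def (C ** diag_mat d ** transpose C)"
proof -
  have "0 < x \<bullet> ((C ** diag_mat d ** transpose C) *v x)" if "x \<noteq> 0" for x
  proof -
    define y where "y = transpose C *v x"
    have "transpose Ci *v y = x"
      unfolding y_def by (metis assms(1) matrix_transpose_mul matrix_vector_mul_assoc
          matrix_vector_mul_lid transpose_mat)
    then have "y \<noteq> 0" using that by auto
    then obtain j where j: "y $ j \<noteq> 0" by (auto simp: vec_eq_iff)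
    have "x \<bullet> ((C ** diag_mat d ** transpose C) *v x) = y \<bullet> (diag_mat d *v y)"
      unfolding y_def by (simp only: matrix_vector_mul_assoc[symmetric] inner_matrix_vector[of x C])
    also have "\<dots> = (\<Sum>i\<in>UNIV. d $ i * (y $ i)\<^sup>2)"
      by (simp add: diag_mat_vector inner_vec_def power2_eq_square mult_ac)
    also have "\<dots> > 0"
      using d j by (intro sum_pos2[of _ j]) (auto simp: less_imp_le)
    finally show ?thesis .
  qed
  then show ?thesis unfolding pos_def_def by (simp add: matrix_transpose_mul matrix_mul_assoc)
qed

lemma det_pos_def: "pos_def A \<Longrightarrow> det A > 0" for A :: "real ^ 'n ^ 'n"
proof -
  assume A: "pos_def A"
  obtain C :: "real ^ 'n ^ 'n" where C: "invertible C" "A = C ** transpose C"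
    by (rule pos_def_factorization[OF A])
  then have "det A = det C * det C" "det C \<noteq> 0"
    by (simp_all add: det_mul invertible_det_nz)
  then show ?thesis by (auto simp: zero_less_mult_iff linorder_neq_iff)
qed

section \<open>The matrix pencil of the two quadratic forms\<close>

lemma trace_scaleR: "trace (c *\<^sub>R A) = c * trace (A :: real ^ 'n ^ 'n)"
  by (simp add: trace_def sum_distrib_left)

lemma transpose_add: "transpose (A + B) = transpose A + transpose B"
  by (simp add: transpose_def vec_eq_iff)

lemma bounded_bilinear_matrix_mult:
  "bounded_bilinear ((**) :: real ^ 'n ^ 'm \<Rightarrow> real ^ 'k ^ 'n \<Rightarrow> real ^ 'k ^ 'm)"
  unfolding bilinear_conv_bounded_bilinear[symmetric] bilinear_def linear_iff
  by (simp add: vec_eq_iff matrix_matrix_mult_def sum.distrib sum_distrib_left algebra_simps)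

interpretation matrix_mult: bounded_bilinear "(**) :: real ^ 'n ^ 'm \<Rightarrow> real ^ 'k ^ 'n \<Rightarrow> real ^ 'k ^ 'm"
  by (rule bounded_bilinear_matrix_mult)

lemma bounded_bilinear_matrix_vector_mult:
  "bounded_bilinear ((*v) :: real ^ 'n ^ 'm \<Rightarrow> real ^ 'n \<Rightarrow> real ^ 'm)"
  unfolding bilinear_conv_bounded_bilinear[symmetric] bilinear_def linear_iff
  by (simp add: vec_eq_iff matrix_vector_mult_def sum.distrib sum_distrib_left algebra_simps)

interpretation matrix_vector: bounded_bilinear "(*v) :: real ^ 'n ^ 'm \<Rightarrow> real ^ 'n \<Rightarrow> real ^ 'm"
  by (rule bounded_bilinear_matrix_vector_mult)

text \<open>
  The \<open>v\<^sub>j\<close> are the eigenvalues of \<open>\<lambda> K\<close> relative to \<open>A = S + \<lambda> K\<close>. Every alternating product of \<open>K\<close>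
  or \<open>S\<close> with the inverse of \<open>A\<close> is diagonal in the frame \<open>C\<close>, so that its trace is a combination of
  the power sums \<open>s\<close>, \<open>q\<close>, \<open>r\<close> and matrix inequalities reduce to inequalities between the \<open>v\<^sub>j\<close>.
\<close>

locale diagonal_pencil =
  fixes C Ci :: "real ^ 'p ^ 'p" and v :: "real ^ 'p" and lam :: real and S K A :: "real ^ 'p ^ 'p"
  assumes A_def: "A = S + lam *\<^sub>R K" and C_Ci: "C ** Ci = mat 1" and Ci_C: "Ci ** C = mat 1"
    and S_eq: "S = C ** diag_mat (1 - v) ** transpose C"
    and K_eq: "K = C ** diag_mat (v /\<^sub>R lam) ** transpose C"
    and lam_pos: "lam > 0" and v_nonneg: "\<And>j. 0 \<le> v $ j" and v_less: "\<And>j. v $ j < 1"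
begin

definition "s = (\<Sum>j\<in>UNIV. v $ j)"
definition "q = (\<Sum>j\<in>UNIV. (v $ j)\<^sup>2)"
definition "r = (\<Sum>j\<in>UNIV. (v $ j) ^ 3)"

lemma lam_K: "lam *\<^sub>R K = C ** diag_mat v ** transpose C"
proof -
  have "diag_mat (v /\<^sub>R lam) = (1 / lam) *\<^sub>R diag_mat v"
    by (simp add: diag_mat_scaleR divide_inverse)
  then show ?thesis
    using lam_pos by (simp add: K_eq matrix_mult.scaleR_left matrix_mult.scaleR_right)
qed

lemma A_eq: "A = C ** transpose C"
proof -
  have "A = C ** (diag_mat (1 - v) + diag_mat v) ** transpose C"
    unfolding A_def lam_K S_eq by (simp add: matrix_mult.add_right matrix_mult.add_left)
  also have "diag_mat (1 - v) + diag_mat v = mat 1"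
    unfolding diag_mat_add by (rule diag_mat_one) simp
  finally show ?thesis by simp
qed

lemma tC_tCi: "transpose C ** transpose Ci = mat 1"
  using Ci_C by (metis matrix_transpose_mul transpose_mat)

lemma A_inv: "matrix_inv A = transpose Ci ** Ci"
proof (rule matrix_inv_eqI(1))
  show "A ** (transpose Ci ** Ci) = mat 1"
    unfolding A_eq by (metis C_Ci matrix_mul_assoc matrix_mul_rid tC_tCi)
qed

abbreviation "Ai \<equiv> matrix_inv A"

lemma pd_A: "pos_def A"
proof -
  have "A = C ** diag_mat 1 ** transpose C" by (simp add: A_eq diag_mat_one)
  then show ?thesis using pos_def_congruence[OF C_Ci, of 1] by simp
qed

lemma pd_S: "pos_def S"
  unfolding S_eq by (rule pos_def_congruence[OF C_Ci]) (simp add: v_less)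

lemma diag_Ai: "C ** diag_mat d ** transpose C ** Ai = C ** diag_mat d ** Ci"
  unfolding A_inv by (metis matrix_mul_assoc matrix_mul_rid tC_tCi)

lemma diag_diag: "(C ** diag_mat a ** Ci) ** (C ** diag_mat b ** M) = C ** diag_mat (\<chi> i. a $ i * b $ i) ** M"
  unfolding diag_mat_mult[symmetric] by (metis Ci_C matrix_mul_assoc matrix_mul_rid)

lemma KA: "K ** Ai = C ** diag_mat (v /\<^sub>R lam) ** Ci"
  unfolding K_eq by (rule diag_Ai)

lemma SA: "S ** Ai = C ** diag_mat (1 - v) ** Ci"
  unfolding S_eq by (rule diag_Ai)

lemma KAS: "K ** Ai ** S = C ** diag_mat (\<chi> j. v $ j * (1 - v $ j) / lam) ** transpose C"
  unfolding KA
  apply (subst S_eq, unfold diag_diag)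
  by (rule arg_cong[where f = "\<lambda>d. C ** diag_mat d ** transpose C"])
    (simp add: vec_eq_iff divide_inverse power2_eq_square power4_eq_xxxx mult_ac)

lemma KAK: "K ** Ai ** K = C ** diag_mat (\<chi> j. (v $ j)\<^sup>2 / lam\<^sup>2) ** transpose C"
  unfolding KA
  apply (subst K_eq, unfold diag_diag)
  by (rule arg_cong[where f = "\<lambda>d. C ** diag_mat d ** transpose C"])
    (simp add: vec_eq_iff divide_inverse power2_eq_square power4_eq_xxxx mult_ac)

lemma KAKAS: "K ** Ai ** K ** Ai ** S = C ** diag_mat (\<chi> j. (v $ j)\<^sup>2 * (1 - v $ j) / lam\<^sup>2) ** transpose C"
  unfolding KAK diag_Ai
  apply (subst S_eq, unfold diag_diag)
  by (rule arg_cong[where f = "\<lambda>d. C ** diag_mat d ** transpose C"])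
    (simp add: vec_eq_iff divide_inverse power2_eq_square power4_eq_xxxx mult_ac)

lemma SAKAS: "S ** Ai ** K ** Ai ** S = C ** diag_mat (\<chi> j. v $ j * (1 - v $ j)\<^sup>2 / lam) ** transpose C"
  unfolding SA
  apply (subst K_eq, unfold diag_diag diag_Ai, subst S_eq, unfold diag_diag)
  by (rule arg_cong[where f = "\<lambda>d. C ** diag_mat d ** transpose C"])
    (simp add: vec_eq_iff divide_inverse power2_eq_square power4_eq_xxxx mult_ac)

lemma KASAK: "K ** Ai ** S ** Ai ** K = C ** diag_mat (\<chi> j. (v $ j)\<^sup>2 * (1 - v $ j) / lam\<^sup>2) ** transpose C"
  unfolding KAS diag_Ai
  apply (subst K_eq, unfold diag_diag)
  by (rule arg_cong[where f = "\<lambda>d. C ** diag_mat d ** transpose C"])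
    (simp add: vec_eq_iff divide_inverse power2_eq_square power4_eq_xxxx mult_ac)

lemma KAKASAKAK: "K ** Ai ** K ** Ai ** S ** Ai ** K ** Ai ** K =
    C ** diag_mat (\<chi> j. (v $ j) ^ 4 * (1 - v $ j) / lam ^ 4) ** transpose C"
  unfolding KAKAS diag_Ai
  apply (subst K_eq, unfold diag_diag diag_Ai, subst K_eq, unfold diag_diag)
  by (rule arg_cong[where f = "\<lambda>d. C ** diag_mat d ** transpose C"])
    (simp add: vec_eq_iff divide_inverse power2_eq_square power4_eq_xxxx mult_ac)

lemma trace_diag: "trace (C ** diag_mat d ** Ci) = (\<Sum>j\<in>UNIV. d $ j)"
  using trace_mul_sym[of "C ** diag_mat d" Ci]
  by (simp add: matrix_mul_assoc Ci_C trace_diag_mat)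

lemma trace_KA: "trace (K ** Ai) = s / lam"
  unfolding KA trace_diag s_def by (simp add: sum_distrib_left divide_inverse mult.commute)

lemma trace_SA: "trace (S ** Ai) = CARD('p) - s"
  unfolding SA trace_diag s_def by (simp add: sum_subtractf)

lemma trace_KASA: "trace (K ** Ai ** S ** Ai) = (s - q) / lam"
  unfolding KAS diag_Ai trace_diag s_def q_def
  by (simp add: sum_divide_distrib power2_eq_square algebra_simps sum_subtractf diff_divide_distrib)

lemma trace_KAKA: "trace (K ** Ai ** K ** Ai) = q / lam\<^sup>2"
  unfolding KAK diag_Ai trace_diag q_def by (simp add: sum_divide_distrib)

lemma trace_KAKASA: "trace (K ** Ai ** K ** Ai ** S ** Ai) = (q - r) / lam\<^sup>2"
  unfolding KAKAS diag_Ai trace_diag q_def r_def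
  by (simp add: sum_divide_distrib power2_eq_square power3_eq_cube algebra_simps sum_subtractf
      diff_divide_distrib)

lemma det_ratio: "det (S + k *\<^sub>R (K ** Ai ** S)) = (\<Prod>j\<in>UNIV. 1 + k / lam * v $ j) * det S"
proof -
  have "C ** diag_mat (1 + (k / lam) *\<^sub>R v) ** Ci = mat 1 + k *\<^sub>R (K ** Ai)"
  proof -
    have "diag_mat (1 + (k / lam) *\<^sub>R v) = mat 1 + k *\<^sub>R diag_mat (v /\<^sub>R lam)"
      unfolding diag_mat_scaleR by (simp add: diag_mat_add[symmetric] diag_mat_one divide_inverse)
    then show ?thesis
      by (simp add: KA matrix_mult.add_right matrix_mult.add_left C_Ci matrix_mult.scaleR_left matrix_mult.scaleR_right)
  qed
  then have "S + k *\<^sub>R (K ** Ai ** S) = (C ** diag_mat (1 + (k / lam) *\<^sub>R v) ** Ci) ** S"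
    by (simp add: matrix_mult.add_left matrix_mult.scaleR_left)
  then have "det (S + k *\<^sub>R (K ** Ai ** S)) = det (C ** Ci) * det (diag_mat (1 + (k / lam) *\<^sub>R v)) * det S"
    by (simp add: det_mul)
  then show ?thesis by (simp add: C_Ci det_diag_mat)
qed

lemma pd_shrunk: "0 \<le> k \<Longrightarrow> pos_def (S + k *\<^sub>R (K ** Ai ** S))"
proof -
  assume k: "0 \<le> k"
  have "S + k *\<^sub>R (K ** Ai ** S) =
      C ** diag_mat ((1 - v) + k *\<^sub>R (\<chi> j. v $ j * (1 - v $ j) / lam)) ** transpose C"
    unfolding KAS diag_mat_add[symmetric] diag_mat_scaleR[symmetric]
    by (simp add: S_eq matrix_mult.add_right matrix_mult.add_left matrix_mult.scaleR_left matrix_mult.scaleR_right)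
  moreover have "pos_def \<dots>"
    using k v_less v_nonneg lam_pos
    by (intro pos_def_congruence[OF C_Ci]) (auto intro!: add_pos_nonneg simp: less_imp_le)
  ultimately show ?thesis by simp
qed

text \<open>The trace is the sum of the \<open>d\<^sub>j\<close> weighted by the values of the form \<open>M\<close> at the columns of \<open>C\<close>.\<close>

lemma trace_diag_mono:
  assumes M: "\<And>x. 0 \<le> x \<bullet> (M *v x)" and "\<And>j. a $ j \<le> b $ j"
  shows "trace (M ** (C ** diag_mat a ** transpose C)) \<le> trace (M ** (C ** diag_mat b ** transpose C))"
proof -
  have *: "trace (M ** (C ** diag_mat d ** transpose C)) =
      (\<Sum>j\<in>UNIV. d $ j * (column j C \<bullet> (M *v column j C)))" for d
  proof -
    have "trace (M ** (C ** diag_mat d ** transpose C)) = trace (transpose C ** M ** C ** diag_mat d)"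
      using trace_mul_sym[of "M ** C ** diag_mat d" "transpose C"] by (simp add: matrix_mul_assoc)
    also have "\<dots> = (\<Sum>j\<in>UNIV. (transpose C ** M ** C) $ j $ j * d $ j)"
      unfolding trace_def
      by (subst matrix_matrix_mult_def)
        (simp add: diag_mat_def if_distrib[where f = "\<lambda>x. _ * x"] cong: if_cong)
    also have "\<dots> = (\<Sum>j\<in>UNIV. d $ j * (column j C \<bullet> (M *v column j C)))"
    proof (rule sum.cong)
      fix j
      have "(transpose C ** (M ** C)) $ j $ j = column j C \<bullet> (M *v column j C)"
        by (simp add: matrix_matrix_mult_def matrix_vector_mult_def column_def transpose_def inner_vec_def)
      then show "(transpose C ** M ** C) $ j $ j * d $ j = d $ j * (column j C \<bullet> (M *v column j C))"
        by (simp add: matrix_mul_assoc)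
    qed simp
    finally show ?thesis .
  qed
  show ?thesis unfolding * using assms by (intro sum_mono mult_right_mono) auto
qed

lemma q_le_s: "q \<le> s"
  unfolding q_def s_def using v_nonneg v_less
  by (intro sum_mono) (simp add: power2_eq_square mult_left_le less_imp_le)

lemma q_less_s: "s \<noteq> 0 \<Longrightarrow> q < s"
proof -
  assume "s \<noteq> 0"
  then obtain j where "v $ j \<noteq> 0" unfolding s_def by (meson sum.neutral)
  then have "v $ j * v $ j < v $ j" using v_nonneg[of j] v_less[of j]
    by (simp add: mult_less_cancel_left2)
  then show "q < s"
    unfolding q_def s_def using v_nonneg v_less
    by (intro sum_strict_mono_ex1) (auto simp: power2_eq_square mult_left_le less_imp_le)
qed

lemma r_le_q: "r \<le> q"
  unfolding q_def r_def using v_nonneg v_less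
  by (intro sum_mono) (simp add: power2_eq_square power3_eq_cube mult_left_le mult_nonneg_nonneg less_imp_le)

lemma r_nonneg: "0 \<le> r"
  unfolding r_def using v_nonneg by (intro sum_nonneg) simp

lemma s_le: "s \<le> CARD('p)"
  unfolding s_def using sum_mono[of UNIV "\<lambda>j. v $ j" "\<lambda>_. 1"] v_less by (simp add: less_imp_le)

lemma quad_diag: "x \<bullet> ((transpose Ci ** diag_mat d ** Ci) *v x) = (\<Sum>j\<in>UNIV. d $ j * ((Ci *v x) $ j)\<^sup>2)"
proof -
  have "x \<bullet> ((transpose Ci ** diag_mat d ** Ci) *v x) = (Ci *v x) \<bullet> (diag_mat d *v (Ci *v x))"
    by (simp only: matrix_vector_mul_assoc[symmetric] inner_matrix_vector[of x] transpose_transpose)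
  then show ?thesis by (simp add: diag_mat_vector inner_vec_def power2_eq_square mult_ac)
qed

lemma Ai_diag: "Ai ** (C ** diag_mat d ** Ci) = transpose Ci ** diag_mat d ** Ci"
proof -
  have "Ai ** (C ** diag_mat d ** Ci) = transpose Ci ** (Ci ** C) ** diag_mat d ** Ci"
    unfolding A_inv by (simp only: matrix_mul_assoc)
  then show ?thesis by (simp only: Ci_C matrix_mul_rid)
qed

lemma AKA: "Ai ** K ** Ai = transpose Ci ** diag_mat (v /\<^sub>R lam) ** Ci"
proof -
  have "Ai ** K ** Ai = Ai ** (K ** Ai)" by (simp only: matrix_mul_assoc)
  then show ?thesis unfolding KA Ai_diag .
qed

lemma AKAKA: "Ai ** K ** Ai ** K ** Ai = transpose Ci ** diag_mat (\<chi> j. (v $ j)\<^sup>2 / lam\<^sup>2) ** Ci"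
proof -
  have "Ai ** K ** Ai ** K ** Ai = Ai ** (K ** Ai ** K ** Ai)" by (simp only: matrix_mul_assoc)
  then show ?thesis unfolding KAK diag_Ai Ai_diag .
qed

lemma quad_A: "x \<bullet> (Ai *v x) = (\<Sum>j\<in>UNIV. ((Ci *v x) $ j)\<^sup>2)"
  using quad_diag[of x 1] by (simp add: A_inv diag_mat_one)

lemma quad_AKA:
  shows "0 \<le> x \<bullet> ((Ai ** K ** Ai) *v x)" "x \<bullet> ((Ai ** K ** Ai) *v x) \<le> x \<bullet> (Ai *v x) / lam"
proof -
  have *: "(v /\<^sub>R lam) $ j * y\<^sup>2 \<le> y\<^sup>2 / lam" for j y
    using mult_right_mono[OF less_imp_le[OF v_less[of j]], of "y\<^sup>2"] lam_pos
    by (simp add: field_simps)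
  have **: "0 \<le> (v /\<^sub>R lam) $ j * y\<^sup>2" for j y
    using v_nonneg[of j] lam_pos by simp
  show "0 \<le> x \<bullet> ((Ai ** K ** Ai) *v x)"
    unfolding AKA quad_diag by (intro sum_nonneg **)
  show "x \<bullet> ((Ai ** K ** Ai) *v x) \<le> x \<bullet> (Ai *v x) / lam"
    unfolding AKA quad_diag quad_A sum_divide_distrib by (intro sum_mono *)
qed

lemma quad_AKAKA:
  shows "0 \<le> x \<bullet> ((Ai ** K ** Ai ** K ** Ai) *v x)"
    "x \<bullet> ((Ai ** K ** Ai ** K ** Ai) *v x) \<le> x \<bullet> (Ai *v x) / lam\<^sup>2"
proof -
  have *: "(v $ j)\<^sup>2 / lam\<^sup>2 * y\<^sup>2 \<le> y\<^sup>2 / lam\<^sup>2" for j y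
  proof -
    have "(v $ j)\<^sup>2 \<le> 1" using v_nonneg[of j] v_less[of j] by (simp add: power_le_one)
    then have "(v $ j)\<^sup>2 * y\<^sup>2 \<le> 1 * y\<^sup>2" by (intro mult_right_mono) auto
    then have "(v $ j)\<^sup>2 * y\<^sup>2 / lam\<^sup>2 \<le> y\<^sup>2 / lam\<^sup>2" by (intro divide_right_mono) auto
    then show ?thesis by simp
  qed
  show "0 \<le> x \<bullet> ((Ai ** K ** Ai ** K ** Ai) *v x)"
    unfolding AKAKA quad_diag by (intro sum_nonneg) simp
  show "x \<bullet> ((Ai ** K ** Ai ** K ** Ai) *v x) \<le> x \<bullet> (Ai *v x) / lam\<^sup>2"
    unfolding AKAKA quad_diag quad_A sum_divide_distrib by (intro sum_mono) (simp only: vec_lambda_beta *)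
qed

end

text \<open>
  Diagonalize \<open>A\<close> to the identity and \<open>S\<close> to \<open>d\<close>; then \<open>v = 1 - d\<close> diagonalizes \<open>\<lambda> K\<close>. Positivity of \<open>S\<close>
  gives \<open>v\<^sub>j < 1\<close>, and that of \<open>K\<close> gives \<open>v\<^sub>j \<ge> 0\<close>.
\<close>

lemma diagonal_pencil_exists:
  fixes S K :: "real ^ 'p ^ 'p"
  assumes S: "pos_def S" and K: "transpose K = K" "\<And>x. 0 \<le> x \<bullet> (K *v x)" and lam: "lam > 0"
  shows "\<exists>C Ci v. diagonal_pencil C Ci v lam S K (S + lam *\<^sub>R K)"
proof -
  define A where "A = S + lam *\<^sub>R K"
  have "transpose A = A"
    by (simp add: A_def pos_def_sym[OF S] K(1) transpose_scalar transpose_add)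
  moreover have "0 < x \<bullet> (A *v x)" if "x \<noteq> 0" for x
    using pos_def_pos[OF S that] K(2)[of x] lam
    by (simp add: A_def matrix_vector.add_left inner_add_right matrix_vector.scaleR_left
        add_pos_nonneg)
  ultimately have A: "pos_def A" by (simp add: pos_def_def)
  obtain C Ci :: "real ^ 'p ^ 'p" and d where C: "C ** Ci = mat 1" "Ci ** C = mat 1"
    and A_eq: "A = C ** transpose C" and S_eq: "S = C ** diag_mat d ** transpose C"
    using simultaneous_diagonalization[OF A pos_def_sym[OF S]] by blast
  define v where "v = 1 - d"
  have "A = C ** diag_mat 1 ** transpose C" by (simp add: A_eq diag_mat_one)
  then have lamK: "lam *\<^sub>R K = C ** (diag_mat 1 - diag_mat d) ** transpose C"
    using S_eq unfolding A_def
    by (simp add: matrix_mult.diff_right matrix_mult.diff_left eq_diff_eq add.commute)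
  also have "diag_mat 1 - diag_mat d = diag_mat v"
    by (simp add: v_def diag_mat_def vec_eq_iff)
  finally have lamK: "lam *\<^sub>R K = C ** diag_mat v ** transpose C" .
  have "diag_mat (v /\<^sub>R lam) = (1 / lam) *\<^sub>R diag_mat v"
    by (simp add: diag_mat_scaleR divide_inverse)
  then have K_eq: "K = C ** diag_mat (v /\<^sub>R lam) ** transpose C"
    using arg_cong[OF lamK, of "\<lambda>x. (1 / lam) *\<^sub>R x"] lam
    by (simp add: matrix_mult.scaleR_left matrix_mult.scaleR_right)
  have "d $ j > 0" for j
  proof -
    have "transpose Ci *v axis j 1 \<noteq> 0"
      using C by (metis axis_eq_0_iff matrix_transpose_mul matrix_vector_mul_assoc
          matrix_vector_mul_lid matrix_vector_mult_0_right transpose_mat zero_neq_one)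
    then show ?thesis
      unfolding congruent_diag_entry[OF C(2) S_eq] by (rule pos_def_pos[OF S])
  qed
  moreover have "v $ j \<ge> 0" for j
    unfolding congruent_diag_entry[OF C(2) lamK] using K(2) lam
    by (simp add: matrix_vector.scaleR_left)
  ultimately show ?thesis
    using C lam S_eq K_eq by (intro exI) (unfold_locales, auto simp: v_def)
qed

section \<open>The pointwise inequality\<close>

text \<open>
  Both sides vanish at 0, and the derivative of their difference is \<open>x\<^sup>2 / ((1 + x) (2 + x)\<^sup>2)\<close>. The bound
  agrees with the logarithm to second order at 0, unlike the simpler \<open>y / (1 + y)\<close>.
\<close>

lemma ln_one_plus_ge:
  fixes y :: real
  assumes "0 \<le> y"
  shows "2 * y / (2 + y) \<le> ln (1 + y)"
proof -
  define f where "f = (\<lambda>y::real. ln (1 + y) - 2 * y / (2 + y))"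
  have "f 0 \<le> f y"
  proof (rule DERIV_nonneg_imp_nondecreasing[OF assms])
    fix x :: real assume x: "0 \<le> x" "x \<le> y"
    have "(f has_real_derivative (1 / (1 + x) - (2 * (2 + x) - 2 * x) / ((2 + x) * (2 + x)))) (at x)"
      unfolding f_def using x by (auto intro!: derivative_eq_intros)
    then have "(f has_real_derivative (1 / (1 + x) - 4 / (2 + x)\<^sup>2)) (at x)"
      by (simp add: power2_eq_square)
    moreover have "1 / (1 + x) - 4 / (2 + x)\<^sup>2 = x\<^sup>2 / ((1 + x) * (2 + x)\<^sup>2)"
      using x by (simp add: field_simps power2_eq_square add_nonneg_eq_0_iff)
    moreover have "0 \<le> x\<^sup>2 / ((1 + x) * (2 + x)\<^sup>2)" using x by simp
    ultimately show "\<exists>d. (f has_real_derivative d) (at x) \<and> 0 \<le> d" by metis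
  qed
  then show ?thesis by (simp add: f_def)
qed

text \<open>
  The expression is the squared Frobenius norm of the \<open>m \<times> m\<close> matrix \<open>1 - \<lambda> T\<close> with \<open>T = X A\<^sup>-\<^sup>1 X\<^sup>T\<close>, since
  \<open>\<lambda> T\<close> and \<open>\<lambda> K A\<^sup>-\<^sup>1\<close> have the same power traces. It is enough to keep the diagonal entries.
\<close>

lemma (in diagonal_pencil) gap_nonneg:
  fixes X :: "real ^ 'p ^ 'm"
  assumes K: "K = transpose X ** X"
  shows "0 \<le> CARD('m) - 2 * s + q"
proof -
  define T where "T = X ** Ai ** transpose X"
  have symT: "T $ i $ l = T $ l $ i" for i l
  proof -
    have "transpose Ai = Ai" by (intro pos_def_sym pos_def_matrix_inv pd_A)
    then have "transpose T = T"
      unfolding T_def by (simp add: matrix_transpose_mul matrix_mul_assoc)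
    moreover have "transpose T $ l $ i = T $ i $ l" by (simp add: transpose_def)
    ultimately show ?thesis by simp
  qed
  have s: "s = lam * (\<Sum>i\<in>UNIV. T $ i $ i)"
  proof -
    have "trace (K ** Ai) = trace T"
      unfolding K T_def using trace_mul_sym[of "transpose X" "X ** Ai"] by (simp add: matrix_mul_assoc)
    then show ?thesis using trace_KA lam_pos by (simp add: trace_def field_simps)
  qed
  have q: "q = lam\<^sup>2 * (\<Sum>i\<in>UNIV. \<Sum>l\<in>UNIV. (T $ i $ l)\<^sup>2)"
  proof -
    have "trace (K ** Ai ** K ** Ai) = trace (T ** T)"
      unfolding K T_def using trace_mul_sym[of "transpose X" "X ** Ai ** transpose X ** X ** Ai"]
      by (simp add: matrix_mul_assoc)
    also have "\<dots> = (\<Sum>i\<in>UNIV. \<Sum>l\<in>UNIV. (T $ i $ l)\<^sup>2)"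
      by (simp add: trace_def matrix_matrix_mult_def power2_eq_square symT)
    finally show ?thesis using trace_KAKA lam_pos by (simp add: field_simps)
  qed
  have "(\<Sum>i\<in>UNIV. (T $ i $ i)\<^sup>2) \<le> (\<Sum>i\<in>UNIV. \<Sum>l\<in>UNIV. (T $ i $ l)\<^sup>2)"
    by (intro sum_mono member_le_sum[of _ UNIV]) auto
  then have "lam\<^sup>2 * (\<Sum>i\<in>UNIV. (T $ i $ i)\<^sup>2) \<le> q"
    unfolding q using lam_pos by (intro mult_left_mono) auto
  moreover have "0 \<le> (\<Sum>i\<in>(UNIV :: 'm set). (1 - lam * T $ i $ i)\<^sup>2)" by (intro sum_nonneg) auto
  moreover have "(\<Sum>i\<in>(UNIV :: 'm set). (1 - lam * T $ i $ i)\<^sup>2) =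
      CARD('m) - 2 * s + lam\<^sup>2 * (\<Sum>i\<in>UNIV. (T $ i $ i)\<^sup>2)"
    unfolding s by (simp add: power2_diff power_mult_distrib sum.distrib sum_subtractf sum_distrib_left mult_ac)
  ultimately show ?thesis by linarith
qed

text \<open>
  The logarithm compensates the first term, which comes from the scale of the covariance estimate. The
  last two terms, which come from the mean, are compared by means of \<open>s - q \<le> m - s\<close>, that is \<open>gap\<close>; the
  remainder is \<open>- 2 k ((m - s)\<^sup>2 + (m - 2 s + q))\<close>. It is strictly negative because \<open>s < m\<close>: equality
  would force \<open>q = s\<close>, hence all \<open>v\<^sub>j = 0\<close> and \<open>s = 0\<close>.
\<close>

lemma (in diagonal_pencil) risk_difference_negative:
  fixes n m p k :: real
  assumes m: "m > 0" and gap: "0 \<le> m - 2 * s + q"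
    and np: "n \<ge> p" "p > m + 1" and k: "k = 1 - lam" "lam < 1"
    and lam: "n - p + 2 * m + 1 \<le> lam * (n + p - 1)"
  shows "m * k / n * ((s * (n - p + s) - s + q) / lam) - m * (\<Sum>j\<in>UNIV. ln (1 + k / lam * v $ j))
    - 2 * k * ((p - s) * (m - s) - (s - q))
    + k\<^sup>2 * (((n - p) * (s - q) + 2 * s\<^sup>2 - 2 * s * q - s + 3 * q - 2 * r) / lam) < 0"
proof -
  have k0: "k > 0" using k by simp
  have n0: "n > 0" using np m by linarith
  have s0: "0 \<le> s" unfolding s_def using v_nonneg by (intro sum_nonneg) auto
  have q0: "0 \<le> q" unfolding q_def by (intro sum_nonneg) auto
  have sm: "s \<le> m" using gap q_le_s by linarith
  have sm': "s < m"
    using gap q_le_s q_less_s sm m by (cases "s = m") auto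
  \<comment> \<open>v_j < 1 makes the denominator 2 lam + k v_j at most 1 + lam, uniformly in j.\<close>
  have log: "2 * k * s / (1 + lam) \<le> (\<Sum>j\<in>UNIV. ln (1 + k / lam * v $ j))"
  proof -
    have "2 * k * v $ j / (1 + lam) \<le> ln (1 + k / lam * v $ j)" for j
    proof -
      have "k * v $ j \<le> k" using mult_left_mono[of "v $ j" 1 k] k0 v_less[of j] by simp
      then have "2 * lam + k * v $ j \<le> 1 + lam" using k(1) by linarith
      then have "2 * k * v $ j / (1 + lam) \<le> 2 * k * v $ j / (2 * lam + k * v $ j)"
        using k0 lam_pos v_nonneg[of j]
        by (intro divide_left_mono mult_nonneg_nonneg mult_pos_pos) (auto simp: add_pos_nonneg)
      also have "\<dots> = 2 * (k / lam * v $ j) / (2 + k / lam * v $ j)"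
        using lam_pos by (simp add: field_simps)
      also have "\<dots> \<le> ln (1 + k / lam * v $ j)"
        using k0 lam_pos v_nonneg[of j] by (intro ln_one_plus_ge) auto
      finally show ?thesis .
    qed
    then show ?thesis
      unfolding s_def by (simp add: sum_distrib_left sum_divide_distrib sum_mono)
  qed
  have first: "m * k / n * ((s * (n - p + s) - s + q) / lam) \<le> m * (2 * k * s / (1 + lam))"
  proof -
    have "s * (n - p + s) - s + q \<le> s * (n - p + m)"
      using q_le_s mult_left_mono[OF sm s0] by (simp add: algebra_simps)
    \<comment> \<open>This is n - p + m \<le> lam (n + p - m), which the hypothesis on lam implies with room to spare.\<close>
    moreover have "(n - p + m) * (1 + lam) \<le> 2 * n * lam"
    proof -
      have "(n - p + m) * (n + p - 1) \<le> (n - p + 2 * m + 1) * (n + p - m)"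
      proof -
        have "(n - p + 2 * m + 1) * (n + p - m) - (n - p + m) * (n + p - 1) = 2 * n + 2 * m * (p - m)"
          by (simp add: algebra_simps)
        moreover have "0 \<le> 2 * n + 2 * m * (p - m)" using n0 m np by simp
        ultimately show ?thesis by linarith
      qed
      also have "\<dots> \<le> lam * (n + p - 1) * (n + p - m)"
        using np m by (intro mult_right_mono lam) auto
      finally have "(n + p - 1) * (n - p + m) \<le> (n + p - 1) * (lam * (n + p - m))"
        by (simp add: mult_ac)
      then have "n - p + m \<le> lam * (n + p - m)" using np m by simp
      then show ?thesis by (simp add: algebra_simps)
    qed
    then have "s * (n - p + m) / (n * lam) \<le> 2 * s / (1 + lam)"
      using n0 lam_pos s0 mult_left_mono[of "(n - p + m) * (1 + lam)" "2 * n * lam" s]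
      by (simp add: field_simps)
    ultimately have "(s * (n - p + s) - s + q) / (n * lam) \<le> 2 * s / (1 + lam)"
      using n0 lam_pos by (meson divide_right_mono less_imp_le mult_pos_pos order_trans)
    then have "m * k * ((s * (n - p + s) - s + q) / (n * lam)) \<le> m * k * (2 * s / (1 + lam))"
      using m k0 by (intro mult_left_mono) auto
    then show ?thesis by (simp add: mult_ac)
  qed
  define B where "B = (n - p) * (s - q) + 2 * s\<^sup>2 - 2 * s * q - s + 3 * q - 2 * r"
  have B: "B \<le> (n - p + 1 + 2 * m) * (s - q)"
  proof -
    have "q - r \<le> s - q"
    proof -
      have "0 \<le> (\<Sum>j\<in>UNIV. v $ j * (1 - v $ j)\<^sup>2)" using v_nonneg by (intro sum_nonneg) auto
      also have "\<dots> = s - 2 * q + r"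
        unfolding s_def q_def r_def
        by (simp add: power2_eq_square power3_eq_cube algebra_simps sum.distrib sum_subtractf sum_distrib_left)
      finally show ?thesis by simp
    qed
    moreover have "s * (s - q) \<le> m * (s - q)" using sm q_le_s by (intro mult_right_mono) auto
    ultimately show ?thesis unfolding B_def by (simp add: algebra_simps power2_eq_square)
  qed
  have "k\<^sup>2 * (B / lam) \<le> 2 * k * (p - m - 1) * (s - q)"
  proof -
    \<comment> \<open>With k = 1 - lam this is exactly the hypothesis on lam.\<close>
    have "k * (n - p + 1 + 2 * m) \<le> 2 * lam * (p - m - 1)"
      using lam unfolding k(1) by (simp add: algebra_simps)
    then have "k * (n - p + 1 + 2 * m) * (s - q) \<le> 2 * lam * (p - m - 1) * (s - q)"
      using q_le_s by (intro mult_right_mono) auto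
    moreover have "k * B \<le> k * ((n - p + 1 + 2 * m) * (s - q))"
      using k0 by (intro mult_left_mono B) auto
    ultimately have "k * B \<le> 2 * lam * (p - m - 1) * (s - q)" by (simp add: mult.assoc)
    then have "k * (k * B) \<le> k * (2 * lam * (p - m - 1) * (s - q))"
      using k0 by (intro mult_left_mono) auto
    then show ?thesis using lam_pos by (simp add: field_simps power2_eq_square)
  qed
  also have "\<dots> \<le> 2 * k * (p - m - 1) * (m - s)"
    using k0 np gap by (intro mult_left_mono) auto
  finally have second: "k\<^sup>2 * (B / lam) \<le> 2 * k * (p - m - 1) * (m - s)" .
  have "2 * k * ((p - s) * (m - s) - (s - q)) - 2 * k * (p - m - 1) * (m - s) =
      2 * k * ((m - s)\<^sup>2 + (m - 2 * s + q))"
    by (simp add: algebra_simps power2_eq_square)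
  moreover have "0 < 2 * k * ((m - s)\<^sup>2 + (m - 2 * s + q))"
    using k0 sm' gap by (intro mult_pos_pos add_pos_nonneg) auto
  moreover have "m * (2 * k * s / (1 + lam)) \<le> m * (\<Sum>j\<in>UNIV. ln (1 + k / lam * v $ j))"
    using m by (intro mult_left_mono log) auto
  ultimately show ?thesis using first second unfolding B_def by linarith
qed

section \<open>Closed forms of the estimators\<close>

lemma gram_sym: "transpose (transpose X ** X) = transpose X ** (X :: real ^ 'p ^ 'm)"
  by (simp add: matrix_transpose_mul)

lemma gram_nonneg: "0 \<le> x \<bullet> ((transpose X ** X) *v x)" for X :: "real ^ 'p ^ 'm"
proof -
  have "x \<bullet> ((transpose X ** X) *v x) = (X *v x) \<bullet> (X *v x)"
    by (simp only: matrix_vector_mul_assoc[symmetric] inner_matrix_vector[of x] transpose_transpose)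
  then show ?thesis by simp
qed

lemma pencil_invertible:
  fixes S K :: "real ^ 'p ^ 'p"
  assumes "pos_def S" "transpose K = K" "\<And>x. 0 \<le> x \<bullet> (K *v x)" "lam > 0"
  shows "invertible (S + lam *\<^sub>R K)" "pos_def (S + lam *\<^sub>R K)"
  using diagonal_pencil_exists[OF assms] diagonal_pencil.pd_A pos_def_invertible by blast+

lemma gram_pencil_exists:
  fixes S :: "real ^ 'p ^ 'p" and X :: "real ^ 'p ^ 'm"
  assumes "pos_def S" "lam > 0"
  shows "\<exists>C Ci v. diagonal_pencil C Ci v lam S (transpose X ** X) (S + lam *\<^sub>R (transpose X ** X))"
  by (intro diagonal_pencil_exists assms gram_sym gram_nonneg)

text \<open>
  The matrix that is inverted in the definition factors as \<open>S\<^sup>-\<^sup>1 (S + \<lambda> K)\<close>.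
\<close>

lemma Theta_GB_eq:
  fixes S :: "real ^ 'p ^ 'p" and X :: "real ^ 'p ^ 'm"
  assumes S: "pos_def S" and k: "k = k0 n CARD('m) c" and lam: "0 < 1 - k"
  shows "Theta_GB n c X S = X - k *\<^sub>R (X ** matrix_inv (S + (1 - k) *\<^sub>R (transpose X ** X)) ** S)"
proof -
  define K where "K = transpose X ** X"
  define A where "A = S + (1 - k) *\<^sub>R K"
  have A: "A ** matrix_inv A = mat 1"
    unfolding A_def K_def by (intro matrix_inv_inverse pencil_invertible S gram_sym gram_nonneg lam)
  note Si = matrix_inv_inverse[OF pos_def_invertible[OF S]]
  have "mat 1 + (1 - k) *\<^sub>R (matrix_inv S ** transpose X ** X) = matrix_inv S ** A"
    unfolding A_def K_def by (simp add: matrix_mult.add_right matrix_mult.scaleR_right Si matrix_mul_assoc)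
  moreover have "(matrix_inv S ** A) ** (matrix_inv A ** S) = matrix_inv S ** (A ** matrix_inv A) ** S"
    by (simp only: matrix_mul_assoc)
  then have "matrix_inv (matrix_inv S ** A) = matrix_inv A ** S"
    by (intro matrix_inv_eqI(1)) (simp add: A Si)
  ultimately show ?thesis
    unfolding Theta_GB_def Let_def k[symmetric] by (simp add: A_def K_def matrix_mul_assoc)
qed

text \<open>
  By the Woodbury identity the inverse of \<open>1 + \<lambda> X S\<^sup>-\<^sup>1 X\<^sup>T\<close> is \<open>1 - \<lambda> X A\<^sup>-\<^sup>1 X\<^sup>T\<close>. Between \<open>X\<^sup>T\<close> and \<open>X\<close> it
  becomes \<open>K - K A\<^sup>-\<^sup>1 (A - S) = K A\<^sup>-\<^sup>1 S\<close>.
\<close>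

lemma Sigma_GB_eq:
  fixes S :: "real ^ 'p ^ 'p" and X :: "real ^ 'p ^ 'm"
  assumes S: "pos_def S" and k: "k = k0 n CARD('m) c" and lam: "0 < 1 - k"
  shows "Sigma_GB n c X S =
    (1 / n) *\<^sub>R (S + k *\<^sub>R (transpose X ** X ** matrix_inv (S + (1 - k) *\<^sub>R (transpose X ** X)) ** S))"
proof -
  define l where "l = 1 - k"
  define K where "K = transpose X ** X"
  define A where "A = S + l *\<^sub>R K"
  define Ai where "Ai = matrix_inv A"
  define Si where "Si = matrix_inv S"
  have A: "A ** Ai = mat 1" "Ai ** A = mat 1"
    unfolding A_def K_def Ai_def l_def by (intro matrix_inv_inverse pencil_invertible S gram_sym gram_nonneg lam)+
  have Si: "S ** Si = mat 1" "Si ** S = mat 1"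
    unfolding Si_def using matrix_inv_inverse[OF pos_def_invertible[OF S]] by auto
  have lK: "l *\<^sub>R K = A - S" by (simp add: A_def)
  have "(mat 1 + l *\<^sub>R (X ** Si ** transpose X)) ** (mat 1 - l *\<^sub>R (X ** Ai ** transpose X)) =
      mat 1 + l *\<^sub>R (X ** (Si - Ai - Si ** (l *\<^sub>R K) ** Ai) ** transpose X)"
    unfolding K_def
    by (simp add: matrix_mult.add_left matrix_mult.add_right matrix_mult.diff_left matrix_mult.diff_right
        matrix_mult.scaleR_left matrix_mult.scaleR_right matrix_mul_assoc algebra_simps)
  also have "Si ** (l *\<^sub>R K) ** Ai = Si - Ai"
  proof -
    have "Si ** (l *\<^sub>R K) ** Ai = Si ** (A ** Ai) - (Si ** S) ** Ai"
      unfolding lK by (simp add: matrix_mult.diff_left matrix_mult.diff_right matrix_mul_assoc)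
    then show ?thesis by (simp add: A Si)
  qed
  finally have "(mat 1 + l *\<^sub>R (X ** Si ** transpose X)) ** (mat 1 - l *\<^sub>R (X ** Ai ** transpose X)) = mat 1"
    by simp
  then have G: "matrix_inv (mat 1 + l *\<^sub>R (X ** Si ** transpose X)) = mat 1 - l *\<^sub>R (X ** Ai ** transpose X)"
    by (rule matrix_inv_eqI(1))
  have "transpose X ** (mat 1 - l *\<^sub>R (X ** Ai ** transpose X)) ** X = K - K ** Ai ** (l *\<^sub>R K)"
    unfolding K_def
    by (simp add: matrix_mult.diff_left matrix_mult.diff_right
        matrix_mult.scaleR_left matrix_mult.scaleR_right matrix_mul_assoc)
  also have "K ** Ai ** (l *\<^sub>R K) = K ** (Ai ** A) - K ** Ai ** S"
    unfolding lK by (simp add: matrix_mult.diff_right matrix_mul_assoc)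
  finally have "transpose X ** (mat 1 - l *\<^sub>R (X ** Ai ** transpose X)) ** X = K ** Ai ** S"
    by (simp add: A)
  then show ?thesis
    unfolding Sigma_GB_def Let_def k[symmetric] Sigma0_def
    using G by (simp add: l_def[symmetric] Si_def[symmetric] A_def[symmetric] Ai_def[symmetric]
        K_def[symmetric] scaleR_add_right)
qed

section \<open>Lebesgue measure and Gaussian measures on vectors\<close>

lemma Basis_vec_image: "(Basis :: ('a::euclidean_space ^ 'n) set) = (\<lambda>(i, b). axis i b) ` (UNIV \<times> Basis)"
  unfolding Basis_vec_def by auto

lemma inj_on_axis_Basis: "inj_on (\<lambda>(i, b). axis i b :: 'a::euclidean_space ^ 'n) (UNIV \<times> Basis)"
  by (auto simp: inj_on_def axis_eq_axis nonzero_Basis)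

lemma measurable_vec_lambda [measurable]:
  assumes "\<And>i. f i \<in> borel_measurable M"
  shows "(\<lambda>x. \<chi> i. (f i x :: 'a::euclidean_space)) \<in> borel_measurable M"
  unfolding borel_measurable_euclidean_space[of "\<lambda>x. \<chi> i. f i x"] Basis_vec_image
  using assms by (auto simp: inner_axis)

lemma measurable_vec_lambda_PiM [measurable]:
  "vec_lambda \<in> measurable (PiM UNIV (\<lambda>i::'n::finite. borel :: 'a::euclidean_space measure)) borel"
  using measurable_vec_lambda[of "\<lambda>i x. x i" "PiM UNIV (\<lambda>i::'n. borel :: 'a measure)"] by simp

lemma lborel_vec:
  "(lborel :: ('a::euclidean_space ^ 'n) measure) = distr (PiM UNIV (\<lambda>_. lborel)) borel vec_lambda"
proof (rule lborel_eqI)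
  interpret product_sigma_finite "\<lambda>_::'n. lborel :: 'a measure" ..
  let ?P = "PiM UNIV (\<lambda>_::'n. lborel :: 'a measure)"
  have sets: "sets ?P = sets (PiM UNIV (\<lambda>i::'n. borel :: 'a measure))"
    by (intro sets_PiM_cong) auto
  have meas: "vec_lambda \<in> measurable ?P (borel :: ('a ^ 'n) measure)"
    using measurable_vec_lambda_PiM by (simp cong: measurable_cong_sets add: sets)
  fix l u :: "'a ^ 'n"
  assume le: "\<And>b. b \<in> Basis \<Longrightarrow> l \<bullet> b \<le> u \<bullet> b"
  have le': "l $ i \<bullet> b \<le> u $ i \<bullet> b" if "b \<in> Basis" for i b
    using le[of "axis i b"] that by (auto simp: inner_axis Basis_vec_image)
  have "vec_lambda -` box l u \<inter> space ?P = (\<Pi>\<^sub>E i\<in>UNIV. box (l $ i) (u $ i))"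
    by (auto simp: space_PiM mem_box Basis_vec_image inner_axis PiE_iff)
  then have "emeasure (distr ?P borel vec_lambda) (box l u) = emeasure ?P (\<Pi>\<^sub>E i\<in>UNIV. box (l $ i) (u $ i))"
    using meas by (simp add: emeasure_distr)
  also have "\<dots> = (\<Prod>i\<in>UNIV. emeasure lborel (box (l $ i) (u $ i)))"
    by (rule emeasure_PiM) auto
  also have "\<dots> = (\<Prod>i\<in>UNIV. ennreal (\<Prod>b\<in>Basis. (u $ i - l $ i) \<bullet> b))"
    by (intro prod.cong refl emeasure_lborel_box le')
  also have "\<dots> = ennreal (\<Prod>i\<in>UNIV. \<Prod>b\<in>Basis. (u $ i - l $ i) \<bullet> b)"
    using le' by (intro prod_ennreal prod_nonneg) (auto simp: inner_diff_left)
  also have "(\<Prod>i\<in>UNIV. \<Prod>b\<in>Basis. (u $ i - l $ i) \<bullet> b) = (\<Prod>b\<in>Basis. (u - l) \<bullet> b)"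
    unfolding Basis_vec_image prod.reindex[OF inj_on_axis_Basis]
    by (simp add: prod.cartesian_product inner_axis o_def case_prod_beta)
  finally show "emeasure (distr ?P borel vec_lambda) (box l u) = (\<Prod>b\<in>Basis. (u - l) \<bullet> b)" .
qed simp

lemma density_vec:
  fixes f :: "'n::finite \<Rightarrow> 'a::euclidean_space \<Rightarrow> ennreal"
  assumes [measurable]: "\<And>i. f i \<in> borel_measurable borel"
    and prob: "\<And>i. prob_space (density lborel (f i))"
  shows "density lborel (\<lambda>x. \<Prod>i\<in>UNIV. f i (x $ i)) =
    distr (PiM UNIV (\<lambda>i. density lborel (f i))) borel vec_lambda"
proof -
  let ?P = "PiM UNIV (\<lambda>_::'n. lborel :: 'a measure)"
  interpret L: product_sigma_finite "\<lambda>_::'n. lborel :: 'a measure" ..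
  interpret D: product_prob_space "\<lambda>i::'n. density lborel (f i)"
    by (intro product_prob_spaceI prob)
  have sets: "sets ?P = sets (PiM UNIV (\<lambda>i::'n. borel :: 'a measure))"
    by (intro sets_PiM_cong) auto
  have meas: "vec_lambda \<in> measurable ?P (borel :: ('a ^ 'n) measure)"
    using measurable_vec_lambda_PiM by (simp cong: measurable_cong_sets add: sets)
  have [measurable]: "(\<lambda>x::'a ^ 'n. \<Prod>i\<in>UNIV. f i (x $ i)) \<in> borel_measurable borel"
    by (intro borel_measurable_prod_ennreal measurable_compose[OF _ assms(1)] borel_measurable_continuous_onI
        continuous_intros)
  have m2: "(\<lambda>x. \<Prod>i\<in>UNIV. f i (x i)) \<in> borel_measurable ?P"
    by measurable
  have "density ?P (\<lambda>x. \<Prod>i\<in>UNIV. f i (x i)) = PiM UNIV (\<lambda>i. density lborel (f i))"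
  proof (rule D.PiM_eqI)
    fix A :: "'n \<Rightarrow> 'a set"
    assume A: "\<And>i. i \<in> UNIV \<Longrightarrow> A i \<in> sets (density lborel (f i))"
    then have A': "A i \<in> sets lborel" for i by simp
    have "emeasure (density ?P (\<lambda>x. \<Prod>i\<in>UNIV. f i (x i))) (Pi\<^sub>E UNIV A) =
        (\<integral>\<^sup>+x. (\<Prod>i\<in>UNIV. f i (x i)) * indicator (Pi\<^sub>E UNIV A) x \<partial>?P)"
      using A' by (intro emeasure_density m2 sets_PiM_I_finite) auto
    also have "\<dots> = (\<integral>\<^sup>+x. (\<Prod>i\<in>UNIV. f i (x i) * indicator (A i) (x i)) \<partial>?P)"
    proof (intro nn_integral_cong)
      fix x :: "'n \<Rightarrow> 'a"
      have "indicator (Pi\<^sub>E UNIV A) x = (\<Prod>i\<in>UNIV. indicator (A i) (x i) :: ennreal)"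
        by (auto simp: indicator_def PiE_iff)
      then show "(\<Prod>i\<in>UNIV. f i (x i)) * indicator (Pi\<^sub>E UNIV A) x =
          (\<Prod>i\<in>UNIV. f i (x i) * indicator (A i) (x i))"
        by (simp add: prod.distrib)
    qed
    also have "\<dots> = (\<Prod>i\<in>UNIV. \<integral>\<^sup>+y. f i y * indicator (A i) y \<partial>lborel)"
      using A' by (intro L.product_nn_integral_prod) auto
    also have "\<dots> = (\<Prod>i\<in>UNIV. emeasure (density lborel (f i)) (A i))"
      using A' by (simp add: emeasure_density)
    finally show "emeasure (density ?P (\<lambda>x. \<Prod>i\<in>UNIV. f i (x i))) (Pi\<^sub>E UNIV A) =
        (\<Prod>i\<in>UNIV. emeasure (density lborel (f i)) (A i))" .
  qed (auto intro!: sets_PiM_cong)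
  then have "distr (PiM UNIV (\<lambda>i. density lborel (f i))) borel vec_lambda =
      distr (density ?P (\<lambda>x. \<Prod>i\<in>UNIV. f i (vec_lambda x $ i))) (borel :: ('a ^ 'n) measure) vec_lambda"
    by simp
  also have "\<dots> = density (distr ?P borel vec_lambda) (\<lambda>x. \<Prod>i\<in>UNIV. f i (x $ i))"
    by (intro density_distr[symmetric] meas) simp
  finally show ?thesis unfolding lborel_vec[symmetric] by simp
qed

text \<open>
  Isolates the coordinate that a shear translates.
\<close>

lemma nn_integral_lborel_update:
  fixes f :: "real ^ 'n \<Rightarrow> ennreal"
  assumes [measurable]: "f \<in> borel_measurable borel"
  shows "(\<integral>\<^sup>+x. f x \<partial>lborel) =
    (\<integral>\<^sup>+x. (\<integral>\<^sup>+y. f (vec_lambda (x(m := y))) \<partial>lborel) \<partial>PiM (UNIV - {m}) (\<lambda>_. lborel))"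
proof -
  interpret product_sigma_finite "\<lambda>_::'n. lborel :: real measure" ..
  let ?P = "PiM UNIV (\<lambda>_::'n. lborel :: real measure)"
  have sets: "sets ?P = sets (PiM UNIV (\<lambda>i::'n. borel :: real measure))"
    by (intro sets_PiM_cong) auto
  have meas [measurable]: "vec_lambda \<in> measurable ?P (borel :: (real ^ 'n) measure)"
    using measurable_vec_lambda_PiM by (simp cong: measurable_cong_sets add: sets)
  have "(\<integral>\<^sup>+x. f x \<partial>lborel) = (\<integral>\<^sup>+x. f (vec_lambda x) \<partial>?P)"
    unfolding lborel_vec by (intro nn_integral_distr) auto
  also have "?P = PiM (insert m (UNIV - {m})) (\<lambda>_. lborel)" by (simp add: insert_absorb)
  also have "integral\<^sup>N \<dots> (\<lambda>x. f (vec_lambda x)) =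
      (\<integral>\<^sup>+x. (\<integral>\<^sup>+y. f (vec_lambda (x(m := y))) \<partial>lborel) \<partial>PiM (UNIV - {m}) (\<lambda>_. lborel))"
    by (rule product_nn_integral_insert) (auto simp: insert_absorb)
  finally show ?thesis .
qed

text \<open>
  The scaling of volumes by a linear map is checked on the elementary matrices: a diagonal matrix
  and a permutation act on boxes, and a shear is a translation of one coordinate when the others
  are fixed.
\<close>

lemma nn_integral_linear_map:
  fixes A :: "real ^ 'n ^ 'n"
  assumes "det A \<noteq> 0" "f \<in> borel_measurable borel"
  shows "(\<integral>\<^sup>+x. f x \<partial>lborel) = ennreal \<bar>det A\<bar> * (\<integral>\<^sup>+x. f (A *v x) \<partial>lborel)"
proof -
  define P where "P = (\<lambda>A :: real ^ 'n ^ 'n. det A \<noteq> 0 \<longrightarrow> (\<forall>f \<in> borel_measurable borel.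
    (\<integral>\<^sup>+x. f x \<partial>lborel) = ennreal \<bar>det A\<bar> * (\<integral>\<^sup>+x. f (A *v x) \<partial>lborel)))"
  have lin [measurable]: "(*v) A \<in> borel_measurable borel" for A :: "real ^ 'n ^ 'n"
    by (intro borel_measurable_continuous_onI matrix_vector_mult_linear_continuous_on)
  have "P A"
  proof (rule induct_matrix_elementary[of P])
    fix A B :: "real ^ 'n ^ 'n"
    assume AB: "P A" "P B"
    show "P (A ** B)"
      unfolding P_def
    proof (intro impI ballI)
      fix f :: "real ^ 'n \<Rightarrow> ennreal"
      assume det: "det (A ** B) \<noteq> 0" and [measurable]: "f \<in> borel_measurable borel"
      have dets: "det A \<noteq> 0" "det B \<noteq> 0" using det by (auto simp: det_mul)
      have m: "(\<lambda>x. f (A *v x)) \<in> borel_measurable borel" by measurable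
      have "(\<integral>\<^sup>+x. f (A *v x) \<partial>lborel) = ennreal \<bar>det B\<bar> * (\<integral>\<^sup>+x. f (A *v (B *v x)) \<partial>lborel)"
        by (rule AB(2)[unfolded P_def, rule_format, OF dets(2) m])
      moreover have "(\<integral>\<^sup>+x. f x \<partial>lborel) = ennreal \<bar>det A\<bar> * (\<integral>\<^sup>+x. f (A *v x) \<partial>lborel)"
        by (rule AB(1)[unfolded P_def, rule_format, OF dets(1)]) measurable
      ultimately show "(\<integral>\<^sup>+x. f x \<partial>lborel) = ennreal \<bar>det (A ** B)\<bar> * (\<integral>\<^sup>+x. f ((A ** B) *v x) \<partial>lborel)"
        by (simp add: matrix_vector_mul_assoc det_mul abs_mult ennreal_mult mult.assoc)
    qed
  next
    fix A :: "real ^ 'n ^ 'n" and i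
    assume "row i A = 0"
    then show "P A" unfolding P_def by (simp add: det_zero_row)
  next
    fix A :: "real ^ 'n ^ 'n"
    assume A: "\<And>i j. i \<noteq> j \<Longrightarrow> A $ i $ j = 0"
    show "P A"
      unfolding P_def
    proof (intro impI ballI)
      fix f :: "real ^ 'n \<Rightarrow> ennreal"
      assume det: "det A \<noteq> 0" and [measurable]: "f \<in> borel_measurable borel"
      have det_A: "det A = (\<Prod>i\<in>UNIV. A $ i $ i)" by (intro det_diagonal A)
      define c where "c = (\<lambda>b :: real ^ 'n. b \<bullet> (A *v b))"
      have c: "c (axis i 1) = A $ i $ i" for i
        by (simp add: c_def inner_axis' matrix_vector_mult_basis column_def)
      have Basis: "(Basis :: (real ^ 'n) set) = (\<lambda>i. axis i 1) ` UNIV"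
        unfolding Basis_vec_def by auto
      have inj: "inj_on (\<lambda>i. axis i (1::real) :: real ^ 'n) UNIV" by (auto simp: inj_on_def axis_eq_axis)
      have comp: "axis j (1::real) $ i = (if j = i then 1 else 0)" for i j :: 'n by (simp add: axis_def)
      have T: "0 + (\<Sum>j\<in>Basis. (c j * (x \<bullet> j)) *\<^sub>R j) = A *v x" for x
      proof -
        have "(\<Sum>j\<in>Basis. (c j * (x \<bullet> j)) *\<^sub>R j) $ i = (A *v x) $ i" for i
        proof -
          have "(\<Sum>j\<in>UNIV. A $ i $ j * x $ j) = (\<Sum>j\<in>UNIV. if j = i then A $ i $ i * x $ i else 0)"
            using A by (intro sum.cong) auto
          then have Ax: "(A *v x) $ i = A $ i $ i * x $ i" by (simp add: matrix_vector_mult_def)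
          have "(\<Sum>j\<in>Basis. (c j * (x \<bullet> j)) *\<^sub>R j) $ i =
              (\<Sum>j\<in>UNIV. if j = i then A $ i $ i * x $ i else 0)"
            unfolding Basis sum.reindex[OF inj] sum_component
            by (intro sum.cong) (simp_all add: c inner_axis comp)
          then show ?thesis using Ax by simp
        qed
        then show ?thesis by (simp add: vec_eq_iff)
      qed
      have "(\<Prod>j\<in>Basis. \<bar>c j\<bar>) = \<bar>det A\<bar>"
        unfolding Basis prod.reindex[OF inj] det_A by (simp add: c abs_prod)
      moreover have "c j \<noteq> 0" if "j \<in> Basis" for j
        using that det det_A unfolding Basis by (auto simp: c)
      ultimately have "lborel = density (distr lborel borel ((*v) A)) (\<lambda>_. ennreal \<bar>det A\<bar>)"
        using lborel_affine_euclidean[of c 0] unfolding T by simp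
      then have "(\<integral>\<^sup>+x. f x \<partial>lborel) = (\<integral>\<^sup>+x. f x \<partial>density (distr lborel borel ((*v) A)) (\<lambda>_. ennreal \<bar>det A\<bar>))"
        by metis
      also have "\<dots> = ennreal \<bar>det A\<bar> * (\<integral>\<^sup>+x. f (A *v x) \<partial>lborel)"
        by (simp add: nn_integral_density nn_integral_cmult nn_integral_distr)
      finally show "(\<integral>\<^sup>+x. f x \<partial>lborel) = ennreal \<bar>det A\<bar> * (\<integral>\<^sup>+x. f (A *v x) \<partial>lborel)" .
    qed
  next
    fix m n :: 'n
    assume "m \<noteq> n"
    define \<pi> where "\<pi> = Transposition.transpose m n"
    define T where "T = (\<lambda>x :: real ^ 'n. \<chi> i. x $ \<pi> i)"
    have \<pi>: "bij \<pi>" "\<And>i. \<pi> (\<pi> i) = i" unfolding \<pi>_def by auto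
    let ?A = "\<chi> i j. mat 1 $ i $ \<pi> j :: real ^ 'n ^ 'n"
    have "?A *v x = T x" for x
    proof -
      have "(?A *v x) $ i = T x $ i" for i
      proof -
        have "(if i = \<pi> j then 1 else 0) * x $ j = (if j = \<pi> i then x $ j else 0)" for j
          using \<pi>(2)[of j] \<pi>(2)[of i] by (cases "j = \<pi> i") auto
        then have "(?A *v x) $ i = (\<Sum>j\<in>UNIV. if j = \<pi> i then x $ j else 0)"
          by (simp add: matrix_vector_mult_def mat_def)
        then show ?thesis by (simp add: T_def)
      qed
      then show ?thesis by (simp add: vec_eq_iff)
    qed
    then have A: "(*v) ?A = T" by blast
    have T_meas [measurable]: "T \<in> borel_measurable borel" using lin[of ?A] unfolding A .
    have det: "\<bar>det ?A\<bar> = 1"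
      unfolding \<pi>_def using \<open>m \<noteq> n\<close>
      by (subst det_permute_columns) (auto simp: permutes_swap_id sign_swap_id)
    have "lborel = distr lborel borel T"
    proof (rule lborel_eqI)
      fix l u :: "real ^ 'n"
      assume le: "\<And>b. b \<in> Basis \<Longrightarrow> l \<bullet> b \<le> u \<bullet> b"
      have le': "l $ i \<le> u $ i" for i using le[of "axis i 1"] by (simp add: inner_axis axis_in_Basis_iff)
      have Basis: "(Basis :: (real ^ 'n) set) = (\<lambda>i. axis i 1) ` UNIV"
        unfolding Basis_vec_def by auto
      have inj: "inj_on (\<lambda>i. axis i (1::real) :: real ^ 'n) UNIV" by (auto simp: inj_on_def axis_eq_axis)
      have all: "(\<forall>i. Q (\<pi> i)) \<longleftrightarrow> (\<forall>i. Q i)" for Q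
        using \<pi>(2) by metis
      have "T -` box l u = box (T l) (T u)"
        using all[of "\<lambda>i. l $ \<pi> i < x $ i \<and> x $ i < u $ \<pi> i" for x]
        by (simp add: set_eq_iff mem_box_cart T_def \<pi>(2))
      then have "emeasure (distr lborel borel T) (box l u) = (\<Prod>b\<in>Basis. (T u - T l) \<bullet> b)"
        by (simp add: emeasure_distr emeasure_lborel_box_eq Basis inner_axis T_def le')
      also have "(\<Prod>b\<in>Basis. (T u - T l) \<bullet> b) = (\<Prod>i\<in>UNIV. u $ \<pi> i - l $ \<pi> i)"
        unfolding Basis prod.reindex[OF inj] by (simp add: inner_axis T_def)
      also have "\<dots> = (\<Prod>i\<in>UNIV. u $ i - l $ i)"
        by (rule prod.reindex_bij_betw[OF \<pi>(1), of "\<lambda>i. u $ i - l $ i"])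
      also have "\<dots> = (\<Prod>b\<in>Basis. (u - l) \<bullet> b)"
        unfolding Basis prod.reindex[OF inj] by (simp add: inner_axis)
      finally show "emeasure (distr lborel borel T) (box l u) = (\<Prod>b\<in>Basis. (u - l) \<bullet> b)" .
    qed simp
    then have eq: "(\<integral>\<^sup>+x. f x \<partial>lborel) = (\<integral>\<^sup>+x. f x \<partial>distr lborel borel T)" for f :: "real ^ 'n \<Rightarrow> ennreal"
      by metis
    have "(\<integral>\<^sup>+x. f x \<partial>lborel) = (\<integral>\<^sup>+x. f (T x) \<partial>lborel)"
      if "f \<in> borel_measurable borel" for f :: "real ^ 'n \<Rightarrow> ennreal"
      unfolding eq[of f] using that by (intro nn_integral_distr) auto
    then show "P (\<chi> i j. mat 1 $ i $ Transposition.transpose m n j)"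
      unfolding \<pi>_def[symmetric] P_def det A ennreal_1 mult_1 by blast
  next
    fix m n :: 'n and c :: real
    assume mn: "m \<noteq> n"
    let ?A = "\<chi> i j. if i = m \<and> j = n then c else of_bool (i = j) :: real ^ 'n ^ 'n"
    have "?A = (\<chi> k. if k = m then row m (mat 1) + c *s row n (mat 1) else row k (mat 1))"
      using mn by (auto simp: vec_eq_iff row_def mat_def)
    then have det: "det ?A = 1" using det_row_operation[OF mn, of "mat 1" c] by (simp add: det_I)
    have A: "?A *v vec_lambda (x(m := y)) = vec_lambda (x(m := y + c * x n))" for x y
    proof -
      have "(?A *v vec_lambda (x(m := y))) $ i = (x(m := y + c * x n)) i" for i
      proof -
        have "(?A *v vec_lambda (x(m := y))) $ i =
            (\<Sum>j\<in>UNIV. (if j = i then (x(m := y)) j else 0) + (if j = n then (if i = m then c * x n else 0) else 0))"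
          unfolding matrix_vector_mult_def using mn by (auto intro!: sum.cong)
        also have "\<dots> = (x(m := y + c * x n)) i"
          unfolding sum.distrib by simp
        finally show ?thesis .
      qed
      then show ?thesis by (simp add: vec_eq_iff)
    qed
    have "(\<integral>\<^sup>+x. f x \<partial>lborel) = (\<integral>\<^sup>+x. f (?A *v x) \<partial>lborel)"
      if [measurable]: "f \<in> borel_measurable borel" for f :: "real ^ 'n \<Rightarrow> ennreal"
    proof -
      have "(\<integral>\<^sup>+y. f (vec_lambda (x(m := y + c * x n))) \<partial>lborel) = (\<integral>\<^sup>+y. f (vec_lambda (x(m := y))) \<partial>lborel)"
        for x
      proof -
        have "(\<lambda>y. f (vec_lambda (x(m := y)))) \<in> borel_measurable borel"
          by (intro measurable_compose[OF _ that] measurable_vec_lambda) simp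
        from nn_integral_real_affine[OF this, of 1 "c * x n"] show ?thesis
          by (simp add: add.commute)
      qed
      then show ?thesis
        unfolding nn_integral_lborel_update[OF that, of m]
        by (subst nn_integral_lborel_update[of _ m]) (auto simp: A)
    qed
    then show "P ?A" unfolding P_def det abs_one ennreal_1 mult_1 by blast
  qed
  then show ?thesis using assms unfolding P_def by blast
qed

lemma lborel_affine_map:
  fixes C Ci :: "real ^ 'n ^ 'n"
  assumes C: "C ** Ci = mat 1"
  shows "lborel = density (distr lborel borel (\<lambda>z. \<mu> + C *v z)) (\<lambda>_. ennreal \<bar>det C\<bar>)"
proof (rule measure_eqI)
  let ?T = "\<lambda>z. \<mu> + C *v z"
  have T [measurable]: "?T \<in> borel_measurable borel"
    by (intro borel_measurable_continuous_onI continuous_intros matrix_vector.continuous_on)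
  have det: "det C \<noteq> 0" using arg_cong[OF C, of det] by (auto simp: det_mul)
  fix B :: "(real ^ 'n) set"
  assume "B \<in> sets lborel"
  then have [measurable]: "B \<in> sets borel" by simp
  have "emeasure (density (distr lborel borel ?T) (\<lambda>_. ennreal \<bar>det C\<bar>)) B =
      ennreal \<bar>det C\<bar> * (\<integral>\<^sup>+z. indicator B z \<partial>distr lborel borel ?T)"
    by (simp add: emeasure_density_const)
  also have "(\<integral>\<^sup>+z. indicator B z \<partial>distr lborel borel ?T) = (\<integral>\<^sup>+z. indicator B (\<mu> + C *v z) \<partial>lborel)"
    by (rule nn_integral_distr) auto
  also have "ennreal \<bar>det C\<bar> * \<dots> = (\<integral>\<^sup>+z. indicator B (\<mu> + z) \<partial>lborel)"
    by (rule nn_integral_linear_map[OF det, symmetric]) simp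
  also have "\<dots> = (\<integral>\<^sup>+z. indicator B z \<partial>distr lborel borel ((+) \<mu>))"
    by (rule nn_integral_distr[symmetric]) auto
  also have "\<dots> = emeasure lborel B"
    unfolding lborel_distr_plus by simp
  finally show "emeasure lborel B = emeasure (density (distr lborel borel ?T) (\<lambda>_. ennreal \<bar>det C\<bar>)) B" ..
qed simp

abbreviation std_normal :: "real measure" where
  "std_normal \<equiv> density lborel (\<lambda>x. ennreal (std_normal_density x))"

lemma prob_space_std_normal: "prob_space std_normal"
  by (rule prob_space_normal_density) simp

definition std_normal_vec :: "(real ^ 'n) measure" where
  "std_normal_vec = distr (PiM UNIV (\<lambda>_. std_normal)) borel vec_lambda"

definition mvn_density :: "real ^ 'n \<Rightarrow> real ^ 'n ^ 'n \<Rightarrow> real ^ 'n \<Rightarrow> real" where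
  "mvn_density \<mu> \<Sigma> x =
     exp (- (1 / 2) * ((x - \<mu>) \<bullet> (matrix_inv \<Sigma> *v (x - \<mu>)))) / sqrt ((2 * pi) ^ CARD('n) * det \<Sigma>)"

definition mvn :: "real ^ 'n \<Rightarrow> real ^ 'n ^ 'n \<Rightarrow> (real ^ 'n) measure" where
  "mvn \<mu> \<Sigma> = density lborel (\<lambda>x. ennreal (mvn_density \<mu> \<Sigma> x))"

lemma sets_mvn [simp, measurable_cong]: "sets (mvn \<mu> \<Sigma>) = sets borel"
  by (simp add: mvn_def)

lemma space_mvn [simp]: "space (mvn \<mu> \<Sigma>) = UNIV"
  by (simp add: mvn_def)

lemma sets_std_normal_vec [simp, measurable_cong]: "sets std_normal_vec = sets borel"
  by (simp add: std_normal_vec_def)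

lemma measurable_vec_lambda_std [measurable]:
  "vec_lambda \<in> measurable (PiM UNIV (\<lambda>i::'n::finite. std_normal)) borel"
  using measurable_vec_lambda_PiM[where 'a = real]
  by (simp cong: measurable_cong_sets add: sets_PiM_cong[of UNIV UNIV "\<lambda>i. std_normal" "\<lambda>i. borel"])

lemma prob_space_std_normal_vec: "prob_space std_normal_vec"
  unfolding std_normal_vec_def
  by (intro prob_space.prob_space_distr[OF prob_space_PiM[OF prob_space_std_normal]]
      measurable_vec_lambda_std)

lemma std_normal_vec_density:
  "(std_normal_vec :: (real ^ 'n) measure) =
    density lborel (\<lambda>z. ennreal (exp (- (1 / 2) * (z \<bullet> z)) / sqrt (2 * pi) ^ CARD('n)))"
proof -
  have "(std_normal_vec :: (real ^ 'n) measure) =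
      density lborel (\<lambda>x. \<Prod>i\<in>UNIV. ennreal (std_normal_density (x $ i)))"
    unfolding std_normal_vec_def by (intro density_vec[symmetric] prob_space_std_normal) simp
  also have "(\<lambda>z::real ^ 'n. \<Prod>i\<in>UNIV. ennreal (std_normal_density (z $ i))) =
      (\<lambda>z. ennreal (exp (- (1 / 2) * (z \<bullet> z)) / sqrt (2 * pi) ^ CARD('n)))"
  proof
    fix z :: "real ^ 'n"
    have "(\<Prod>i\<in>UNIV. std_normal_density (z $ i)) =
        (\<Prod>i\<in>UNIV. exp (- (z $ i)\<^sup>2 / 2)) / sqrt (2 * pi) ^ CARD('n)"
      unfolding std_normal_density_def prod.distrib by (simp add: prod_constant power_one_over)
    also have "(\<Prod>i\<in>UNIV. exp (- (z $ i)\<^sup>2 / 2)) = exp (- (1 / 2) * (z \<bullet> z))"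
      by (simp add: exp_sum[symmetric] inner_vec_def power2_eq_square sum_distrib_left sum_negf)
    finally show "(\<Prod>i\<in>UNIV. ennreal (std_normal_density (z $ i))) =
        ennreal (exp (- (1 / 2) * (z \<bullet> z)) / sqrt (2 * pi) ^ CARD('n))"
      by (simp add: prod_ennreal)
  qed
  finally show ?thesis .
qed

lemma mvn_density_pos: "pos_def \<Sigma> \<Longrightarrow> 0 < mvn_density \<mu> \<Sigma> x"
  unfolding mvn_density_def
  by (intro divide_pos_pos exp_gt_zero real_sqrt_gt_zero mult_pos_pos zero_less_power det_pos_def) simp_all

lemma borel_measurable_mvn_density [measurable]: "mvn_density \<mu> \<Sigma> \<in> borel_measurable borel"
proof -
  have "(\<lambda>x. exp (- (1 / 2) * ((x - \<mu>) \<bullet> (matrix_inv \<Sigma> *v (x - \<mu>))))) \<in> borel_measurable borel"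
    by (intro borel_measurable_continuous_onI continuous_intros matrix_vector.continuous_on)
  then show ?thesis unfolding mvn_density_def by (rule borel_measurable_divide) simp
qed

text \<open>
  The quadratic form of the density at \<open>\<mu> + C z\<close> is \<open>z \<bullet> z\<close>, and the normalization absorbs the Jacobian
  \<open>\<bar>det C\<bar>\<close>.
\<close>

lemma mvn_eq_distr:
  fixes C Ci :: "real ^ 'n ^ 'n"
  assumes C: "C ** Ci = mat 1"
  shows "mvn \<mu> (C ** transpose C) = distr std_normal_vec borel (\<lambda>z. \<mu> + C *v z)"
proof -
  let ?T = "\<lambda>z. \<mu> + C *v z" and ?\<Sigma> = "C ** transpose C"
  have Ci: "Ci ** C = mat 1" using C by (simp add: matrix_left_right_inverse)
  have T [measurable]: "?T \<in> borel_measurable borel"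
    by (intro borel_measurable_continuous_onI continuous_intros matrix_vector.continuous_on)
  have tC: "transpose C ** transpose Ci = mat 1" using Ci by (metis matrix_transpose_mul transpose_mat)
  have "?\<Sigma> ** (transpose Ci ** Ci) = C ** (transpose C ** transpose Ci) ** Ci"
    by (simp only: matrix_mul_assoc)
  then have inv: "matrix_inv ?\<Sigma> = transpose Ci ** Ci"
    by (intro matrix_inv_eqI(1)) (simp add: tC C)
  have quad: "(C *v z) \<bullet> (matrix_inv ?\<Sigma> *v (C *v z)) = z \<bullet> z" for z
  proof -
    have "matrix_inv ?\<Sigma> *v (C *v z) = transpose Ci *v ((Ci ** C) *v z)"
      unfolding inv by (simp only: matrix_vector_mul_assoc matrix_mul_assoc)
    then have "matrix_inv ?\<Sigma> *v (C *v z) = transpose Ci *v z" by (simp only: Ci matrix_vector_mul_lid)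
    then have "(C *v z) \<bullet> (matrix_inv ?\<Sigma> *v (C *v z)) = (Ci *v (C *v z)) \<bullet> z"
      by (simp only: inner_matrix_vector transpose_transpose)
    then show ?thesis by (simp only: matrix_vector_mul_assoc Ci matrix_vector_mul_lid)
  qed
  have detC: "det C \<noteq> 0" using arg_cong[OF C, of det] by (auto simp: det_mul)
  have det: "sqrt ((2 * pi) ^ CARD('n) * det ?\<Sigma>) = sqrt (2 * pi) ^ CARD('n) * \<bar>det C\<bar>"
    by (simp add: det_mul det_transpose real_sqrt_mult real_sqrt_power power_mult_distrib)
  have dens: "ennreal \<bar>det C\<bar> * ennreal (mvn_density \<mu> ?\<Sigma> (?T z)) =
      ennreal (exp (- (1 / 2) * (z \<bullet> z)) / sqrt (2 * pi) ^ CARD('n))" for z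
    unfolding mvn_density_def det using detC quad[of z]
    by (simp add: ennreal_mult'[symmetric] divide_simps)
  have "mvn \<mu> ?\<Sigma> = density (density (distr lborel borel ?T) (\<lambda>_. ennreal \<bar>det C\<bar>))
      (\<lambda>x. ennreal (mvn_density \<mu> ?\<Sigma> x))"
    unfolding mvn_def by (simp flip: lborel_affine_map[OF C])
  also have "\<dots> = density (distr lborel borel ?T) (\<lambda>x. ennreal \<bar>det C\<bar> * ennreal (mvn_density \<mu> ?\<Sigma> x))"
    by (subst density_density_eq) auto
  also have "\<dots> = distr (density lborel (\<lambda>z. ennreal \<bar>det C\<bar> * ennreal (mvn_density \<mu> ?\<Sigma> (?T z)))) borel ?T"
    by (intro density_distr) auto
  also have "\<dots> = distr std_normal_vec borel ?T"
    unfolding dens std_normal_vec_density ..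
  finally show ?thesis .
qed

lemma prob_space_mvn:
  fixes \<Sigma> :: "real ^ 'n ^ 'n"
  assumes \<Sigma>: "pos_def \<Sigma>"
  shows "prob_space (mvn \<mu> \<Sigma>)"
proof -
  from assms obtain C Ci :: "real ^ 'n ^ 'n" where C: "\<Sigma> = C ** transpose C" "C ** Ci = mat 1"
    by (metis pos_def_factorization matrix_inv_inverse(1))
  interpret prob_space "std_normal_vec :: (real ^ 'n) measure" by (rule prob_space_std_normal_vec)
  have [measurable]: "(\<lambda>z. \<mu> + C *v z) \<in> borel_measurable borel"
    by (intro borel_measurable_continuous_onI continuous_intros matrix_vector.continuous_on)
  show ?thesis
    unfolding C(1) mvn_eq_distr[OF C(2)] by (rule prob_space_distr) measurable
qed

lemma matrix_normal_density_rows: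
  fixes X :: "real ^ 'p ^ 'm"
  assumes "pos_def \<Sigma>"
  shows "matrix_normal_density M (mat 1) \<Sigma> X = (\<Prod>i\<in>UNIV. mvn_density (M $ i) \<Sigma> (X $ i))"
proof -
  have inv: "matrix_inv (mat 1 :: real ^ 'm ^ 'm) = mat 1" by (intro matrix_inv_eqI(1)) simp
  have tr: "trace (Y ** N ** transpose Y) = (\<Sum>i\<in>UNIV. Y $ i \<bullet> (N *v Y $ i))"
    for Y :: "real ^ 'p ^ 'm" and N :: "real ^ 'p ^ 'p"
  proof -
    have "trace (Y ** (N ** transpose Y)) = (\<Sum>i\<in>UNIV. Y $ i \<bullet> (N *v Y $ i))"
      by (simp add: trace_def matrix_matrix_mult_def matrix_vector_mult_def transpose_def inner_vec_def)
    then show ?thesis by (simp add: matrix_mul_assoc)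
  qed
  have "(\<Prod>i\<in>(UNIV :: 'm set). mvn_density (M $ i) \<Sigma> (X $ i)) =
      exp (- (1 / 2) * (\<Sum>i\<in>UNIV. (X - M) $ i \<bullet> (matrix_inv \<Sigma> *v (X - M) $ i))) /
      sqrt ((2 * pi) ^ CARD('p) * det \<Sigma>) ^ CARD('m)"
    unfolding mvn_density_def by (simp add: prod_dividef exp_sum[symmetric] sum_distrib_left sum_negf)
  also have "sqrt ((2 * pi) ^ CARD('p) * det \<Sigma>) ^ CARD('m) =
      sqrt ((2 * pi) ^ (CARD('m) * CARD('p)) * 1 ^ CARD('p) * det \<Sigma> ^ CARD('m))"
    by (simp add: real_sqrt_power[symmetric] power_mult_distrib power_mult[symmetric] mult.commute)
  finally show ?thesis
    unfolding matrix_normal_density_def by (simp add: inv tr det_I)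
qed

lemma matrix_normal_rows:
  fixes M :: "real ^ 'p ^ 'm"
  assumes "pos_def \<Sigma>"
  shows "matrix_normal M (mat 1) \<Sigma> = distr (PiM UNIV (\<lambda>i. mvn (M $ i) \<Sigma>)) borel vec_lambda"
proof -
  have "matrix_normal M (mat 1) \<Sigma> =
      density lborel (\<lambda>X. \<Prod>i\<in>UNIV. ennreal (mvn_density (M $ i) \<Sigma> (X $ i)))"
    unfolding matrix_normal_def matrix_normal_density_rows[OF assms]
    using mvn_density_pos[OF assms] by (simp add: prod_ennreal less_imp_le)
  also have "\<dots> = distr (PiM UNIV (\<lambda>i. mvn (M $ i) \<Sigma>)) borel vec_lambda"
    unfolding mvn_def
    by (intro density_vec) (auto simp: mvn_def[symmetric] prob_space_mvn assms)
  finally show ?thesis .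
qed

section \<open>Integration by parts for Gaussian measures\<close>

text \<open>
  The boundary terms of the integration by parts. The crude bound \<open>exp (x\<^sup>2 / 2) \<ge> x\<^sup>2 / 2\<close> is enough for
  functions of linear growth.
\<close>

lemma tendsto_zero_mult_gaussian:
  fixes g :: "real \<Rightarrow> real"
  assumes "\<And>x. \<bar>g x\<bar> \<le> a + b * \<bar>x\<bar>" "0 \<le> a" "0 \<le> b"
  shows "((\<lambda>x. g x * std_normal_density x) \<longlongrightarrow> 0) at_top"
proof (rule Lim_null_comparison)
  show "\<forall>\<^sub>F x in at_top. norm (g x * std_normal_density x) \<le> 2 * (a + b) / x"
  proof (rule eventually_mono[OF eventually_ge_at_top[of 1]])
    fix x :: real assume x: "1 \<le> x"
    have "1 + x\<^sup>2 / 2 \<le> exp (x\<^sup>2 / 2)" by (rule exp_ge_add_one_self)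
    then have "x\<^sup>2 / 2 \<le> exp (x\<^sup>2 / 2)" by linarith
    then have "exp (- x\<^sup>2 / 2) \<le> 2 / x\<^sup>2" using x by (simp add: exp_minus divide_simps mult.commute)
    moreover have "1 / sqrt (2 * pi) \<le> 1" using pi_gt3 by (simp add: divide_simps)
    ultimately have "std_normal_density x \<le> 1 * (2 / x\<^sup>2)"
      unfolding std_normal_density_def by (intro mult_mono) auto
    moreover have "\<bar>g x\<bar> \<le> (a + b) * x"
      using assms(1)[of x] x mult_left_mono[OF x assms(2)] by (simp add: algebra_simps)
    ultimately have "\<bar>g x\<bar> * std_normal_density x \<le> (a + b) * x * (1 * (2 / x\<^sup>2))"
      using assms(2,3) x by (intro mult_mono) auto
    also have "\<dots> = 2 * (a + b) / x" using x by (simp add: power2_eq_square)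
    finally show "norm (g x * std_normal_density x) \<le> 2 * (a + b) / x" by (simp add: abs_mult)
  qed
  show "((\<lambda>x. 2 * (a + b) / x) \<longlongrightarrow> 0) at_top"
    by (intro tendsto_divide_0[OF tendsto_const] filterlim_at_top_imp_at_infinity filterlim_ident)
qed

lemma integrable_std_normal_iff:
  fixes f :: "real \<Rightarrow> real"
  assumes "f \<in> borel_measurable borel"
  shows "integrable std_normal f \<longleftrightarrow> integrable lborel (\<lambda>x. std_normal_density x * f x)"
  using assms by (subst integrable_density) auto

lemma integrable_std_normal_power: "integrable std_normal (\<lambda>x. \<bar>x\<bar> ^ k)" "integrable std_normal (\<lambda>x. x ^ k)"
  by (simp_all add: integrable_std_normal_iff integrable_std_normal_moment_abs integrable_std_normal_moment)

text \<open>
  The Gaussian density \<open>\<phi>\<close> satisfies \<open>\<phi>' = - x \<phi>\<close>, so \<open>(f' - x f) \<phi>\<close> is the derivative of \<open>f \<phi>\<close>, which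
  vanishes at both ends.
\<close>

lemma stein_std_normal:
  fixes f f' :: "real \<Rightarrow> real"
  assumes deriv: "\<And>x. (f has_real_derivative f' x) (at x)"
    and cont: "continuous_on UNIV f'" and bound: "\<And>x. \<bar>f' x\<bar> \<le> c"
  shows "(\<integral>x. x * f x \<partial>std_normal) = (\<integral>x. f' x \<partial>std_normal)"
proof -
  interpret prob_space std_normal by (rule prob_space_std_normal)
  have c: "0 \<le> c" using bound[of 0] by linarith
  have growth: "\<bar>f x\<bar> \<le> \<bar>f 0\<bar> + c * \<bar>x\<bar>" for x
    using field_differentiable_bound[of UNIV f f' c x 0] deriv bound by (simp add: has_field_derivative_at_within)
  have f_cont: "continuous_on UNIV f"
    using deriv by (meson DERIV_isCont continuous_at_imp_continuous_on)
  have [measurable]: "f \<in> borel_measurable borel" "f' \<in> borel_measurable borel"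
    using f_cont cont by (auto intro: borel_measurable_continuous_onI)
  have int': "integrable std_normal f'"
    by (rule integrable_const_bound[of _ c]) (use bound in auto)
  have int: "integrable std_normal (\<lambda>x. x * f x)"
  proof (rule Bochner_Integration.integrable_bound)
    show "integrable std_normal (\<lambda>x. \<bar>f 0\<bar> * \<bar>x\<bar> ^ 1 + c * \<bar>x\<bar> ^ 2)"
      by (intro Bochner_Integration.integrable_add integrable_mult_right integrable_std_normal_power)
    have "norm (x * f x) \<le> norm (\<bar>f 0\<bar> * \<bar>x\<bar> ^ 1 + c * \<bar>x\<bar> ^ 2)" for x
      using mult_left_mono[OF growth[of x], of "\<bar>x\<bar>"] c
      by (simp add: abs_mult algebra_simps power2_eq_square)
    then show "AE x in std_normal. norm (x * f x) \<le> norm (\<bar>f 0\<bar> * \<bar>x\<bar> ^ 1 + c * \<bar>x\<bar> ^ 2)" by simp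
  qed simp
  define g where "g = (\<lambda>x. (f' x - x * f x) * std_normal_density x)"
  have g_int: "integrable lborel g"
  proof -
    have "integrable std_normal (\<lambda>x. f' x - x * f x)" using int int' by simp
    then show ?thesis by (simp add: integrable_std_normal_iff g_def mult.commute)
  qed
  have dG: "((\<lambda>x. f x * std_normal_density x) has_real_derivative g x) (at x)" for x
  proof -
    define c where "c = 1 / sqrt (2 * pi)"
    have "std_normal_density = (\<lambda>x. c * exp (- x\<^sup>2 / 2))"
      by (simp add: fun_eq_iff std_normal_density_def c_def)
    then show ?thesis
      unfolding g_def by (auto intro!: derivative_eq_intros deriv simp: algebra_simps)
  qed
  have "(LBINT x=-\<infinity>..\<infinity>. g x) = 0 - 0"
  proof (rule interval_integral_FTC_integrable[where F = "\<lambda>x. f x * std_normal_density x"])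
    show "((\<lambda>x. f x * std_normal_density x) has_vector_derivative g x) (at x)" for x
      using dG[of x] by (simp add: has_real_derivative_iff_has_vector_derivative)
    show "isCont g x" for x
    proof -
      have "continuous_on UNIV g"
        unfolding g_def std_normal_density_def by (intro continuous_intros f_cont cont) auto
      then show ?thesis by (simp add: continuous_on_eq_continuous_at)
    qed
    show "set_integrable lborel (einterval (- \<infinity>) \<infinity>) g"
      using g_int by (simp add: set_integrable_def einterval_def)
    show "(((\<lambda>x. f x * std_normal_density x) \<circ> real_of_ereal) \<longlongrightarrow> 0) (at_left \<infinity>)"
      using tendsto_zero_mult_gaussian[OF growth abs_ge_zero c]
      by (simp add: at_left_PInf filterlim_filtermap o_def)
    have "((\<lambda>x. f (- x) * std_normal_density x) \<longlongrightarrow> 0) at_top"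
      using growth c by (intro tendsto_zero_mult_gaussian[of _ "\<bar>f 0\<bar>" c]) (metis abs_minus_cancel, auto)
    then show "(((\<lambda>x. f x * std_normal_density x) \<circ> real_of_ereal) \<longlongrightarrow> 0) (at_right (- \<infinity>))"
      by (simp add: at_right_MInf filterlim_filtermap o_def filterlim_at_bot_mirror std_normal_density_def)
  qed auto
  then have "integral\<^sup>L lborel g = 0"
    by (simp add: interval_lebesgue_integral_def set_lebesgue_integral_def einterval_def)
  moreover have "integral\<^sup>L lborel g = (\<integral>x. f' x - x * f x \<partial>std_normal)"
    by (subst integral_density) (auto simp: g_def mult.commute)
  ultimately show ?thesis using int int' by simp
qed

lemma integral_std_normal_vec_update:
  fixes F :: "real ^ 'n \<Rightarrow> real"
  assumes "integrable std_normal_vec F"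
  shows "(\<integral>z. F z \<partial>std_normal_vec) =
    (\<integral>x. (\<integral>y. F (vec_lambda (x(j := y))) \<partial>std_normal) \<partial>PiM (UNIV - {j}) (\<lambda>_. std_normal))"
proof -
  interpret product_prob_space "\<lambda>_::'n. std_normal"
    by (intro product_prob_spaceI prob_space_std_normal)
  have [measurable]: "F \<in> borel_measurable borel"
    using borel_measurable_integrable[OF assms] by simp
  have "(\<integral>z. F z \<partial>std_normal_vec) = (\<integral>x. F (vec_lambda x) \<partial>PiM UNIV (\<lambda>_. std_normal))"
    unfolding std_normal_vec_def by (intro integral_distr) auto
  also have "PiM UNIV (\<lambda>_::'n. std_normal) = PiM (insert j (UNIV - {j})) (\<lambda>_. std_normal)"
    by (simp add: insert_absorb)
  also have "integral\<^sup>L \<dots> (\<lambda>x. F (vec_lambda x)) =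
      (\<integral>x. (\<integral>y. F (vec_lambda (x(j := y))) \<partial>std_normal) \<partial>PiM (UNIV - {j}) (\<lambda>_. std_normal))"
  proof (rule product_integral_insert)
    show "integrable (Pi\<^sub>M (insert j (UNIV - {j})) (\<lambda>_. std_normal)) (\<lambda>x. F (vec_lambda x))"
      using assms unfolding std_normal_vec_def
      by (subst (asm) integrable_distr_eq) (auto simp: insert_absorb)
  qed auto
  finally show ?thesis .
qed

lemma integrable_std_normal_vec_coord:
  fixes g :: "real \<Rightarrow> real"
  assumes "integrable std_normal g"
  shows "integrable (std_normal_vec :: (real ^ 'n) measure) (\<lambda>z. g (z $ j))"
proof -
  have [measurable]: "g \<in> borel_measurable borel" using borel_measurable_integrable[OF assms] by simp
  have "(\<lambda>z::real ^ 'n. z $ j) \<in> borel_measurable borel"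
    by (intro borel_measurable_continuous_onI continuous_intros)
  then have [measurable]: "(\<lambda>z::real ^ 'n. g (z $ j)) \<in> borel_measurable borel" by measurable
  have "integrable (distr (PiM UNIV (\<lambda>_::'n. std_normal)) std_normal (\<lambda>x. x j)) g"
    using assms by (subst distr_PiM_component) (auto intro: prob_space_std_normal)
  then have "integrable (PiM UNIV (\<lambda>_::'n. std_normal)) (\<lambda>x. g (x j))"
    by (subst (asm) integrable_distr_eq) auto
  then show ?thesis unfolding std_normal_vec_def by (subst integrable_distr_eq) auto
qed

lemma integrable_std_normal_vec_norm2:
  "integrable (std_normal_vec :: (real ^ 'n) measure) (\<lambda>z. (norm z)\<^sup>2)"
proof -
  have "(\<lambda>z::real ^ 'n. (norm z)\<^sup>2) = (\<lambda>z. \<Sum>j\<in>UNIV. (z $ j)\<^sup>2)"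
    by (simp only: power2_norm_eq_inner inner_vec_def inner_real_def power2_eq_square[of "_ $ _"])
  then show ?thesis
    by (simp only:) (intro Bochner_Integration.integrable_sum integrable_std_normal_vec_coord
        integrable_std_normal_power)
qed

lemma has_derivative_bound_linear:
  fixes h :: "real ^ 'n \<Rightarrow> real ^ 'm" and D :: "real ^ 'n \<Rightarrow> real ^ 'n ^ 'm"
  assumes deriv: "\<And>z. (h has_derivative (\<lambda>v. D z *v v)) (at z)"
    and bound: "\<And>z. norm (D z) \<le> c"
  shows "\<exists>L\<ge>0. \<forall>z. norm (h z) \<le> norm (h 0) + L * norm z"
proof -
  obtain K where K: "0 < K" "\<And>(A :: real ^ 'n ^ 'm) v. norm (A *v v) \<le> norm A * norm v * K"
    using matrix_vector.pos_bounded by blast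
  have c: "0 \<le> c" using bound[of 0] norm_ge_zero order_trans by blast
  have "norm (h z - h 0) \<le> (c * K) * norm (z - 0)" for z
  proof (rule differentiable_bound[of UNIV h "\<lambda>z v. D z *v v"])
    show "onorm ((*v) (D x)) \<le> c * K" for x
    proof (rule onorm_le)
      fix v :: "real ^ 'n"
      have "norm (D x) * norm v * K \<le> c * norm v * K"
        using bound K(1) by (intro mult_right_mono) auto
      then show "norm (D x *v v) \<le> c * K * norm v" using K(2)[of "D x" v] by (simp add: mult_ac)
    qed
  qed (use deriv in auto)
  then have "norm (h z) \<le> norm (h 0) + (c * K) * norm z" for z
    using norm_triangle_ineq2[of "h z" "h 0"] by (smt (verit) diff_zero)
  then show ?thesis using c K(1) by (intro exI[of _ "c * K"]) auto
qed

lemma borel_measurable_trace [measurable]: "trace \<in> borel_measurable (borel :: (real ^ 'n ^ 'n) measure)"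
  unfolding trace_def by (intro borel_measurable_continuous_onI continuous_intros)

text \<open>
  The one-dimensional identity is applied to the \<open>j\<close>-th component of the field along the \<open>j\<close>-th
  coordinate, and the results are summed to the divergence.
\<close>

lemma stein_std_normal_vec:
  fixes h :: "real ^ 'n \<Rightarrow> real ^ 'n" and D :: "real ^ 'n \<Rightarrow> real ^ 'n ^ 'n"
  assumes deriv: "\<And>z. (h has_derivative (\<lambda>v. D z *v v)) (at z)"
    and cont: "continuous_on UNIV D" and bound: "\<And>z. norm (D z) \<le> c"
  shows "integrable std_normal_vec (\<lambda>z. z \<bullet> h z)"
    and "(\<integral>z. z \<bullet> h z \<partial>std_normal_vec) = (\<integral>z. trace (D z) \<partial>std_normal_vec)"
proof -
  interpret prob_space "std_normal_vec :: (real ^ 'n) measure" by (rule prob_space_std_normal_vec)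
  obtain L where L: "0 \<le> L" "\<And>z. norm (h z) \<le> norm (h 0) + L * norm z"
    using has_derivative_bound_linear[OF deriv bound] by blast
  have h_cont: "continuous_on UNIV h"
    using deriv by (meson has_derivative_continuous continuous_at_imp_continuous_on)
  have coord: "norm (A $ i $ j) \<le> norm A" for A :: "real ^ 'n ^ 'n" and i j
    using component_le_norm_cart[of "A $ i" j] Finite_Cartesian_Product.norm_nth_le[of A i] by simp
  have m1 [measurable]: "(\<lambda>z. z $ j * h z $ j) \<in> borel_measurable borel" for j
    by (intro borel_measurable_continuous_onI continuous_intros h_cont)
  have m2 [measurable]: "(\<lambda>z. D z $ j $ j) \<in> borel_measurable borel" for j
    by (intro borel_measurable_continuous_onI continuous_intros cont)
  have int1: "integrable std_normal_vec (\<lambda>z. z $ j * h z $ j)" for j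
  proof (rule Bochner_Integration.integrable_bound)
    show "integrable (std_normal_vec :: (real ^ 'n) measure)
        (\<lambda>z. norm (h 0) + (norm (h 0) + L) * (norm z)\<^sup>2)"
      by (intro Bochner_Integration.integrable_add integrable_mult_right integrable_std_normal_vec_norm2) simp
    have "norm (z $ j * h z $ j) \<le> norm (h 0) + (norm (h 0) + L) * (norm z)\<^sup>2" for z
    proof -
      have "norm (z $ j * h z $ j) \<le> norm z * norm (h z)"
        unfolding norm_mult by (intro mult_mono) (auto simp: component_le_norm_cart)
      also have "\<dots> \<le> norm z * (norm (h 0) + L * norm z)" by (intro mult_left_mono L) auto
      also have "\<dots> = norm (h 0) * norm z + L * (norm z)\<^sup>2" by (simp add: algebra_simps power2_eq_square)
      also have "norm (h 0) * norm z \<le> norm (h 0) * (1 + (norm z)\<^sup>2)"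
      proof (intro mult_left_mono)
        have "0 \<le> (norm z - 1)\<^sup>2" by simp
        then have "2 * norm z \<le> 1 + (norm z)\<^sup>2" by (simp add: power2_diff)
        then show "norm z \<le> 1 + (norm z)\<^sup>2" using norm_ge_zero[of z] by linarith
      qed simp
      finally show ?thesis by (simp add: algebra_simps)
    qed
    then show "AE z in std_normal_vec. norm (z $ j * h z $ j) \<le> norm (norm (h 0) + (norm (h 0) + L) * (norm z)\<^sup>2)"
      using L(1) by (intro AE_I2) (simp add: add_nonneg_nonneg)
  qed simp
  have int2: "integrable std_normal_vec (\<lambda>z. D z $ j $ j)" for j
    by (rule integrable_const_bound[of _ c]) (use coord bound order_trans in \<open>auto, blast\<close>)
  show "integrable std_normal_vec (\<lambda>z. z \<bullet> h z)"
    unfolding inner_vec_def inner_real_def by (intro Bochner_Integration.integrable_sum int1)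
  have slice: "(\<integral>y. vec_lambda (x(j := y)) $ j * h (vec_lambda (x(j := y))) $ j \<partial>std_normal) =
      (\<integral>y. D (vec_lambda (x(j := y))) $ j $ j \<partial>std_normal)" for x :: "'n \<Rightarrow> real" and j
  proof -
    let ?p = "\<lambda>y. vec_lambda (x(j := y)) :: real ^ 'n"
    define b where "b = ?p 0"
    have p_eq: "?p = (\<lambda>y. b + y *\<^sub>R axis j 1)"
      by (simp add: b_def fun_eq_iff vec_eq_iff axis_def)
    have "(\<integral>y. y * h (?p y) $ j \<partial>std_normal) = (\<integral>y. D (?p y) $ j $ j \<partial>std_normal)"
    proof (rule stein_std_normal)
      fix y
      have p: "(?p has_derivative (\<lambda>t. t *\<^sub>R axis j 1)) (at y)"
        unfolding p_eq by (auto intro!: derivative_eq_intros)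
      have "((\<lambda>y. h (?p y)) has_derivative (\<lambda>t. D (?p y) *v (t *\<^sub>R axis j 1))) (at y)"
        using has_derivative_compose[OF p deriv] .
      then have "((\<lambda>y. h (?p y) $ j) has_derivative (\<lambda>t. (D (?p y) *v (t *\<^sub>R axis j 1)) $ j)) (at y)"
        by (rule bounded_linear.has_derivative[OF bounded_linear_vec_nth])
      moreover have "(D (?p y) *v (t *\<^sub>R axis j 1)) $ j = D (?p y) $ j $ j * t" for t
        by (simp add: matrix_vector_mult_scaleR matrix_vector_mult_basis column_def)
      ultimately show "((\<lambda>y. h (?p y) $ j) has_real_derivative D (?p y) $ j $ j) (at y)"
        by (simp add: has_field_derivative_def)
    next
      have p_cont: "continuous_on UNIV ?p"
        unfolding p_eq by (intro continuous_intros)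
      show "continuous_on UNIV (\<lambda>y. D (?p y) $ j $ j)"
        by (intro continuous_intros continuous_on_compose2[OF cont p_cont]) auto
      show "\<bar>D (?p y) $ j $ j\<bar> \<le> c" for y
        using coord[of "D (?p y)" j j] bound[of "?p y"] by simp
    qed
    then show ?thesis by simp
  qed
  have eq: "(\<integral>z. z $ j * h z $ j \<partial>std_normal_vec) = (\<integral>z. D z $ j $ j \<partial>std_normal_vec)" for j
    by (simp only: integral_std_normal_vec_update[OF int1[of j], where j = j]
        integral_std_normal_vec_update[OF int2[of j], where j = j] slice)
  show "(\<integral>z. z \<bullet> h z \<partial>std_normal_vec) = (\<integral>z. trace (D z) \<partial>std_normal_vec)"
    unfolding inner_vec_def inner_real_def trace_def
    by (simp add: Bochner_Integration.integral_sum int1 int2 eq)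
qed

text \<open>
  With \<open>\<Sigma> = C C\<^sup>T\<close> and \<open>x = \<mu> + C z\<close> the left-hand side is \<open>z \<bullet> C\<^sup>-\<^sup>1 h\<close>, and the Jacobian \<open>C\<^sup>-\<^sup>1 D C\<close> of the
  field \<open>C\<^sup>-\<^sup>1 h (\<mu> + C z)\<close> has the trace of \<open>D\<close>.
\<close>

theorem stein_mvn:
  fixes h :: "real ^ 'n \<Rightarrow> real ^ 'n" and D :: "real ^ 'n \<Rightarrow> real ^ 'n ^ 'n"
  assumes \<Sigma>: "pos_def \<Sigma>"
    and deriv: "\<And>x. (h has_derivative (\<lambda>v. D x *v v)) (at x)"
    and cont: "continuous_on UNIV D" and bound: "\<And>x. norm (D x) \<le> c"
  shows "integrable (mvn \<mu> \<Sigma>) (\<lambda>x. (matrix_inv \<Sigma> *v (x - \<mu>)) \<bullet> h x)"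
    and "(\<integral>x. (matrix_inv \<Sigma> *v (x - \<mu>)) \<bullet> h x \<partial>mvn \<mu> \<Sigma>) = (\<integral>x. trace (D x) \<partial>mvn \<mu> \<Sigma>)"
proof -
  obtain C :: "real ^ 'n ^ 'n" where C: "invertible C" "\<Sigma> = C ** transpose C"
    by (rule pos_def_factorization[OF \<Sigma>])
  define Ci where "Ci = matrix_inv C"
  have CCi: "C ** Ci = mat 1" "Ci ** C = mat 1" unfolding Ci_def using matrix_inv_inverse[OF C(1)] by auto
  let ?T = "\<lambda>z. \<mu> + C *v z"
  have T_cont: "continuous_on UNIV ?T"
    by (intro continuous_intros matrix_vector_mult_linear_continuous_on)
  have [measurable]: "?T \<in> borel_measurable borel" using T_cont by (rule borel_measurable_continuous_onI)
  have h_cont: "continuous_on UNIV h"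
    using deriv by (meson has_derivative_continuous continuous_at_imp_continuous_on)
  have [measurable]: "h \<in> borel_measurable borel" "D \<in> borel_measurable borel"
    using h_cont cont by (auto intro: borel_measurable_continuous_onI)
  have m: "(\<lambda>x. (matrix_inv \<Sigma> *v (x - \<mu>)) \<bullet> h x) \<in> borel_measurable borel"
    by (intro borel_measurable_continuous_onI continuous_intros h_cont matrix_vector.continuous_on)
  have inv: "matrix_inv \<Sigma> = transpose Ci ** Ci"
  proof (rule matrix_inv_eqI(1))
    have "\<Sigma> ** (transpose Ci ** Ci) = C ** (transpose C ** transpose Ci) ** Ci"
      unfolding C(2) by (simp only: matrix_mul_assoc)
    also have "transpose C ** transpose Ci = mat 1"
      using CCi(2) by (metis matrix_transpose_mul transpose_mat)
    finally show "\<Sigma> ** (transpose Ci ** Ci) = mat 1" by (simp add: CCi)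
  qed
  have inner: "(matrix_inv \<Sigma> *v (?T z - \<mu>)) \<bullet> h (?T z) = z \<bullet> (Ci *v h (?T z))" for z
  proof -
    have "matrix_inv \<Sigma> *v (?T z - \<mu>) = (transpose Ci ** Ci ** C) *v z"
      unfolding inv by (simp add: matrix_vector_mul_assoc del: transpose_matrix_vector)
    also have "\<dots> = transpose Ci *v z" by (simp only: matrix_mul_assoc[symmetric] CCi matrix_mul_rid)
    finally show ?thesis by (simp only: inner_matrix_vector[of z])
  qed
  define D' where "D' = (\<lambda>z. Ci ** D (?T z) ** C)"
  have tr: "trace (D' z) = trace (D (?T z))" for z
    unfolding D'_def using trace_mul_sym[of "Ci ** D (?T z)" C]
    by (simp add: matrix_mul_assoc CCi(1))
  have deriv': "((\<lambda>z. Ci *v h (?T z)) has_derivative (\<lambda>v. D' z *v v)) (at z)" for z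
  proof -
    have "((*v) C has_derivative (*v) C) (at z)"
      by (rule bounded_linear_imp_has_derivative[OF matrix_vector.bounded_linear_right])
    from has_derivative_add[OF has_derivative_const this]
    have "(?T has_derivative (\<lambda>v. C *v v)) (at z)" by simp
    from has_derivative_compose[OF this deriv]
    have "((\<lambda>z. h (?T z)) has_derivative (\<lambda>v. D (?T z) *v (C *v v))) (at z)" .
    from bounded_linear.has_derivative[OF matrix_vector.bounded_linear_right this]
    show ?thesis by (simp add: D'_def matrix_vector_mul_assoc matrix_mul_assoc)
  qed
  have cont': "continuous_on UNIV D'"
    unfolding D'_def by (intro matrix_mult.continuous_on continuous_on_const
        continuous_on_compose2[OF cont T_cont]) auto
  have "bounded_linear (\<lambda>M. Ci ** M ** C)"
    by (intro bounded_linear_compose[OF matrix_mult.bounded_linear_left] matrix_mult.bounded_linear_right)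
  then obtain K where K: "0 < K" "\<And>M. norm (Ci ** M ** C) \<le> norm M * K"
    using bounded_linear.pos_bounded by blast
  have bound': "norm (D' z) \<le> c * K" for z
    using K(2)[of "D (?T z)"] mult_right_mono[OF bound[of "?T z"], of K] K(1)
    unfolding D'_def by linarith
  note stein = stein_std_normal_vec[OF deriv' cont' bound']
  have mvn_\<Sigma>: "mvn \<mu> \<Sigma> = distr std_normal_vec borel ?T"
    unfolding C(2) by (rule mvn_eq_distr[OF CCi(1)])
  show "integrable (mvn \<mu> \<Sigma>) (\<lambda>x. (matrix_inv \<Sigma> *v (x - \<mu>)) \<bullet> h x)"
    unfolding mvn_\<Sigma> using m stein(1) by (subst integrable_distr_eq) (auto simp: inner[simplified])
  have "(\<integral>x. (matrix_inv \<Sigma> *v (x - \<mu>)) \<bullet> h x \<partial>mvn \<mu> \<Sigma>) =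
      (\<integral>z. (matrix_inv \<Sigma> *v (?T z - \<mu>)) \<bullet> h (?T z) \<partial>std_normal_vec)"
    using m unfolding mvn_\<Sigma> by (intro integral_distr) auto
  also have "\<dots> = (\<integral>z. trace (D (?T z)) \<partial>std_normal_vec)"
    unfolding inner using stein(2) by (simp add: tr)
  also have "\<dots> = (\<integral>x. trace (D x) \<partial>mvn \<mu> \<Sigma>)"
    unfolding mvn_\<Sigma> by (intro integral_distr[symmetric]) auto
  finally show "(\<integral>x. (matrix_inv \<Sigma> *v (x - \<mu>)) \<bullet> h x \<partial>mvn \<mu> \<Sigma>) = (\<integral>x. trace (D x) \<partial>mvn \<mu> \<Sigma>)" .
qed

text \<open>
  In a product of Gaussian measures one factor may be integrated by parts while the others are
  fixed; the regularity is needed only along almost all of these slices.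
\<close>

theorem stein_PiM:
  fixes h :: "('i \<Rightarrow> real ^ 'p) \<Rightarrow> real ^ 'p" and D :: "('i \<Rightarrow> real ^ 'p) \<Rightarrow> real ^ 'p ^ 'p"
  assumes fin: "finite I" and i: "i \<in> I" and \<Sigma>: "pos_def \<Sigma>"
    and int1: "integrable (PiM I (\<lambda>i. mvn (\<theta> i) \<Sigma>)) (\<lambda>x. (matrix_inv \<Sigma> *v (x i - \<theta> i)) \<bullet> h x)"
    and int2: "integrable (PiM I (\<lambda>i. mvn (\<theta> i) \<Sigma>)) (\<lambda>x. trace (D x))"
    and slice: "AE x in PiM (I - {i}) (\<lambda>i. mvn (\<theta> i) \<Sigma>).
      (\<forall>y. ((\<lambda>y. h (x(i := y))) has_derivative (\<lambda>v. D (x(i := y)) *v v)) (at y)) \<and>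
      continuous_on UNIV (\<lambda>y. D (x(i := y))) \<and> bounded (range (\<lambda>y. D (x(i := y))))"
  shows "(\<integral>x. (matrix_inv \<Sigma> *v (x i - \<theta> i)) \<bullet> h x \<partial>PiM I (\<lambda>i. mvn (\<theta> i) \<Sigma>)) =
    (\<integral>x. trace (D x) \<partial>PiM I (\<lambda>i. mvn (\<theta> i) \<Sigma>))"
proof -
  let ?M = "\<lambda>i. mvn (\<theta> i) \<Sigma>"
  interpret product_prob_space ?M
    by (intro product_prob_spaceI prob_space_mvn \<Sigma>)
  have I: "insert i (I - {i}) = I" using i by auto
  have meas: "(\<lambda>x. \<integral>y. f (x(i := y)) \<partial>?M i) \<in> borel_measurable (PiM (I - {i}) ?M)"
    if f: "f \<in> borel_measurable (PiM I ?M)" for f :: "('i \<Rightarrow> real ^ 'p) \<Rightarrow> real"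
  proof -
    have "(\<lambda>(x, y). f (x(i := y))) \<in> borel_measurable (PiM (I - {i}) ?M \<Otimes>\<^sub>M ?M i)"
      using measurable_comp[OF measurable_add_dim[of i "I - {i}" ?M], of f borel] f
      using i by (simp add: insert_absorb o_def case_prod_beta)
    then show ?thesis by (intro M.borel_measurable_lebesgue_integral) simp
  qed
  have int1': "integrable (PiM (insert i (I - {i})) ?M) (\<lambda>x. (matrix_inv \<Sigma> *v (x i - \<theta> i)) \<bullet> h x)"
    and int2': "integrable (PiM (insert i (I - {i})) ?M) (\<lambda>x. trace (D x))"
    using int1 int2 unfolding I by simp_all
  have "(\<integral>x. (matrix_inv \<Sigma> *v (x i - \<theta> i)) \<bullet> h x \<partial>PiM (insert i (I - {i})) ?M) =
      (\<integral>x. (\<integral>y. (matrix_inv \<Sigma> *v ((x(i := y)) i - \<theta> i)) \<bullet> h (x(i := y)) \<partial>?M i) \<partial>PiM (I - {i}) ?M)"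
    by (rule product_integral_insert[OF _ _ int1']) (use fin in auto)
  also have "\<dots> = (\<integral>x. (\<integral>y. trace (D (x(i := y))) \<partial>?M i) \<partial>PiM (I - {i}) ?M)"
  proof (rule integral_cong_AE)
    show "(\<lambda>x. \<integral>y. (matrix_inv \<Sigma> *v ((x(i := y)) i - \<theta> i)) \<bullet> h (x(i := y)) \<partial>?M i)
        \<in> borel_measurable (PiM (I - {i}) ?M)"
      by (rule meas[OF borel_measurable_integrable[OF int1]])
    show "(\<lambda>x. \<integral>y. trace (D (x(i := y))) \<partial>?M i) \<in> borel_measurable (PiM (I - {i}) ?M)"
      by (rule meas[OF borel_measurable_integrable[OF int2]])
    show "AE x in PiM (I - {i}) ?M.
        (\<integral>y. (matrix_inv \<Sigma> *v ((x(i := y)) i - \<theta> i)) \<bullet> h (x(i := y)) \<partial>?M i) =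
        (\<integral>y. trace (D (x(i := y))) \<partial>?M i)"
      using slice
    proof eventually_elim
      case (elim x)
      then obtain c where c: "\<And>y. norm (D (x(i := y))) \<le> c"
        by (auto simp: bounded_iff)
      have "(\<integral>y. (matrix_inv \<Sigma> *v (y - \<theta> i)) \<bullet> h (x(i := y)) \<partial>?M i) =
        (\<integral>y. trace (D (x(i := y))) \<partial>?M i)"
        by (rule stein_mvn(2)[OF \<Sigma> _ _ c]) (use elim in auto)
      then show ?case by simp
    qed
  qed
  also have "\<dots> = (\<integral>x. trace (D x) \<partial>PiM (insert i (I - {i})) ?M)"
    by (rule product_integral_insert[OF _ _ int2', symmetric]) (use fin in auto)
  finally show ?thesis unfolding I .
qed

section \<open>Nonsingularity of Gaussian matrices\<close>

text \<open>
  The value at 0 is infinite, so that a function whose image under \<open>inv_sqrt\<close> has a finite integral is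
  almost everywhere nonzero.
\<close>

definition inv_sqrt :: "real \<Rightarrow> ennreal" where
  "inv_sqrt y = (if y = 0 then \<infinity> else ennreal (\<bar>y\<bar> powr (- (1 / 2))))"

lemma inv_sqrt_measurable [measurable]: "inv_sqrt \<in> borel_measurable borel"
  unfolding inv_sqrt_def[abs_def] by measurable

lemma inv_sqrt_mult: "inv_sqrt (a * b) = inv_sqrt a * inv_sqrt b" if "a \<noteq> 0"
proof (cases "b = 0")
  case True
  then show ?thesis using that by (simp add: inv_sqrt_def ennreal_mult_top)
next
  case False
  then show ?thesis using that by (simp add: inv_sqrt_def abs_mult powr_mult ennreal_mult)
qed

lemma inv_sqrt_mono: "\<bar>a\<bar> \<le> \<bar>b\<bar> \<Longrightarrow> inv_sqrt b \<le> inv_sqrt a"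
  unfolding inv_sqrt_def by (auto intro!: ennreal_leI powr_mono2')

lemma nn_integral_inv_sqrt_near_zero: "(\<integral>\<^sup>+y. inv_sqrt y * indicator {-1..1} y \<partial>lborel) \<le> 4"
proof -
  have half: "(\<integral>\<^sup>+y. ennreal (y powr (- (1 / 2))) * indicator {0..1} y \<partial>lborel) = 2"
  proof -
    have "((\<lambda>y::real. y powr (- (1 / 2))) has_integral (1 powr (- (1 / 2) + 1) / (- (1 / 2) + 1))) {0..1}"
      by (rule has_integral_powr_from_0) auto
    then have "(\<integral>\<^sup>+y. ennreal (y powr (- (1 / 2))) * indicator {0..1} y \<partial>lborel) =
        ennreal (1 powr (- (1 / 2) + 1) / (- (1 / 2) + 1))"
      by (intro nn_integral_has_integral_lebesgue') auto
    then show ?thesis by simp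
  qed
  have "(\<integral>\<^sup>+y. inv_sqrt y * indicator {-1..1} y \<partial>lborel) =
      (\<integral>\<^sup>+y. ennreal (y powr (- (1 / 2))) * indicator {0..1} y +
        ennreal ((- y) powr (- (1 / 2))) * indicator {0..1} (- y) \<partial>lborel)"
    by (intro nn_integral_cong_AE eventually_mono[OF AE_lborel_singleton[of 0]])
      (auto simp: inv_sqrt_def indicator_def)
  also have "\<dots> = 2 + (\<integral>\<^sup>+y. ennreal ((- y) powr (- (1 / 2))) * indicator {0..1} (- y) \<partial>lborel)"
    by (subst nn_integral_add) (auto simp: half)
  also have "(\<integral>\<^sup>+y. ennreal ((- y) powr (- (1 / 2))) * indicator {0..1} (- y) \<partial>lborel) = 2"
    using nn_integral_real_affine[of "\<lambda>y. ennreal (y powr (- (1 / 2))) * indicator {0..1} y" "-1" 0] half by simp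
  finally show ?thesis by simp
qed

text \<open>
  Translations do not matter because the Gaussian density is at most 1 and the singularity of
  \<open>inv_sqrt\<close> is integrable.
\<close>

lemma nn_integral_inv_sqrt_std_normal: "(\<integral>\<^sup>+y. inv_sqrt (a + b * y) \<partial>std_normal) \<le> 5 * inv_sqrt b"
proof (cases "b = 0")
  case True
  then show ?thesis by (simp add: inv_sqrt_def ennreal_mult_top)
next
  case False
  interpret prob_space std_normal by (rule prob_space_std_normal)
  define c where "c = a / b"
  have "inv_sqrt (c + y) \<le> 1 + inv_sqrt (c + y) * indicator {-1..1} (c + y)" for y
  proof (cases "\<bar>c + y\<bar> \<le> 1")
    case False
    then have "inv_sqrt (c + y) \<le> inv_sqrt 1" by (intro inv_sqrt_mono) auto
    also have "inv_sqrt 1 = 1" by (simp add: inv_sqrt_def)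
    finally show ?thesis by (simp add: add_increasing2)
  qed (auto simp: indicator_def add_increasing)
  then have "(\<integral>\<^sup>+y. inv_sqrt (c + y) \<partial>std_normal) \<le>
      (\<integral>\<^sup>+y. 1 + inv_sqrt (c + y) * indicator {-1..1} (c + y) \<partial>std_normal)"
    by (intro nn_integral_mono) auto
  also have "\<dots> = 1 + (\<integral>\<^sup>+y. inv_sqrt (c + y) * indicator {-1..1} (c + y) \<partial>std_normal)"
    by (subst nn_integral_add) (auto simp: emeasure_space_1[simplified])
  finally have 1: "(\<integral>\<^sup>+y. inv_sqrt (c + y) \<partial>std_normal) \<le>
      1 + (\<integral>\<^sup>+y. inv_sqrt (c + y) * indicator {-1..1} (c + y) \<partial>std_normal)" .
  have "(\<integral>\<^sup>+y. inv_sqrt (c + y) * indicator {-1..1} (c + y) \<partial>std_normal) \<le>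
      (\<integral>\<^sup>+y. inv_sqrt (c + y) * indicator {-1..1} (c + y) \<partial>lborel)"
  proof (subst nn_integral_density)
    have "std_normal_density y \<le> 1 * 1" for y
      unfolding std_normal_density_def using pi_gt3 by (intro mult_mono) (auto simp: divide_simps)
    then have "ennreal (std_normal_density y) \<le> 1" for y
      by simp
    then have "ennreal (std_normal_density y) * w \<le> 1 * w" for y w
      by (intro mult_right_mono) auto
    then show "(\<integral>\<^sup>+y. ennreal (std_normal_density y) * (inv_sqrt (c + y) * indicator {-1..1} (c + y)) \<partial>lborel) \<le>
        (\<integral>\<^sup>+y. inv_sqrt (c + y) * indicator {-1..1} (c + y) \<partial>lborel)"
      by (intro nn_integral_mono) (simp only: mult_1)
  qed auto
  also have "\<dots> = (\<integral>\<^sup>+y. inv_sqrt y * indicator {-1..1} y \<partial>lborel)"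
    using nn_integral_real_affine[of "\<lambda>y. inv_sqrt y * indicator {-1..1} y" 1 c] by simp
  also have "\<dots> \<le> 4" by (rule nn_integral_inv_sqrt_near_zero)
  finally have "(\<integral>\<^sup>+y. inv_sqrt (c + y) \<partial>std_normal) \<le> 1 + 4"
    by (intro order_trans[OF 1] add_left_mono)
  then have *: "(\<integral>\<^sup>+y. inv_sqrt (c + y) \<partial>std_normal) \<le> 5" by simp
  have "a + b * y = b * (c + y)" for y using False by (simp add: c_def field_simps)
  then have "(\<integral>\<^sup>+y. inv_sqrt (a + b * y) \<partial>std_normal) = inv_sqrt b * (\<integral>\<^sup>+y. inv_sqrt (c + y) \<partial>std_normal)"
    using False by (simp add: inv_sqrt_mult nn_integral_cmult)
  also have "\<dots> \<le> inv_sqrt b * 5" by (intro mult_left_mono *) auto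
  finally show ?thesis by (simp add: mult.commute)
qed

text \<open>
  When the other coordinates are fixed, \<open>a \<bullet> z\<close> is an affine function of the \<open>j\<close>-th one with slope
  \<open>a\<^sub>j\<close>.
\<close>

lemma nn_integral_inv_sqrt_std_normal_vec:
  "(\<integral>\<^sup>+z. inv_sqrt (a \<bullet> z) \<partial>std_normal_vec) \<le> 5 * inv_sqrt (a $ j)" for a :: "real ^ 'n"
proof -
  interpret product_prob_space "\<lambda>_::'n. std_normal"
    by (intro product_prob_spaceI prob_space_std_normal)
  interpret Q: prob_space "PiM (UNIV - {j}) (\<lambda>_::'n. std_normal)"
    by (intro prob_space_PiM prob_space_std_normal)
  have [measurable]: "(\<lambda>z::real ^ 'n. inv_sqrt (a \<bullet> z)) \<in> borel_measurable borel"
    by (intro measurable_compose[OF _ inv_sqrt_measurable] borel_measurable_continuous_onI continuous_intros)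
  have "(\<integral>\<^sup>+z. inv_sqrt (a \<bullet> z) \<partial>std_normal_vec) =
      (\<integral>\<^sup>+x. inv_sqrt (a \<bullet> vec_lambda x) \<partial>PiM UNIV (\<lambda>_. std_normal))"
    unfolding std_normal_vec_def by (intro nn_integral_distr) auto
  also have "PiM UNIV (\<lambda>_::'n. std_normal) = PiM (insert j (UNIV - {j})) (\<lambda>_. std_normal)"
    by (simp add: insert_absorb)
  also have "integral\<^sup>N \<dots> (\<lambda>x. inv_sqrt (a \<bullet> vec_lambda x)) =
      (\<integral>\<^sup>+x. (\<integral>\<^sup>+y. inv_sqrt (a \<bullet> vec_lambda (x(j := y))) \<partial>std_normal) \<partial>PiM (UNIV - {j}) (\<lambda>_. std_normal))"
    by (rule product_nn_integral_insert) (auto simp: insert_absorb)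
  also have "\<dots> \<le> (\<integral>\<^sup>+x. 5 * inv_sqrt (a $ j) \<partial>PiM (UNIV - {j}) (\<lambda>_. std_normal))"
  proof (intro nn_integral_mono)
    fix x :: "'n \<Rightarrow> real"
    define b where "b = a \<bullet> vec_lambda (x(j := 0))"
    have "a \<bullet> vec_lambda (x(j := y)) = b + a $ j * y" for y
    proof -
      have "vec_lambda (x(j := y)) = vec_lambda (x(j := 0)) + y *\<^sub>R axis j (1::real)"
        by (simp add: vec_eq_iff axis_def)
      then show ?thesis by (simp add: inner_add_right inner_axis b_def)
    qed
    then show "(\<integral>\<^sup>+y. inv_sqrt (a \<bullet> vec_lambda (x(j := y))) \<partial>std_normal) \<le> 5 * inv_sqrt (a $ j)"
      by (simp only: nn_integral_inv_sqrt_std_normal)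
  qed
  also have "\<dots> = 5 * inv_sqrt (a $ j)" by (simp add: Q.emeasure_space_1)
  finally show ?thesis .
qed

text \<open>
  With \<open>\<Sigma> = C C\<^sup>T\<close> the vector \<open>a\<close> is replaced by \<open>b = C\<^sup>T a\<close>. Since \<open>a = (C\<^sup>T)\<^sup>-\<^sup>1 b\<close>, some coordinate of \<open>b\<close>
  is at least a fixed multiple of \<open>\<bar>a\<^sub>j\<bar>\<close>.
\<close>

lemma nn_integral_inv_sqrt_mvn:
  fixes \<Sigma> :: "real ^ 'n ^ 'n"
  assumes \<Sigma>: "pos_def \<Sigma>"
  shows "\<exists>c. 0 \<le> c \<and> (\<forall>a j. (\<integral>\<^sup>+z. inv_sqrt (a \<bullet> z) \<partial>mvn 0 \<Sigma>) \<le> ennreal c * inv_sqrt (a $ j))"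
proof -
  obtain C :: "real ^ 'n ^ 'n" where C: "invertible C" "\<Sigma> = C ** transpose C"
    by (rule pos_def_factorization[OF \<Sigma>])
  define Ci where "Ci = matrix_inv C"
  have CCi: "C ** Ci = mat 1" "Ci ** C = mat 1" unfolding Ci_def using matrix_inv_inverse[OF C(1)] by auto
  define K where "K = 1 + (\<Sum>i\<in>UNIV. \<Sum>j\<in>UNIV. \<bar>Ci $ i $ j\<bar>)"
  have K: "1 \<le> K" unfolding K_def by (simp add: sum_nonneg)
  define c where "c = 5 * (1 / K) powr (- (1 / 2))"
  have "(\<integral>\<^sup>+z. inv_sqrt (a \<bullet> z) \<partial>mvn 0 \<Sigma>) \<le> ennreal c * inv_sqrt (a $ j)" for a :: "real ^ 'n" and j
  proof -
    define b where "b = transpose C *v a"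
    have "transpose Ci ** transpose C = mat 1"
      using arg_cong[OF CCi(1), of transpose] by (simp add: matrix_transpose_mul)
    then have ab: "a = transpose Ci *v b"
      unfolding b_def by (simp only: matrix_vector_mul_assoc matrix_vector_mul_lid)
    have "\<exists>i. \<bar>a $ j\<bar> / K \<le> \<bar>b $ i\<bar>"
    proof -
      obtain i where i: "\<And>l. \<bar>b $ l\<bar> \<le> \<bar>b $ i\<bar>"
        using Max_in[of "range (\<lambda>l. \<bar>b $ l\<bar>)"] Max_ge[of "range (\<lambda>l. \<bar>b $ l\<bar>)"] by fastforce
      have "\<bar>a $ j\<bar> \<le> (\<Sum>l\<in>UNIV. \<bar>Ci $ l $ j\<bar> * \<bar>b $ l\<bar>)"
        unfolding ab matrix_vector_mult_def transpose_def
        by (simp flip: abs_mult)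
      also have "\<dots> \<le> (\<Sum>l\<in>UNIV. (\<Sum>j\<in>UNIV. \<bar>Ci $ l $ j\<bar>) * \<bar>b $ i\<bar>)"
        by (intro sum_mono mult_mono i member_le_sum[of j UNIV "\<lambda>j. \<bar>Ci $ _ $ j\<bar>"] sum_nonneg) auto
      also have "\<dots> \<le> K * \<bar>b $ i\<bar>"
        unfolding K_def sum_distrib_right[symmetric] by (intro mult_right_mono) auto
      finally show ?thesis using K by (intro exI[of _ i]) (simp add: divide_simps mult.commute)
    qed
    then obtain i where i: "\<bar>a $ j\<bar> / K \<le> \<bar>b $ i\<bar>" by blast
    have meas: "(\<lambda>z. 0 + C *v z) \<in> borel_measurable borel" "(\<lambda>z. inv_sqrt (a \<bullet> z)) \<in> borel_measurable borel"
      by (intro measurable_compose[OF _ inv_sqrt_measurable] borel_measurable_continuous_onI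
          continuous_intros matrix_vector.continuous_on)+
    have "(\<integral>\<^sup>+z. inv_sqrt (a \<bullet> z) \<partial>mvn 0 \<Sigma>) = (\<integral>\<^sup>+z. inv_sqrt (a \<bullet> (0 + C *v z)) \<partial>std_normal_vec)"
      unfolding C(2) mvn_eq_distr[OF CCi(1)] by (rule nn_integral_distr) (use meas in auto)
    also have "\<dots> = (\<integral>\<^sup>+z. inv_sqrt (b \<bullet> z) \<partial>std_normal_vec)"
      unfolding b_def by (simp add: inner_matrix_vector)
    also have "\<dots> \<le> 5 * inv_sqrt (b $ i)" by (rule nn_integral_inv_sqrt_std_normal_vec)
    also have "\<dots> \<le> 5 * inv_sqrt (1 / K * (a $ j))"
      using i K by (intro mult_left_mono inv_sqrt_mono) (auto simp: abs_mult)
    also have "\<dots> = ennreal c * inv_sqrt (a $ j)"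
      using K by (subst inv_sqrt_mult) (auto simp: inv_sqrt_def[of "1 / K"] c_def ennreal_mult mult.assoc)
    finally show ?thesis .
  qed
  moreover have "0 \<le> c" by (simp add: c_def)
  ultimately show ?thesis by blast
qed

definition replace_rows :: "real ^ 'n ^ 'n \<Rightarrow> 'n set \<Rightarrow> ('n \<Rightarrow> real ^ 'n) \<Rightarrow> real ^ 'n ^ 'n" where
  "replace_rows B J x = (\<chi> i. if i \<in> J then x i else B $ i)"

lemma borel_measurable_det [measurable]: "det \<in> borel_measurable (borel :: (real ^ 'n ^ 'n) measure)"
  unfolding det_def by (intro borel_measurable_continuous_onI continuous_intros)

lemma measurable_replace_rows [measurable]:
  "replace_rows B J \<in> borel_measurable (PiM J (\<lambda>i. mvn (\<theta> i) \<Sigma>))"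
  unfolding replace_rows_def
proof (rule measurable_vec_lambda)
  fix i
  show "(\<lambda>x. if i \<in> J then x i else B $ i) \<in> borel_measurable (PiM J (\<lambda>i. mvn (\<theta> i) \<Sigma>))"
    using measurable_component_singleton[of i J "\<lambda>i. mvn (\<theta> i) \<Sigma>"]
    by (cases "i \<in> J") (auto cong: measurable_cong_sets)
qed

text \<open>
  The determinant is linear in each row, and its coefficient at the \<open>i\<close>-th coordinate of row \<open>i\<close>
  is the determinant with that row replaced by a unit vector. So Gaussian rows can be exchanged for
  the fixed rows one at a time, at the cost of a constant factor.
\<close>

lemma nn_integral_inv_sqrt_det:
  fixes B :: "real ^ 'n ^ 'n"
  assumes \<Sigma>: "pos_def \<Sigma>" and J: "\<And>i. i \<in> J \<Longrightarrow> B $ i = axis i 1" and B: "det B \<noteq> 0"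
  shows "(\<integral>\<^sup>+x. inv_sqrt (det (replace_rows B J x)) \<partial>PiM J (\<lambda>_. mvn 0 \<Sigma>)) < \<infinity>"
proof -
  interpret product_prob_space "\<lambda>_::'n. mvn 0 \<Sigma>"
    by (intro product_prob_spaceI prob_space_mvn \<Sigma>)
  obtain c where c: "\<And>a j. (\<integral>\<^sup>+z. inv_sqrt (a \<bullet> z) \<partial>mvn 0 \<Sigma>) \<le> ennreal c * inv_sqrt (a $ j)"
    using nn_integral_inv_sqrt_mvn[OF \<Sigma>] by blast
  have "finite J" by simp
  then show ?thesis using J
  proof (induction J rule: finite_induct)
    case empty
    have "replace_rows B {} x = B" for x by (simp add: replace_rows_def vec_eq_iff)
    then show ?case using B by (simp add: PiM_empty inv_sqrt_def)
  next
    case (insert i J)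
    have "(\<integral>\<^sup>+x. inv_sqrt (det (replace_rows B (insert i J) x)) \<partial>PiM (insert i J) (\<lambda>_. mvn 0 \<Sigma>)) =
        (\<integral>\<^sup>+x. (\<integral>\<^sup>+y. inv_sqrt (det (replace_rows B (insert i J) (x(i := y)))) \<partial>mvn 0 \<Sigma>) \<partial>PiM J (\<lambda>_. mvn 0 \<Sigma>))"
      using insert.hyps by (intro product_nn_integral_insert) auto
    also have "\<dots> \<le> (\<integral>\<^sup>+x. ennreal c * inv_sqrt (det (replace_rows B J x)) \<partial>PiM J (\<lambda>_. mvn 0 \<Sigma>))"
    proof (intro nn_integral_mono)
      fix x
      define a where "a = (\<chi> j. det (\<chi> l. if l = i then axis j 1 else replace_rows B J x $ l))"
      have rows: "replace_rows B (insert i J) (x(i := y)) = (\<chi> l. if l = i then y else replace_rows B J x $ l)" for y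
        using insert.hyps by (auto simp: replace_rows_def vec_eq_iff)
      have "det (replace_rows B (insert i J) (x(i := y))) = a \<bullet> y" for y
      proof -
        have "det (\<chi> l. if l = i then (\<Sum>j\<in>UNIV. y $ j *s axis j 1) else replace_rows B J x $ l) =
            (\<Sum>j\<in>UNIV. det (\<chi> l. if l = i then y $ j *s axis j 1 else replace_rows B J x $ l))"
          by (rule det_linear_row_sum) simp
        also have "\<dots> = (\<Sum>j\<in>UNIV. y $ j * a $ j)"
          unfolding a_def by (simp add: det_row_mul)
        finally show ?thesis
          unfolding rows basis_expansion by (simp add: inner_vec_def mult.commute)
      qed
      moreover have "a $ i = det (replace_rows B J x)"
      proof -
        have "(\<chi> l. if l = i then axis i 1 else replace_rows B J x $ l) = replace_rows B J x"
          using insert by (auto simp: replace_rows_def vec_eq_iff)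
        then show ?thesis by (simp add: a_def)
      qed
      ultimately show "(\<integral>\<^sup>+y. inv_sqrt (det (replace_rows B (insert i J) (x(i := y)))) \<partial>mvn 0 \<Sigma>) \<le>
          ennreal c * inv_sqrt (det (replace_rows B J x))"
        using c[of a i] by simp
    qed
    also have "\<dots> = ennreal c * (\<integral>\<^sup>+x. inv_sqrt (det (replace_rows B J x)) \<partial>PiM J (\<lambda>_. mvn 0 \<Sigma>))"
      by (intro nn_integral_cmult) measurable
    also have "\<dots> < \<infinity>"
      using insert by (simp add: ennreal_mult_less_top)
    finally show ?case .
  qed
qed

lemma AE_det_replace_rows:
  fixes B :: "real ^ 'n ^ 'n"
  assumes "pos_def \<Sigma>" "\<And>i. i \<in> J \<Longrightarrow> B $ i = axis i 1" "det B \<noteq> 0"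
  shows "AE x in PiM J (\<lambda>_. mvn 0 \<Sigma>). det (replace_rows B J x) \<noteq> 0"
proof -
  have "AE x in PiM J (\<lambda>_. mvn 0 \<Sigma>). inv_sqrt (det (replace_rows B J x)) \<noteq> \<infinity>"
    using nn_integral_inv_sqrt_det[of \<Sigma> J B] assms by (intro nn_integral_PInf_AE) auto
  then show ?thesis by eventually_elim (auto simp: inv_sqrt_def)
qed

section \<open>The Kullback-Leibler loss in closed form\<close>

text \<open>
  Second moments are Stein's identity for the linear field \<open>\<Sigma> N (x - \<mu>)\<close>, whose divergence is constant.
\<close>

lemma integrable_mvn_quadratic:
  fixes N :: "real ^ 'n ^ 'n"
  assumes \<Sigma>: "pos_def \<Sigma>"
  shows "integrable (mvn \<mu> \<Sigma>) (\<lambda>x. (x - \<mu>) \<bullet> (N *v (x - \<mu>)))"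
    and "(\<integral>x. (x - \<mu>) \<bullet> (N *v (x - \<mu>)) \<partial>mvn \<mu> \<Sigma>) = trace (\<Sigma> ** N)"
proof -
  interpret prob_space "mvn \<mu> \<Sigma>" by (rule prob_space_mvn[OF \<Sigma>])
  have tr: "transpose (matrix_inv \<Sigma>) = matrix_inv \<Sigma>"
    by (intro pos_def_sym pos_def_matrix_inv \<Sigma>)
  have eq: "(matrix_inv \<Sigma> *v y) \<bullet> ((\<Sigma> ** N) *v z) = y \<bullet> (N *v z)" for y z
  proof -
    have "(matrix_inv \<Sigma> *v y) \<bullet> ((\<Sigma> ** N) *v z) = y \<bullet> (matrix_inv \<Sigma> *v ((\<Sigma> ** N) *v z))"
      using tr by (metis inner_matrix_vector)
    also have "matrix_inv \<Sigma> *v ((\<Sigma> ** N) *v z) = N *v z"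
      by (simp add: matrix_vector_mul_assoc matrix_mul_assoc matrix_inv_inverse pos_def_invertible[OF \<Sigma>])
    finally show ?thesis .
  qed
  have deriv: "((\<lambda>x. (\<Sigma> ** N) *v (x - \<mu>)) has_derivative (\<lambda>v. (\<Sigma> ** N) *v v)) (at x)" for x
    using bounded_linear.has_derivative[OF matrix_vector.bounded_linear_right
        has_derivative_diff[OF has_derivative_ident has_derivative_const]] by simp
  note stein = stein_mvn[OF \<Sigma> deriv continuous_on_const order_refl, of \<mu>]
  show "integrable (mvn \<mu> \<Sigma>) (\<lambda>x. (x - \<mu>) \<bullet> (N *v (x - \<mu>)))"
    using stein(1) by (simp only: eq)
  show "(\<integral>x. (x - \<mu>) \<bullet> (N *v (x - \<mu>)) \<partial>mvn \<mu> \<Sigma>) = trace (\<Sigma> ** N)"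
    using stein(2) by (simp only: eq) (simp add: prob_space[simplified])
qed

lemma integrable_mvn_linear:
  fixes \<Sigma> :: "real ^ 'n ^ 'n"
  assumes \<Sigma>: "pos_def \<Sigma>"
  shows "integrable (mvn \<mu> \<Sigma>) (\<lambda>x. (x - \<mu>) \<bullet> w)"
    and "(\<integral>x. (x - \<mu>) \<bullet> w \<partial>mvn \<mu> \<Sigma>) = 0"
proof -
  have tr: "transpose (matrix_inv \<Sigma>) = matrix_inv \<Sigma>"
    by (intro pos_def_sym pos_def_matrix_inv \<Sigma>)
  have eq: "(matrix_inv \<Sigma> *v y) \<bullet> (\<Sigma> *v w) = y \<bullet> w" for y
  proof -
    have "(matrix_inv \<Sigma> *v y) \<bullet> (\<Sigma> *v w) = y \<bullet> (matrix_inv \<Sigma> *v (\<Sigma> *v w))"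
      using tr by (metis inner_matrix_vector)
    then show ?thesis
      by (simp add: matrix_vector_mul_assoc matrix_inv_inverse pos_def_invertible[OF \<Sigma>])
  qed
  have deriv: "((\<lambda>x. \<Sigma> *v w) has_derivative (\<lambda>v. (0 :: real ^ 'n ^ 'n) *v v)) (at x)" for x :: "real ^ 'n"
    by simp
  note stein = stein_mvn[OF \<Sigma> deriv continuous_on_const order_refl, of \<mu>]
  show "integrable (mvn \<mu> \<Sigma>) (\<lambda>x. (x - \<mu>) \<bullet> w)"
    using stein(1) by (simp only: eq)
  show "(\<integral>x. (x - \<mu>) \<bullet> w \<partial>mvn \<mu> \<Sigma>) = 0"
    using stein(2) by (simp only: eq) (simp add: trace_def)
qed

lemma measurable_vec_lambda_mvn [measurable]:
  "vec_lambda \<in> measurable (PiM UNIV (\<lambda>i::'m::finite. mvn (\<theta> i) \<Sigma>)) borel"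
proof -
  have sets: "sets (PiM UNIV (\<lambda>i::'m. mvn (\<theta> i) \<Sigma>)) = sets (PiM UNIV (\<lambda>i::'m. borel))"
    by (intro sets_PiM_cong) auto
  show ?thesis unfolding measurable_cong_sets[OF sets refl] by (rule measurable_vec_lambda_PiM)
qed

lemma prob_space_matrix_normal:
  assumes "pos_def \<Sigma>"
  shows "prob_space (matrix_normal M (mat 1) \<Sigma>)"
  unfolding matrix_normal_rows[OF assms]
  by (intro prob_space.prob_space_distr[OF prob_space_PiM measurable_vec_lambda_mvn] prob_space_mvn assms)

lemma sets_matrix_normal [simp, measurable_cong]: "sets (matrix_normal M A \<Sigma>) = sets borel"
  by (simp add: matrix_normal_def)

lemma space_matrix_normal [simp]: "space (matrix_normal M A \<Sigma>) = UNIV"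
  by (simp add: matrix_normal_def)

lemma integrable_matrix_normal_row:
  fixes g :: "real ^ 'p \<Rightarrow> real" and M :: "real ^ 'p ^ 'm"
  assumes \<Sigma>: "pos_def \<Sigma>" and g: "integrable (mvn (M $ i) \<Sigma>) g"
  shows "integrable (matrix_normal M (mat 1) \<Sigma>) (\<lambda>X. g (X $ i))"
    and "(\<integral>X. g (X $ i) \<partial>matrix_normal M (mat 1) \<Sigma>) = (\<integral>x. g x \<partial>mvn (M $ i) \<Sigma>)"
proof -
  let ?P = "PiM UNIV (\<lambda>i. mvn (M $ i) \<Sigma>)"
  have gm [measurable]: "g \<in> borel_measurable borel" using borel_measurable_integrable[OF g] by simp
  have "(\<lambda>X :: real ^ 'p ^ 'm. X $ i) \<in> borel_measurable borel"
    by (intro borel_measurable_continuous_onI continuous_intros)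
  then have gX [measurable]: "(\<lambda>X :: real ^ 'p ^ 'm. g (X $ i)) \<in> borel_measurable borel"
    by (rule measurable_compose) (rule gm)
  have comp: "distr ?P (mvn (M $ i) \<Sigma>) (\<lambda>x. x i) = mvn (M $ i) \<Sigma>"
    by (rule distr_PiM_component) (auto intro: prob_space_mvn \<Sigma>)
  have "integrable (distr ?P (mvn (M $ i) \<Sigma>) (\<lambda>x. x i)) g" using g unfolding comp .
  then show "integrable (matrix_normal M (mat 1) \<Sigma>) (\<lambda>X. g (X $ i))"
    unfolding matrix_normal_rows[OF \<Sigma>]
    by (subst integrable_distr_eq) (auto simp: integrable_distr_eq)
  have "(\<integral>X. g (X $ i) \<partial>matrix_normal M (mat 1) \<Sigma>) = (\<integral>x. g (x i) \<partial>?P)"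
    unfolding matrix_normal_rows[OF \<Sigma>] by (subst integral_distr) auto
  also have "\<dots> = (\<integral>x. g x \<partial>distr ?P (mvn (M $ i) \<Sigma>) (\<lambda>x. x i))"
    by (subst integral_distr) auto
  finally show "(\<integral>X. g (X $ i) \<partial>matrix_normal M (mat 1) \<Sigma>) = (\<integral>x. g x \<partial>mvn (M $ i) \<Sigma>)"
    unfolding comp .
qed

lemma ln_mvn_density:
  fixes \<Sigma> :: "real ^ 'n ^ 'n"
  assumes "pos_def \<Sigma>"
  shows "ln (mvn_density \<mu> \<Sigma> x) =
    - (1 / 2) * ((x - \<mu>) \<bullet> (matrix_inv \<Sigma> *v (x - \<mu>))) - (1 / 2) * (CARD('n) * ln (2 * pi) + ln (det \<Sigma>))"
  unfolding mvn_density_def using det_pos_def[OF assms]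
  by (simp add: ln_div ln_sqrt ln_mult ln_realpow field_simps)

lemma matrix_normal_density_pos: "pos_def \<Sigma> \<Longrightarrow> 0 < matrix_normal_density M (mat 1) \<Sigma> X"
  unfolding matrix_normal_density_rows by (intro prod_pos mvn_density_pos)

lemma borel_measurable_matrix_normal_density [measurable]:
  assumes "pos_def \<Sigma>"
  shows "matrix_normal_density M (mat 1) \<Sigma> \<in> borel_measurable borel"
  unfolding matrix_normal_density_rows[OF assms, abs_def]
  by (intro borel_measurable_prod measurable_compose[OF _ borel_measurable_mvn_density]
      borel_measurable_continuous_onI continuous_intros)

definition kl_formula ::
    "real ^ 'p ^ 'm \<Rightarrow> real ^ 'p ^ 'p \<Rightarrow> real ^ 'p ^ 'm \<Rightarrow> real ^ 'p ^ 'p \<Rightarrow> real" where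
  "kl_formula \<Theta>' \<Sigma>' \<Theta> \<Sigma> =
     CARD('m) / 2 * (trace (\<Sigma>' ** matrix_inv \<Sigma>) - (ln (det \<Sigma>') - ln (det \<Sigma>)) - CARD('p)) +
     (\<Sum>i\<in>UNIV. (\<Theta>' - \<Theta>) $ i \<bullet> (matrix_inv \<Sigma> *v (\<Theta>' - \<Theta>) $ i)) / 2"

lemma mvn_log_ratio:
  fixes \<Sigma> \<Sigma>' :: "real ^ 'p ^ 'p"
  assumes \<Sigma>': "pos_def \<Sigma>'" and \<Sigma>: "pos_def \<Sigma>"
  shows "integrable (mvn \<mu>' \<Sigma>') (\<lambda>x. ln (mvn_density \<mu>' \<Sigma>' x) - ln (mvn_density \<mu> \<Sigma> x))"
    and "(\<integral>x. ln (mvn_density \<mu>' \<Sigma>' x) - ln (mvn_density \<mu> \<Sigma> x) \<partial>mvn \<mu>' \<Sigma>') =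
      (trace (\<Sigma>' ** matrix_inv \<Sigma>) - (ln (det \<Sigma>') - ln (det \<Sigma>)) - CARD('p)) / 2 +
      ((\<mu>' - \<mu>) \<bullet> (matrix_inv \<Sigma> *v (\<mu>' - \<mu>))) / 2"
proof -
  interpret prob_space "mvn \<mu>' \<Sigma>'" by (rule prob_space_mvn[OF \<Sigma>'])
  let ?N = "matrix_inv \<Sigma>" and ?N' = "matrix_inv \<Sigma>'"
  have sym: "transpose ?N = ?N" by (intro pos_def_sym pos_def_matrix_inv \<Sigma>)
  define a where "a = (\<mu>' - \<mu>) \<bullet> (?N *v (\<mu>' - \<mu>))"
  define l where "l = ln (det \<Sigma>') - ln (det \<Sigma>)"
  define w where "w = ?N *v (\<mu>' - \<mu>)"
  have eq: "ln (mvn_density \<mu>' \<Sigma>' x) - ln (mvn_density \<mu> \<Sigma> x) =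
      - (1 / 2) * ((x - \<mu>') \<bullet> (?N' *v (x - \<mu>'))) + (1 / 2) * ((x - \<mu>') \<bullet> (?N *v (x - \<mu>')))
      + (x - \<mu>') \<bullet> w + (a / 2 - l / 2)" for x
  proof -
    have "(x - \<mu>) \<bullet> (?N *v (x - \<mu>)) = ((x - \<mu>') + (\<mu>' - \<mu>)) \<bullet> (?N *v ((x - \<mu>') + (\<mu>' - \<mu>)))" by simp
    also have "\<dots> = (x - \<mu>') \<bullet> (?N *v (x - \<mu>')) + (\<mu>' - \<mu>) \<bullet> (?N *v (x - \<mu>')) + (x - \<mu>') \<bullet> w + a"
      unfolding a_def w_def
      by (simp only: matrix_vector.add_right inner_add_left inner_add_right add.assoc add.left_commute)
    also have "(\<mu>' - \<mu>) \<bullet> (?N *v (x - \<mu>')) = (x - \<mu>') \<bullet> w"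
      unfolding w_def by (metis inner_commute inner_matrix_vector sym)
    finally show ?thesis
      unfolding ln_mvn_density[OF \<Sigma>'] ln_mvn_density[OF \<Sigma>] l_def by (simp add: field_simps)
  qed
  note q' = integrable_mvn_quadratic[OF \<Sigma>', of \<mu>' ?N']
  note q = integrable_mvn_quadratic[OF \<Sigma>', of \<mu>' ?N]
  note lin = integrable_mvn_linear[OF \<Sigma>', of \<mu>' w]
  show "integrable (mvn \<mu>' \<Sigma>') (\<lambda>x. ln (mvn_density \<mu>' \<Sigma>' x) - ln (mvn_density \<mu> \<Sigma> x))"
    unfolding eq
    by (intro Bochner_Integration.integrable_add integrable_mult_right q' q lin) simp
  have "(\<integral>x. ln (mvn_density \<mu>' \<Sigma>' x) - ln (mvn_density \<mu> \<Sigma> x) \<partial>mvn \<mu>' \<Sigma>') =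
      - (1 / 2) * trace (\<Sigma>' ** ?N') + (1 / 2) * trace (\<Sigma>' ** ?N) + (a / 2 - l / 2)"
    unfolding eq
    by (simp add: q' q lin prob_space[simplified])
  moreover have "trace (\<Sigma>' ** ?N') = CARD('p)"
    by (simp add: matrix_inv_inverse pos_def_invertible[OF \<Sigma>'] trace_I)
  ultimately show "(\<integral>x. ln (mvn_density \<mu>' \<Sigma>' x) - ln (mvn_density \<mu> \<Sigma> x) \<partial>mvn \<mu>' \<Sigma>') =
      (trace (\<Sigma>' ** ?N) - (ln (det \<Sigma>') - ln (det \<Sigma>)) - CARD('p)) / 2 +
      ((\<mu>' - \<mu>) \<bullet> (?N *v (\<mu>' - \<mu>))) / 2"
    unfolding a_def l_def by (simp add: field_simps)
qed

text \<open>
  The logarithm of the density ratio is a sum over the rows, each of which is a quadratic polynomial in a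
  Gaussian vector. Nonnegativity is \<open>ln t \<ge> 1 - 1 / t\<close> integrated at the density ratio \<open>t\<close>.
\<close>

theorem kl_loss_eq:
  fixes \<Theta>' \<Theta> :: "real ^ 'p ^ 'm"
  assumes \<Sigma>': "pos_def \<Sigma>'" and \<Sigma>: "pos_def \<Sigma>"
  shows "kl_loss (\<Theta>', \<Sigma>') (\<Theta>, \<Sigma>) = kl_formula \<Theta>' \<Sigma>' \<Theta> \<Sigma>"
    and "0 \<le> kl_formula \<Theta>' \<Sigma>' \<Theta> \<Sigma>"
proof -
  let ?f' = "matrix_normal_density \<Theta>' (mat 1) \<Sigma>'" and ?f = "matrix_normal_density \<Theta> (mat 1) \<Sigma>"
  let ?M = "matrix_normal \<Theta>' (mat 1) \<Sigma>'"
  interpret prob_space ?M by (rule prob_space_matrix_normal[OF \<Sigma>'])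
  have [measurable]: "?f' \<in> borel_measurable borel" "?f \<in> borel_measurable borel"
    by (rule borel_measurable_matrix_normal_density assms)+
  have pos: "0 < ?f' Y" "0 < ?f Y" for Y by (rule matrix_normal_density_pos assms)+
  let ?g = "\<lambda>i y. ln (mvn_density (\<Theta>' $ i) \<Sigma>' y) - ln (mvn_density (\<Theta> $ i) \<Sigma> y)"
  have ratio: "ln (?f' Y / ?f Y) = (\<Sum>i\<in>UNIV. ?g i (Y $ i))" for Y
    using pos[of Y] less_imp_neq[OF mvn_density_pos[OF \<Sigma>'], symmetric]
      less_imp_neq[OF mvn_density_pos[OF \<Sigma>], symmetric]
    by (simp add: ln_div matrix_normal_density_rows[OF \<Sigma>] matrix_normal_density_rows[OF \<Sigma>']
        ln_prod sum_subtractf)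
  note row = integrable_matrix_normal_row[OF \<Sigma>' mvn_log_ratio(1)[OF \<Sigma>' \<Sigma>]]
  have int: "integrable ?M (\<lambda>Y. ln (?f' Y / ?f Y))"
    unfolding ratio by (intro Bochner_Integration.integrable_sum row)
  have "kl_loss (\<Theta>', \<Sigma>') (\<Theta>, \<Sigma>) = (\<integral>Y. ?f' Y *\<^sub>R ln (?f' Y / ?f Y) \<partial>lborel)"
    unfolding kl_loss_def by (simp add: mult.commute)
  also have "\<dots> = (\<integral>Y. ln (?f' Y / ?f Y) \<partial>?M)"
    unfolding matrix_normal_def by (rule integral_density[symmetric]) (use pos pos[THEN less_imp_le] in auto)
  finally have loss: "kl_loss (\<Theta>', \<Sigma>') (\<Theta>, \<Sigma>) = (\<integral>Y. ln (?f' Y / ?f Y) \<partial>?M)" .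
  also have "\<dots> = (\<Sum>i\<in>UNIV. \<integral>Y. ?g i (Y $ i) \<partial>?M)"
    unfolding ratio by (intro Bochner_Integration.integral_sum row)
  also have "\<dots> = (\<Sum>i\<in>(UNIV :: 'm set).
      (trace (\<Sigma>' ** matrix_inv \<Sigma>) - (ln (det \<Sigma>') - ln (det \<Sigma>)) - CARD('p)) / 2 +
      ((\<Theta>' $ i - \<Theta> $ i) \<bullet> (matrix_inv \<Sigma> *v (\<Theta>' $ i - \<Theta> $ i))) / 2)"
    unfolding row(2) mvn_log_ratio(2)[OF \<Sigma>' \<Sigma>] ..
  also have "\<dots> = kl_formula \<Theta>' \<Sigma>' \<Theta> \<Sigma>"
    unfolding kl_formula_def by (simp add: sum.distrib sum_divide_distrib)
  finally show eq: "kl_loss (\<Theta>', \<Sigma>') (\<Theta>, \<Sigma>) = kl_formula \<Theta>' \<Sigma>' \<Theta> \<Sigma>" .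
  have f_prob: "integrable lborel ?f" "integral\<^sup>L lborel ?f = 1"
  proof -
    interpret F: prob_space "matrix_normal \<Theta> (mat 1) \<Sigma>" by (rule prob_space_matrix_normal[OF \<Sigma>])
    have "integrable (matrix_normal \<Theta> (mat 1) \<Sigma>) (\<lambda>_. 1 :: real)" by simp
    then show "integrable lborel ?f"
      unfolding matrix_normal_def by (subst (asm) integrable_density) (use pos pos[THEN less_imp_le] in auto)
    have "(\<integral>Y. 1 \<partial>matrix_normal \<Theta> (mat 1) \<Sigma>) = (1 :: real)" by (simp add: F.prob_space[simplified])
    then show "integral\<^sup>L lborel ?f = 1"
      unfolding matrix_normal_def by (subst (asm) integral_density) (use pos pos[THEN less_imp_le] in auto)
  qed
  have r_eq: "?f' Y *\<^sub>R (?f Y / ?f' Y) = ?f Y" for Y using pos(1)[of Y] by simp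
  have r_int: "integrable ?M (\<lambda>Y. ?f Y / ?f' Y)"
    unfolding matrix_normal_def
    by (subst integrable_density) (use pos pos[THEN less_imp_le] f_prob r_eq in auto)
  have r_one: "(\<integral>Y. ?f Y / ?f' Y \<partial>?M) = 1"
    unfolding matrix_normal_def
    by (subst integral_density) (use pos pos[THEN less_imp_le] f_prob r_eq in auto)
  have "1 - ?f Y / ?f' Y \<le> ln (?f' Y / ?f Y)" for Y
    using ln_le_minus_one[of "?f Y / ?f' Y"] pos[of Y] by (simp add: ln_div)
  then have "(\<integral>Y. 1 - ?f Y / ?f' Y \<partial>?M) \<le> (\<integral>Y. ln (?f' Y / ?f Y) \<partial>?M)"
    by (intro integral_mono int Bochner_Integration.integrable_diff r_int) auto
  moreover have "(\<integral>Y. 1 - ?f Y / ?f' Y \<partial>?M) = 0"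
    by (simp add: r_int r_one prob_space[simplified])
  ultimately show "0 \<le> kl_formula \<Theta>' \<Sigma>' \<Theta> \<Sigma>" using loss eq by simp
qed

section \<open>Measurability and the Wishart distribution\<close>

lemma bounded_bilinear_measurable:
  fixes prod :: "'a::euclidean_space \<Rightarrow> 'b::euclidean_space \<Rightarrow> 'c::euclidean_space"
  assumes "bounded_bilinear prod" "f \<in> borel_measurable M" "g \<in> borel_measurable M"
  shows "(\<lambda>x. prod (f x) (g x)) \<in> borel_measurable M"
proof -
  interpret bounded_bilinear prod by fact
  have "continuous_on UNIV (\<lambda>x. prod (fst x) (snd x))" by (intro continuous_on continuous_intros)
  then show ?thesis using borel_measurable_continuous_Pair[OF assms(2,3), of prod] by simp
qed

lemmas matrix_mult_measurable [measurable (raw)] = bounded_bilinear_measurable[OF bounded_bilinear_matrix_mult]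
lemmas matrix_vector_measurable [measurable (raw)] = bounded_bilinear_measurable[OF bounded_bilinear_matrix_vector_mult]

lemma transpose_measurable [measurable]:
  "(transpose :: real ^ 'n ^ 'm \<Rightarrow> real ^ 'm ^ 'n) \<in> borel_measurable borel"
  unfolding transpose_def by (intro borel_measurable_continuous_onI continuous_intros)

lemma vec_nth_measurable [measurable]: "(\<lambda>x :: 'a::euclidean_space ^ 'n. x $ i) \<in> borel_measurable borel"
  by (intro borel_measurable_continuous_onI continuous_intros)

text \<open>
  Cramer's rule on the nonsingular matrices. On the singular ones \<open>matrix_inv\<close> is a constant, because its
  defining choice is then made from the same unsatisfiable predicate.
\<close>

lemma matrix_inv_measurable [measurable]: "(matrix_inv :: real ^ 'n ^ 'n \<Rightarrow> real ^ 'n ^ 'n) \<in> borel_measurable borel"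
proof -
  define cram where "cram = (\<lambda>A :: real ^ 'n ^ 'n. \<chi> k j. det (\<chi> a b. if b = k then (axis j 1 :: real ^ 'n) $ a else A $ a $ b) / det A)"
  define c where "c = matrix_inv (0 :: real ^ 'n ^ 'n)"
  have inv: "matrix_inv A = (if det A = 0 then c else cram A)" for A :: "real ^ 'n ^ 'n"
  proof (cases "det A = 0")
    case True
    have not_inv: "\<not> (B ** B' = mat 1 \<and> B' ** B = mat 1)" if "det B = 0" for B B' :: "real ^ 'n ^ 'n"
      using that invertible_det_nz[of B] unfolding invertible_def by blast
    have "det (0 :: real ^ 'n ^ 'n) = 0" by (rule det_zero_row) (simp add: row_def vec_eq_iff)
    then have "(\<lambda>A'. A ** A' = mat 1 \<and> A' ** A = mat 1) = (\<lambda>A'. 0 ** A' = mat 1 \<and> A' ** 0 = mat 1)"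
      using not_inv True by (intro ext) blast
    then have "matrix_inv A = matrix_inv 0"
      unfolding matrix_inv_def by (rule arg_cong)
    then show ?thesis using True by (simp add: c_def)
  next
    case False
    have "matrix_inv A $ k $ j = cram A $ k $ j" for k j
    proof -
      have "A *v (matrix_inv A *v axis j 1) = axis j 1"
        using False by (simp add: matrix_vector_mul_assoc matrix_inv_inverse invertible_det_nz)
      then have "matrix_inv A *v axis j 1 = (\<chi> k. det (\<chi> a b. if b = k then axis j 1 $ a else A $ a $ b) / det A)"
        using cramer[OF False] by blast
      then have "(matrix_inv A *v axis j 1) $ k = cram A $ k $ j" by (simp add: cram_def)
      then show ?thesis by (simp add: matrix_vector_mult_basis column_def)
    qed
    then show ?thesis using False by (simp add: vec_eq_iff)
  qed
  have ent: "(\<lambda>A :: real ^ 'n ^ 'n. if b = k then (axis j 1 :: real ^ 'n) $ a else A $ a $ b) \<in> borel_measurable borel" for a b k j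
    by (cases "b = k") (auto intro!: borel_measurable_continuous_onI continuous_intros)
  have [measurable]: "cram \<in> borel_measurable borel"
    unfolding cram_def
    by (intro measurable_vec_lambda borel_measurable_divide measurable_compose[OF _ borel_measurable_det] ent) simp
  have "(\<lambda>A. if det A = 0 then c else cram A) \<in> borel_measurable borel" by measurable
  moreover have "matrix_inv = (\<lambda>A. if det A = 0 then c else cram A)" using inv by blast
  ultimately show ?thesis by simp
qed

definition outer :: "real ^ 'n \<Rightarrow> real ^ 'm \<Rightarrow> real ^ 'm ^ 'n" where
  "outer a b = (\<chi> i j. a $ i * b $ j)"

lemma bounded_bilinear_outer: "bounded_bilinear (outer :: real ^ 'n \<Rightarrow> real ^ 'm \<Rightarrow> real ^ 'm ^ 'n)"
  unfolding bilinear_conv_bounded_bilinear[symmetric] bilinear_def linear_iff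
  by (simp add: vec_eq_iff outer_def algebra_simps)

interpretation outer: bounded_bilinear "outer :: real ^ 'n \<Rightarrow> real ^ 'm \<Rightarrow> real ^ 'm ^ 'n"
  by (rule bounded_bilinear_outer)

lemmas outer_measurable [measurable (raw)] = bounded_bilinear_measurable[OF bounded_bilinear_outer]

lemma outer_vector: "outer a b *v x = (b \<bullet> x) *\<^sub>R a"
  by (simp add: outer_def matrix_vector_mult_def inner_vec_def vec_eq_iff sum_distrib_left mult_ac)

lemma matrix_outer: "M ** outer a b = outer (M *v a) b"
  by (simp add: outer_def matrix_matrix_mult_def matrix_vector_mult_def vec_eq_iff sum_distrib_left sum_distrib_right mult_ac)

lemma outer_matrix: "outer a b ** M = outer a (transpose M *v b)"
  by (simp add: outer_def matrix_matrix_mult_def vector_matrix_mult_def vec_eq_iff sum_distrib_left mult_ac)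

lemma transpose_outer: "transpose (outer a b) = outer b a"
  by (simp add: outer_def transpose_def vec_eq_iff mult.commute)

lemma trace_outer: "trace (outer a b) = a \<bullet> b"
  by (simp add: outer_def trace_def inner_vec_def)

lemma trace_mult_outer: "trace (M ** outer a b) = b \<bullet> (M *v a)"
  by (simp add: matrix_outer trace_outer inner_commute)

lemma gram_outer: "transpose X ** X = (\<Sum>i\<in>UNIV. outer (X $ i) (X $ i))"
  by (simp add: outer_def matrix_matrix_mult_def transpose_def vec_eq_iff)

definition scatter :: "'i set \<Rightarrow> ('i \<Rightarrow> real ^ 'p) \<Rightarrow> real ^ 'p ^ 'p" where
  "scatter I z = (\<Sum>i\<in>I. outer (z i) (z i))"

lemma scatter_sym: "transpose (scatter I z) = scatter I z"
proof -
  have "transpose (scatter I z) = (\<Sum>i\<in>I. transpose (outer (z i) (z i)))"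
    unfolding scatter_def by (simp add: transpose_def vec_eq_iff)
  then show ?thesis by (simp add: transpose_outer scatter_def)
qed

lemma scatter_quad: "x \<bullet> (scatter I z *v x) = (\<Sum>i\<in>I. (z i \<bullet> x)\<^sup>2)"
  unfolding scatter_def
  by (simp add: matrix_vector.sum_left inner_sum_right outer_vector power2_eq_square inner_commute)

lemma scatter_nonneg: "0 \<le> x \<bullet> (scatter I z *v x)"
  unfolding scatter_quad by (intro sum_nonneg) simp

lemma trace_mult_scatter: "trace (M ** scatter I z) = (\<Sum>i\<in>I. z i \<bullet> (M *v z i))"
proof -
  have "trace (M ** scatter I z) = (\<Sum>i\<in>I. trace (M ** outer (z i) (z i)))"
    unfolding scatter_def matrix_mult.sum_right by (simp add: trace_def) (rule sum.swap)
  then show ?thesis by (simp add: trace_mult_outer)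
qed

lemma scatter_measurable [measurable]:
  "scatter I \<in> borel_measurable (PiM I (\<lambda>i. mvn (\<theta> i) \<Sigma>))"
  unfolding scatter_def
proof (rule borel_measurable_sum)
  fix i assume "i \<in> I"
  then have [measurable]: "(\<lambda>z. z i) \<in> borel_measurable (PiM I (\<lambda>i. mvn (\<theta> i) \<Sigma>))"
    using measurable_component_singleton[of i I "\<lambda>i. mvn (\<theta> i) \<Sigma>"] by (simp cong: measurable_cong_sets)
  show "(\<lambda>z. outer (z i) (z i)) \<in> borel_measurable (PiM I (\<lambda>i. mvn (\<theta> i) \<Sigma>))" by measurable
qed

text \<open>
  A \<open>1 \<times> p\<close> matrix is identified with its only row, so that the results on Gaussian vectors apply.
\<close>

lemma wishart_scatter:
  fixes \<Sigma> :: "real ^ 'p ^ 'p"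
  assumes \<Sigma>: "pos_def \<Sigma>"
  shows "wishart n \<Sigma> = distr (PiM {..<n} (\<lambda>_. mvn 0 \<Sigma>)) borel (scatter {..<n})"
proof -
  define f :: "real ^ 'p \<Rightarrow> real ^ 'p ^ 1" where "f = (\<lambda>x. \<chi> i. x)"
  have [measurable]: "f \<in> borel_measurable borel"
    unfolding f_def by (rule measurable_vec_lambda) simp
  have row: "matrix_normal (0 :: real ^ 'p ^ 1) (mat 1) \<Sigma> = distr (mvn 0 \<Sigma>) borel f"
  proof -
    let ?P = "PiM (UNIV :: 1 set) (\<lambda>_. mvn 0 \<Sigma>)"
    have "matrix_normal (0 :: real ^ 'p ^ 1) (mat 1) \<Sigma> = distr ?P borel vec_lambda"
      by (simp add: matrix_normal_rows[OF \<Sigma>])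
    also have "vec_lambda = f \<circ> (\<lambda>x. x 1)"
      unfolding f_def by (auto simp: fun_eq_iff vec_eq_iff)
    also have "distr ?P borel \<dots> = distr (distr ?P (mvn 0 \<Sigma>) (\<lambda>x. x 1)) borel f"
      by (intro distr_distr[symmetric]) auto
    also have "distr ?P (mvn 0 \<Sigma>) (\<lambda>x. x 1) = mvn 0 \<Sigma>"
      by (rule distr_PiM_component) (auto intro: prob_space_mvn \<Sigma>)
    finally show ?thesis .
  qed
  let ?g = "\<lambda>z :: nat \<Rightarrow> real ^ 'p ^ 1. \<Sum>i<n. transpose (z i) ** z i"
  have g: "?g \<in> borel_measurable (PiM {..<n} (\<lambda>_. borel))"
    by (intro borel_measurable_sum matrix_mult_measurable measurable_compose[OF _ transpose_measurable]
        measurable_component_singleton) auto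
  have "PiM {..<n} (\<lambda>_. distr (mvn 0 \<Sigma>) borel f) =
      distr (PiM {..<n} (\<lambda>_. mvn 0 \<Sigma>)) (PiM {..<n} (\<lambda>_. borel)) (compose {..<n} f)"
  proof -
    have "PiM {..<n} (\<lambda>_. distr (mvn 0 \<Sigma>) borel f) =
        PiM {..<n} (\<lambda>_. distr (mvn 0 \<Sigma>) (matrix_normal (0 :: real ^ 'p ^ 1) (mat 1) \<Sigma>) f)"
      by (intro PiM_cong refl distr_cong) auto
    also have "\<dots> = distr (PiM {..<n} (\<lambda>_. mvn 0 \<Sigma>))
        (PiM {..<n} (\<lambda>_. matrix_normal (0 :: real ^ 'p ^ 1) (mat 1) \<Sigma>)) (compose {..<n} f)"
      by (intro distr_PiM_finite_prob_space'[symmetric])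
        (auto intro: prob_space_mvn prob_space_matrix_normal \<Sigma>)
    also have "\<dots> = distr (PiM {..<n} (\<lambda>_. mvn 0 \<Sigma>)) (PiM {..<n} (\<lambda>_. borel)) (compose {..<n} f)"
      by (intro distr_cong refl sets_PiM_cong) auto
    finally show ?thesis .
  qed
  then have "wishart n \<Sigma> = distr (distr (PiM {..<n} (\<lambda>_. mvn 0 \<Sigma>)) (PiM {..<n} (\<lambda>_. borel)) (compose {..<n} f)) borel ?g"
    unfolding wishart_def row by simp
  also have "\<dots> = distr (PiM {..<n} (\<lambda>_. mvn 0 \<Sigma>)) borel (?g \<circ> compose {..<n} f)"
  proof (intro distr_distr g)
    show "compose {..<n} f \<in> measurable (PiM {..<n} (\<lambda>_. mvn 0 \<Sigma>)) (PiM {..<n} (\<lambda>_. borel))"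
      unfolding compose_def
      by (intro measurable_restrict measurable_compose[OF measurable_component_singleton[of _ _ "\<lambda>_. mvn 0 \<Sigma>"]]) auto
  qed
  also have "?g \<circ> compose {..<n} f = scatter {..<n}"
    by (simp add: fun_eq_iff scatter_def compose_def f_def outer_def matrix_matrix_mult_def transpose_def
        vec_eq_iff)
  finally show ?thesis .
qed

lemma distr_mvn_reindex:
  fixes \<phi> :: "'n::finite \<Rightarrow> 'i" and \<Sigma> :: "real ^ 'n ^ 'n"
  assumes \<Sigma>: "pos_def \<Sigma>" and \<phi>: "inj_on \<phi> J" "\<phi> ` J \<subseteq> I"
  shows "distr (PiM I (\<lambda>_. mvn 0 \<Sigma>)) (PiM J (\<lambda>_. mvn 0 \<Sigma>)) (\<lambda>z. \<lambda>i\<in>J. z (\<phi> i)) = PiM J (\<lambda>_. mvn 0 \<Sigma>)"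
    and "(\<lambda>z. \<lambda>i\<in>J. z (\<phi> i)) \<in> measurable (PiM I (\<lambda>_. mvn 0 \<Sigma>)) (PiM J (\<lambda>_. mvn 0 \<Sigma>))"
proof -
  show "distr (PiM I (\<lambda>_. mvn 0 \<Sigma>)) (PiM J (\<lambda>_. mvn 0 \<Sigma>)) (\<lambda>z. \<lambda>i\<in>J. z (\<phi> i)) = PiM J (\<lambda>_. mvn 0 \<Sigma>)"
    using distr_PiM_reindex[of I "\<lambda>_. mvn 0 \<Sigma>" \<phi> J] prob_space_mvn[OF \<Sigma>] \<phi> by auto
  show "(\<lambda>z. \<lambda>i\<in>J. z (\<phi> i)) \<in> measurable (PiM I (\<lambda>_. mvn 0 \<Sigma>)) (PiM J (\<lambda>_. mvn 0 \<Sigma>))"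
    using \<phi> by (intro measurable_restrict measurable_component_singleton) auto
qed

lemma replace_rows_restrict: "replace_rows B J (\<lambda>i\<in>J. f i) = replace_rows B J f"
  by (simp add: replace_rows_def vec_eq_iff)

lemma nn_integral_inv_sqrt_det_reindex:
  fixes B :: "real ^ 'n ^ 'n"
  assumes \<Sigma>: "pos_def \<Sigma>" and \<phi>: "inj_on \<phi> J" "\<phi> ` J \<subseteq> I"
    and "\<And>i. i \<in> J \<Longrightarrow> B $ i = axis i 1" "det B \<noteq> 0"
  shows "(\<integral>\<^sup>+z. inv_sqrt (det (replace_rows B J (\<lambda>i. z (\<phi> i)))) \<partial>PiM I (\<lambda>_. mvn 0 \<Sigma>)) < \<infinity>"
    and "AE z in PiM I (\<lambda>_. mvn 0 \<Sigma>). det (replace_rows B J (\<lambda>i. z (\<phi> i))) \<noteq> 0"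
proof -
  note re = distr_mvn_reindex[OF \<Sigma> \<phi>]
  have "(\<integral>\<^sup>+x. inv_sqrt (det (replace_rows B J x)) \<partial>PiM J (\<lambda>_. mvn 0 \<Sigma>)) =
      (\<integral>\<^sup>+z. inv_sqrt (det (replace_rows B J (\<lambda>i\<in>J. z (\<phi> i)))) \<partial>PiM I (\<lambda>_. mvn 0 \<Sigma>))"
    by (subst re(1)[symmetric], rule nn_integral_distr[OF re(2)]) measurable
  then show "(\<integral>\<^sup>+z. inv_sqrt (det (replace_rows B J (\<lambda>i. z (\<phi> i)))) \<partial>PiM I (\<lambda>_. mvn 0 \<Sigma>)) < \<infinity>"
    using nn_integral_inv_sqrt_det[of \<Sigma> J B] assms by (simp add: replace_rows_restrict)
  have "AE x in distr (PiM I (\<lambda>_. mvn 0 \<Sigma>)) (PiM J (\<lambda>_. mvn 0 \<Sigma>)) (\<lambda>z. \<lambda>i\<in>J. z (\<phi> i)).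
      det (replace_rows B J x) \<noteq> 0"
    unfolding re(1) using AE_det_replace_rows[of \<Sigma> J B] assms by simp
  from AE_distrD[OF re(2) this] show "AE z in PiM I (\<lambda>_. mvn 0 \<Sigma>). det (replace_rows B J (\<lambda>i. z (\<phi> i))) \<noteq> 0"
    by (simp add: replace_rows_restrict)
qed

text \<open>
  A null vector of the quadratic form is orthogonal to all \<open>z l\<close> and, by the hypothesis on \<open>N\<close>, to the rows
  of \<open>B\<close> outside \<open>J\<close>; so it is in the kernel of a nonsingular matrix.
\<close>

lemma pos_def_plus_scatter:
  fixes N B :: "real ^ 'n ^ 'n"
  assumes N: "transpose N = N" "\<And>v. 0 \<le> v \<bullet> (N *v v)"
    "\<And>v i. v \<bullet> (N *v v) = 0 \<Longrightarrow> i \<notin> J \<Longrightarrow> B $ i \<bullet> v = 0"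
    and det: "det (replace_rows B J (\<lambda>i. z (\<phi> i))) \<noteq> 0" and \<phi>: "\<phi> ` J \<subseteq> I" "finite I"
  shows "pos_def (N + scatter I z)"
  unfolding pos_def_def
proof (intro conjI allI impI)
  show "transpose (N + scatter I z) = N + scatter I z"
    by (simp add: transpose_add N scatter_sym)
  fix v :: "real ^ 'n"
  assume v: "v \<noteq> 0"
  have nonneg: "0 \<le> v \<bullet> ((N + scatter I z) *v v)"
    using N(2)[of v] scatter_nonneg[of v I z] by (simp add: matrix_vector.add_left inner_add_right)
  show "0 < v \<bullet> ((N + scatter I z) *v v)"
  proof (rule ccontr)
    assume "\<not> 0 < v \<bullet> ((N + scatter I z) *v v)"
    with nonneg have "v \<bullet> (N *v v) + v \<bullet> (scatter I z *v v) = 0"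
      by (simp add: matrix_vector.add_left inner_add_right)
    then have 0: "v \<bullet> (N *v v) = 0" "v \<bullet> (scatter I z *v v) = 0"
      using N(2)[of v] scatter_nonneg[of v I z] by linarith+
    then have "z l \<bullet> v = 0" if "l \<in> I" for l
      using that \<phi>(2) unfolding scatter_quad by (simp add: sum_nonneg_eq_0_iff)
    then have "replace_rows B J (\<lambda>i. z (\<phi> i)) $ i \<bullet> v = 0" for i
      using N(3)[OF 0(1)] \<phi>(1) by (auto simp: replace_rows_def)
    then have "replace_rows B J (\<lambda>i. z (\<phi> i)) *v v = 0"
      by (simp add: matrix_mult_dot vec_eq_iff)
    then show False using v det invertible_iff_kernel invertible_det_nz by blast
  qed
qed

lemma transpose_zero: "transpose 0 = 0"
  by (simp add: transpose_def vec_eq_iff)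

lemma AE_pos_def_scatter:
  fixes \<Sigma> :: "real ^ 'n ^ 'n"
  assumes \<Sigma>: "pos_def \<Sigma>" and I: "finite I" "CARD('n) \<le> card I"
  shows "AE z in PiM I (\<lambda>_. mvn 0 \<Sigma>). pos_def (scatter I z)"
proof -
  obtain \<phi> :: "'n \<Rightarrow> _" where \<phi>: "\<phi> ` UNIV \<subseteq> I" "inj_on \<phi> UNIV"
    using card_le_inj[of "UNIV :: 'n set" I] I by auto
  have "AE z in PiM I (\<lambda>_. mvn 0 \<Sigma>). det (replace_rows (mat 1) UNIV (\<lambda>i. z (\<phi> i))) \<noteq> 0"
    by (rule nn_integral_inv_sqrt_det_reindex(2)[OF \<Sigma> \<phi>(2,1)])
      (auto simp: mat_def axis_def vec_eq_iff det_I[unfolded mat_def])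
  then show ?thesis
  proof eventually_elim
    case (elim z)
    then show ?case
      using pos_def_plus_scatter[of 0 UNIV "mat 1" z \<phi> I] \<phi> I
      by (simp add: transpose_zero)
  qed
qed

text \<open>
  One Gaussian vector may be missing, because \<open>N\<close> controls the direction \<open>x\<close>: a matrix with one row equal
  to \<open>x\<close> and independent Gaussian rows otherwise is almost surely nonsingular. The fixed row takes the
  place of an index \<open>i\<close> with \<open>x\<^sub>i \<noteq> 0\<close>, where it can be completed by unit vectors to a nonsingular matrix.
\<close>

lemma AE_pos_def_plus_scatter:
  fixes \<Sigma> N :: "real ^ 'n ^ 'n"
  assumes \<Sigma>: "pos_def \<Sigma>" and I: "finite I" "CARD('n) \<le> Suc (card I)"
    and N: "transpose N = N" "x \<noteq> 0" "\<And>v. c * (x \<bullet> v)\<^sup>2 \<le> v \<bullet> (N *v v)" and c: "0 < c"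
  shows "AE z in PiM I (\<lambda>_. mvn 0 \<Sigma>). pos_def (N + scatter I z)"
proof -
  obtain i where i: "x $ i \<noteq> 0" using N(2) by (auto simp: vec_eq_iff)
  define B :: "real ^ 'n ^ 'n" where "B = (\<chi> l. if l = i then x else axis l 1)"
  have "v = 0" if "B *v v = 0" for v
  proof -
    have *: "B $ l \<bullet> v = 0" for l using that by (simp add: matrix_mult_dot vec_eq_iff)
    have l: "v $ l = 0" if "l \<noteq> i" for l using *[of l] that by (simp add: B_def inner_axis')
    then have "x \<bullet> v = x $ i * v $ i"
      unfolding inner_vec_def by (subst sum.remove[of _ i]) auto
    then have "v $ i = 0" using *[of i] i by (simp add: B_def)
    then show ?thesis using l by (metis vec_eq_iff zero_index)
  qed
  then have det: "det B \<noteq> 0" using invertible_iff_kernel invertible_det_nz by blast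
  have "card (UNIV - {i}) \<le> card I" using I by simp
  then obtain \<phi> :: "'n \<Rightarrow> _" where \<phi>: "\<phi> ` (UNIV - {i}) \<subseteq> I" "inj_on \<phi> (UNIV - {i})"
    using card_le_inj[of "UNIV - {i}" I] I by auto
  have "AE z in PiM I (\<lambda>_. mvn 0 \<Sigma>). det (replace_rows B (UNIV - {i}) (\<lambda>i. z (\<phi> i))) \<noteq> 0"
    by (rule nn_integral_inv_sqrt_det_reindex(2)[OF \<Sigma> \<phi>(2,1) _ det]) (simp add: B_def)
  then show ?thesis
  proof eventually_elim
    case (elim z)
    show ?case
    proof (rule pos_def_plus_scatter[OF N(1) _ _ elim \<phi>(1) I(1)])
      show "0 \<le> v \<bullet> (N *v v)" for v using N(3)[of v] c by (meson less_imp_le mult_nonneg_nonneg order_trans zero_le_power2)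
      show "B $ l \<bullet> v = 0" if "v \<bullet> (N *v v) = 0" "l \<notin> UNIV - {i}" for v l
      proof -
        have "c * (x \<bullet> v)\<^sup>2 \<le> 0" using N(3)[of v] that(1) by simp
        then have "(x \<bullet> v)\<^sup>2 \<le> 0" using c by (simp add: mult_le_0_iff)
        then show ?thesis using that(2) by (simp add: B_def)
      qed
    qed
  qed
qed

lemma det_mono:
  fixes A S :: "real ^ 'n ^ 'n"
  assumes A: "pos_def A" and S: "pos_def S" and le: "\<And>x. x \<bullet> (S *v x) \<le> x \<bullet> (A *v x)"
  shows "det S \<le> det A"
proof -
  obtain C Ci :: "real ^ 'n ^ 'n" and d where C: "Ci ** C = mat 1"
    and A_eq: "A = C ** transpose C" and S_eq: "S = C ** diag_mat d ** transpose C"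
    using simultaneous_diagonalization[OF A pos_def_sym[OF S]] by blast
  have A_eq': "A = C ** diag_mat 1 ** transpose C" by (simp add: A_eq diag_mat_one)
  have d: "0 \<le> d $ j" "d $ j \<le> 1" for j
  proof -
    show "0 \<le> d $ j" unfolding congruent_diag_entry[OF C S_eq] by (rule pos_def_nonneg[OF S])
    have "d $ j \<le> (1 :: real ^ 'n) $ j"
      unfolding congruent_diag_entry[OF C S_eq] congruent_diag_entry[OF C A_eq'] by (rule le)
    then show "d $ j \<le> 1" by simp
  qed
  have "det S = (\<Prod>j\<in>UNIV. d $ j) * det A"
    unfolding S_eq A_eq by (simp add: det_mul det_diag_mat)
  also have "\<dots> \<le> 1 * det A"
    using d det_pos_def[OF A] by (intro mult_right_mono prod_le_1) auto
  finally show ?thesis by simp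
qed

lemma neg_ln_le_inv_sqrt: "ennreal (- ln (d\<^sup>2)) \<le> 4 * inv_sqrt d"
proof (cases "d = 0")
  case False
  have "ln (\<bar>d\<bar> powr (- (1 / 2))) \<le> \<bar>d\<bar> powr (- (1 / 2)) - 1"
    using False by (intro ln_le_minus_one) simp
  moreover have "ln (\<bar>d\<bar> powr (- (1 / 2))) = - (1 / 2) * ln \<bar>d\<bar>" using False by (simp add: ln_powr)
  moreover have "ln (d\<^sup>2) = 2 * ln \<bar>d\<bar>"
    using False by (metis ln_realpow power2_abs zero_less_abs_iff of_nat_numeral)
  ultimately have "- ln (d\<^sup>2) \<le> 4 * (\<bar>d\<bar> powr (- (1 / 2)))" by linarith
  then have "ennreal (- ln (d\<^sup>2)) \<le> ennreal (4 * (\<bar>d\<bar> powr (- (1 / 2))))" by (rule ennreal_leI)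
  then show ?thesis using False by (simp add: inv_sqrt_def ennreal_mult)
qed (simp add: inv_sqrt_def ennreal_mult_top)

text \<open>
  As many of the vectors as there are coordinates form a square matrix \<open>Z\<close> with
  \<open>(det Z)\<^sup>2 \<le> det (scatter I z)\<close>, and \<open>- ln\<close> is dominated by the inverse square root.
\<close>

lemma nn_integral_neg_ln_det_scatter:
  fixes \<Sigma> :: "real ^ 'n ^ 'n"
  assumes \<Sigma>: "pos_def \<Sigma>" and I: "finite I" "CARD('n) \<le> card I"
  shows "(\<integral>\<^sup>+z. ennreal (- ln (det (scatter I z))) \<partial>PiM I (\<lambda>_. mvn 0 \<Sigma>)) < \<infinity>"
proof -
  obtain \<phi> :: "'n \<Rightarrow> _" where \<phi>: "\<phi> ` UNIV \<subseteq> I" "inj_on \<phi> UNIV"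
    using card_le_inj[of "UNIV :: 'n set" I] I by auto
  define Z where "Z = (\<lambda>z. replace_rows (mat 1) UNIV (\<lambda>i. z (\<phi> i)) :: real ^ 'n ^ 'n)"
  note fin = nn_integral_inv_sqrt_det_reindex[OF \<Sigma> \<phi>(2,1), of "mat 1"]
  have B: "(mat 1 :: real ^ 'n ^ 'n) $ i = axis i 1" for i by (simp add: mat_def axis_def vec_eq_iff eq_commute)
  have "(\<integral>\<^sup>+z. ennreal (- ln (det (scatter I z))) \<partial>PiM I (\<lambda>_. mvn 0 \<Sigma>)) \<le>
      (\<integral>\<^sup>+z. 4 * inv_sqrt (det (Z z)) \<partial>PiM I (\<lambda>_. mvn 0 \<Sigma>))"
  proof (intro nn_integral_mono_AE)
    have "AE z in PiM I (\<lambda>_. mvn 0 \<Sigma>). det (Z z) \<noteq> 0"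
      unfolding Z_def using fin(2) B by (simp add: det_I)
    then show "AE z in PiM I (\<lambda>_. mvn 0 \<Sigma>). ennreal (- ln (det (scatter I z))) \<le> 4 * inv_sqrt (det (Z z))"
    proof eventually_elim
      case (elim z)
      have gram: "transpose (Z z) ** Z z = scatter (\<phi> ` UNIV) z"
        unfolding gram_outer scatter_def sum.reindex[OF \<phi>(2)] by (simp add: Z_def replace_rows_def)
      have pd: "pos_def (scatter J z)" if "\<phi> ` UNIV \<subseteq> J" "finite J" for J
        using pos_def_plus_scatter[of 0 UNIV "mat 1" z \<phi> J] elim that unfolding Z_def
        by (simp add: transpose_zero)
      have "(det (Z z))\<^sup>2 = det (scatter (\<phi> ` UNIV) z)"
        unfolding gram[symmetric] by (simp add: det_mul det_transpose power2_eq_square)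
      also have "\<dots> \<le> det (scatter I z)"
        using \<phi>(1) I(1) unfolding scatter_quad[symmetric]
        by (intro det_mono pd) (auto simp: scatter_quad intro!: sum_mono2)
      finally have le: "(det (Z z))\<^sup>2 \<le> det (scatter I z)" .
      have pos: "0 < (det (Z z))\<^sup>2" using elim by simp
      then have "0 < det (scatter I z)" using le by (rule less_le_trans)
      then have "- ln (det (scatter I z)) \<le> - ln ((det (Z z))\<^sup>2)"
        using ln_le_cancel_iff[OF pos] le by simp
      then show ?case by (intro order_trans[OF ennreal_leI neg_ln_le_inv_sqrt])
    qed
  qed
  also have "\<dots> = 4 * (\<integral>\<^sup>+z. inv_sqrt (det (Z z)) \<partial>PiM I (\<lambda>_. mvn 0 \<Sigma>))"
  proof (rule nn_integral_cmult)
    have "(\<lambda>z. replace_rows (mat 1) UNIV (\<lambda>i\<in>UNIV. z (\<phi> i))) \<in> borel_measurable (PiM I (\<lambda>_. mvn 0 \<Sigma>))"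
      by (rule measurable_compose[OF distr_mvn_reindex(2)[OF \<Sigma> \<phi>(2,1)] measurable_replace_rows])
    then have [measurable]: "Z \<in> borel_measurable (PiM I (\<lambda>_. mvn 0 \<Sigma>))"
      unfolding Z_def by (simp only: replace_rows_restrict)
    show "(\<lambda>z. inv_sqrt (det (Z z))) \<in> borel_measurable (PiM I (\<lambda>_. mvn 0 \<Sigma>))" by measurable
  qed
  also have "\<dots> < \<infinity>"
    using fin(1) B by (simp add: Z_def det_I ennreal_mult_less_top)
  finally show ?thesis .
qed

section \<open>Rank-one updates of the inverse\<close>

lemma bounded_bilinear_bounded_range:
  fixes prod :: "'a::real_normed_vector \<Rightarrow> 'b::real_normed_vector \<Rightarrow> 'c::real_normed_vector"
  assumes "bounded_bilinear prod" "bounded (range f)" "bounded (range g)"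
  shows "bounded (range (\<lambda>y. prod (f y) (g y)))"
proof -
  interpret bounded_bilinear prod by fact
  obtain K where K: "0 < K" "\<And>a b. norm (prod a b) \<le> norm a * norm b * K" using pos_bounded by blast
  obtain a b where a: "\<And>y. norm (f y) \<le> a" and b: "\<And>y. norm (g y) \<le> b"
    using assms(2,3) by (auto simp: bounded_iff)
  have "norm (prod (f y) (g y)) \<le> a * b * K" for y
  proof -
    have "norm (f y) * norm (g y) \<le> a * b"
      using a[of y] b[of y] norm_ge_zero[of "f y"] by (intro mult_mono) (auto intro: order_trans[OF norm_ge_zero])
    then have "norm (f y) * norm (g y) * K \<le> a * b * K" using K(1) by (intro mult_right_mono) auto
    then show ?thesis using K(2)[of "f y" "g y"] by linarith
  qed
  then show ?thesis unfolding bounded_iff by blast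
qed

lemma bounded_range_add: "bounded (range f) \<Longrightarrow> bounded (range g) \<Longrightarrow> bounded (range (\<lambda>y. f y + g y))"
  for f g :: "_ \<Rightarrow> 'a::real_normed_vector"
proof -
  assume "bounded (range f)" "bounded (range g)"
  then obtain a b where "\<And>y. norm (f y) \<le> a" "\<And>y. norm (g y) \<le> b"
    by (auto simp: bounded_iff)
  then have "norm (f y + g y) \<le> a + b" for y
    by (intro norm_triangle_le add_mono)
  then show ?thesis unfolding bounded_iff by blast
qed

lemma bounded_range_const: "bounded (range (\<lambda>_. c))"
  by simp

text \<open>
  At \<open>x = A\<^sup>-\<^sup>1 y\<close> the hypothesis compares \<open>c (y \<bullet> x)\<^sup>2\<close> with \<open>y \<bullet> x\<close>.
\<close>

lemma quad_inverse_le_one: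
  assumes A: "pos_def A" and le: "\<And>x. c * (y \<bullet> x)\<^sup>2 \<le> x \<bullet> (A *v x)" and c: "0 < c"
  shows "0 \<le> y \<bullet> (matrix_inv A *v y)" "c * (y \<bullet> (matrix_inv A *v y)) \<le> 1"
proof -
  show 0: "0 \<le> y \<bullet> (matrix_inv A *v y)" by (intro pos_def_nonneg pos_def_matrix_inv A)
  define x where "x = matrix_inv A *v y"
  have "A *v x = y"
    unfolding x_def by (simp add: matrix_vector_mul_assoc matrix_inv_inverse pos_def_invertible[OF A])
  then have "c * (y \<bullet> x) * (y \<bullet> x) \<le> 1 * (y \<bullet> x)"
    using le[of x] by (simp add: power2_eq_square inner_commute)
  then show "c * (y \<bullet> (matrix_inv A *v y)) \<le> 1"
    using 0 unfolding x_def[symmetric] by (cases "y \<bullet> x = 0") (auto simp: mult_le_cancel_right)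
qed

text \<open>
  The inverse of \<open>S + \<lambda> K\<close> depends on a single Gaussian row \<open>y\<close> in this way. Integration by parts along \<open>y\<close>
  needs that the fields built from \<open>R y\<close> and \<open>u y = R y y\<close> have bounded derivatives on the whole
  space. The reason is that \<open>u\<close> stays bounded although \<open>y\<close> does not: the term \<open>\<lambda> y y\<^sup>T\<close> makes \<open>R y\<close> small in
  the direction of \<open>y\<close>.
\<close>

locale rank_one_update =
  fixes B :: "real ^ 'p ^ 'p" and lam :: real
  assumes pd: "pos_def B" and lam: "0 < lam"
begin

definition "R y = matrix_inv (B + lam *\<^sub>R outer y y)"
definition "u y = R y *v y"

lemma quad_update: "x \<bullet> ((B + lam *\<^sub>R outer y y) *v x) = x \<bullet> (B *v x) + lam * (y \<bullet> x)\<^sup>2"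
  by (simp add: matrix_vector.add_left matrix_vector.scaleR_left inner_add_right outer_vector
      power2_eq_square inner_commute)

lemma pd_update: "pos_def (B + lam *\<^sub>R outer y y)"
  unfolding pos_def_def
proof (intro conjI allI impI)
  show "transpose (B + lam *\<^sub>R outer y y) = B + lam *\<^sub>R outer y y"
    by (simp add: transpose_add transpose_scalar transpose_outer pos_def_sym[OF pd])
  fix x :: "real ^ 'p" assume "x \<noteq> 0"
  then show "0 < x \<bullet> ((B + lam *\<^sub>R outer y y) *v x)"
    unfolding quad_update using pos_def_pos[OF pd] lam by (simp add: add_pos_nonneg)
qed

lemma R_inv: "(B + lam *\<^sub>R outer y y) ** R y = mat 1" "R y ** (B + lam *\<^sub>R outer y y) = mat 1"
  unfolding R_def by (rule matrix_inv_inverse[OF pos_def_invertible[OF pd_update]])+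

lemma R_sym: "transpose (R y) = R y"
  unfolding R_def by (intro pos_def_sym pos_def_matrix_inv pd_update)

lemma u_bound: "0 \<le> y \<bullet> u y" "lam * (y \<bullet> u y) \<le> 1"
proof -
  have "lam * (y \<bullet> x)\<^sup>2 \<le> x \<bullet> ((B + lam *\<^sub>R outer y y) *v x)" for x
    unfolding quad_update using pos_def_nonneg[OF pd, of x] by linarith
  from quad_inverse_le_one[OF pd_update this lam] show "0 \<le> y \<bullet> u y" "lam * (y \<bullet> u y) \<le> 1"
    unfolding u_def R_def by blast+
qed

text \<open>
  The Sherman-Morrison formula.
\<close>

lemma R_eq:
  "R y = matrix_inv B - (lam / (1 + lam * (y \<bullet> (matrix_inv B *v y)))) *\<^sub>R
     outer (matrix_inv B *v y) (matrix_inv B *v y)"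
proof -
  define Bi where "Bi = matrix_inv B"
  define b where "b = Bi *v y"
  define t where "t = 1 + lam * (y \<bullet> b)"
  have Bi: "B ** Bi = mat 1" "transpose Bi = Bi"
    unfolding Bi_def by (rule matrix_inv_inverse[OF pos_def_invertible[OF pd]])
      (intro pos_def_sym pos_def_matrix_inv pd)
  have "0 \<le> y \<bullet> b" unfolding b_def Bi_def by (intro pos_def_nonneg pos_def_matrix_inv pd)
  then have t: "t > 0" unfolding t_def using lam by (simp add: add_pos_nonneg)
  have Bb: "B *v b = y" unfolding b_def by (simp add: matrix_vector_mul_assoc Bi)
  have yb: "lam * (y \<bullet> b) = t - 1" by (simp add: t_def)
  have "(B + lam *\<^sub>R outer y y) ** (Bi - (lam / t) *\<^sub>R outer b b) =
      mat 1 + lam *\<^sub>R outer y b - (lam / t) *\<^sub>R outer y b - ((lam / t) * (lam * (y \<bullet> b))) *\<^sub>R outer y b"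
    using Bi Bb
    by (simp add: matrix_mult.add_left matrix_mult.diff_right matrix_mult.scaleR_left matrix_mult.scaleR_right
        matrix_outer outer_matrix outer_vector outer.scaleR_left b_def[symmetric] matrix_vector.add_left
        matrix_vector.scaleR_left outer.add_left algebra_simps del: transpose_matrix_vector)
  also have "\<dots> = mat 1 + (lam - lam / t - (lam / t) * (t - 1)) *\<^sub>R outer y b"
    unfolding yb by (simp add: algebra_simps)
  also have "lam - lam / t - (lam / t) * (t - 1) = 0" using t by (simp add: field_simps)
  finally show ?thesis
    unfolding R_def by (intro matrix_inv_eqI(1)) (simp add: Bi_def b_def t_def)
qed

lemma one_plus_pos: "0 < 1 + lam * (y \<bullet> (matrix_inv B *v y))"
  using pos_def_nonneg[OF pos_def_matrix_inv[OF pd], of y] lam by (simp add: add_pos_nonneg)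

lemma R_differentiable: "R differentiable (at y)"
proof -
  have b: "((\<lambda>y. matrix_inv B *v y) has_derivative (\<lambda>v. matrix_inv B *v v)) (at y)"
    by (rule bounded_linear_imp_has_derivative[OF matrix_vector.bounded_linear_right])
  have o: "((\<lambda>y. outer (matrix_inv B *v y) (matrix_inv B *v y)) has_derivative
      (\<lambda>v. outer (matrix_inv B *v y) (matrix_inv B *v v) + outer (matrix_inv B *v v) (matrix_inv B *v y))) (at y)"
    by (rule outer.FDERIV[OF b b])
  have c: "((\<lambda>y. lam / (1 + lam * (y \<bullet> (matrix_inv B *v y)))) has_derivative
      (\<lambda>v. - lam * (lam * (y \<bullet> (matrix_inv B *v v) + v \<bullet> (matrix_inv B *v y))) /
        ((1 + lam * (y \<bullet> (matrix_inv B *v y))) * (1 + lam * (y \<bullet> (matrix_inv B *v y)))))) (at y)"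
    using one_plus_pos[of y] by (auto intro!: derivative_eq_intros b simp: fun_eq_iff field_simps)
  from has_derivative_diff[OF has_derivative_const has_derivative_scaleR[OF c o]] show ?thesis
    unfolding R_eq[abs_def] differentiable_def by blast
qed

text \<open>
  The explicit formula only serves to show that \<open>R\<close> is differentiable; its derivative is read off by
  differentiating \<open>(B + \<lambda> y y\<^sup>T) R y = 1\<close>.
\<close>

lemma R_deriv: "(R has_derivative (\<lambda>v. - lam *\<^sub>R (R y ** (outer v y + outer y v) ** R y))) (at y)"
proof -
  obtain R' where R': "(R has_derivative R') (at y)"
    using R_differentiable unfolding differentiable_def by blast
  have A: "((\<lambda>y. B + lam *\<^sub>R outer y y) has_derivative (\<lambda>v. lam *\<^sub>R (outer y v + outer v y))) (at y)"
    using has_derivative_add[OF has_derivative_const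
        has_derivative_scaleR_right[OF outer.FDERIV[OF has_derivative_ident has_derivative_ident]]] by simp
  have "((\<lambda>y. (B + lam *\<^sub>R outer y y) ** R y) has_derivative
      (\<lambda>v. (B + lam *\<^sub>R outer y y) ** R' v + (lam *\<^sub>R (outer y v + outer v y)) ** R y)) (at y)"
    by (rule matrix_mult.FDERIV[OF A R'])
  moreover have "((\<lambda>y. (B + lam *\<^sub>R outer y y) ** R y) has_derivative (\<lambda>v. 0)) (at y)"
    unfolding R_inv by (rule has_derivative_const)
  ultimately have "(\<lambda>v. (B + lam *\<^sub>R outer y y) ** R' v + (lam *\<^sub>R (outer y v + outer v y)) ** R y) = (\<lambda>v. 0)"
    by (rule has_derivative_unique)
  then have eq: "(B + lam *\<^sub>R outer y y) ** R' v = - ((lam *\<^sub>R (outer y v + outer v y)) ** R y)" for v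
    unfolding eq_neg_iff_add_eq_0 by (rule fun_cong)
  have "R' v = - lam *\<^sub>R (R y ** (outer v y + outer y v) ** R y)" for v
  proof -
    have "R' v = R y ** ((B + lam *\<^sub>R outer y y) ** R' v)"
      by (simp add: matrix_mul_assoc R_inv)
    then show ?thesis
      unfolding eq by (simp add: matrix_mult.minus_right matrix_mult.scaleR_left matrix_mult.scaleR_right
          matrix_mul_assoc add.commute)
  qed
  then have "R' = (\<lambda>v. - lam *\<^sub>R (R y ** (outer v y + outer y v) ** R y))" by blast
  with R' show ?thesis by simp
qed

lemma R_deriv_vector:
  "- lam *\<^sub>R (R y ** (outer v y + outer y v) ** R y) *v w =
    - lam *\<^sub>R (((u y \<bullet> w) *\<^sub>R R y + outer (u y) (R y *v w)) *v v)"
proof -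
  have "y \<bullet> (R y *v w) = u y \<bullet> w"
    unfolding u_def by (metis inner_matrix_vector R_sym)
  then have "(R y ** (outer v y + outer y v) ** R y) *v w =
      ((u y \<bullet> w) *\<^sub>R R y + outer (u y) (R y *v w)) *v v"
    by (simp add: matrix_vector_mul_assoc[symmetric] matrix_vector.add_left matrix_vector.add_right outer_vector
        matrix_vector.scaleR_left matrix_vector.scaleR_right u_def inner_commute)
  then show ?thesis by (simp add: matrix_vector.scaleR_left matrix_vector.minus_left)
qed

text \<open>
  The Jacobian of \<open>u\<close>.
\<close>

definition "Du y = (1 - lam * (y \<bullet> u y)) *\<^sub>R R y - lam *\<^sub>R outer (u y) (u y)"

lemma u_deriv: "(u has_derivative (\<lambda>v. Du y *v v)) (at y)"
proof -
  have "((\<lambda>y. R y *v y) has_derivative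
      (\<lambda>v. R y *v v + (- lam *\<^sub>R (R y ** (outer v y + outer y v) ** R y)) *v y)) (at y)"
    by (rule matrix_vector.FDERIV[OF R_deriv has_derivative_ident])
  moreover have "R y *v v + (- lam *\<^sub>R (R y ** (outer v y + outer y v) ** R y)) *v y = Du y *v v" for v
    unfolding R_deriv_vector Du_def
    by (simp add: u_def[symmetric] matrix_vector.diff_left matrix_vector.add_left matrix_vector.scaleR_left
        inner_commute algebra_simps)
  ultimately show ?thesis unfolding u_def[abs_def] by simp
qed

lemma R_cont: "continuous_on UNIV R"
  using R_differentiable by (simp add: continuous_on_eq_continuous_at differentiable_imp_continuous_within)

lemma u_cont: "continuous_on UNIV u"
  unfolding u_def[abs_def] by (intro matrix_vector.continuous_on R_cont continuous_on_id)

lemma Du_cont: "continuous_on UNIV Du"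
  unfolding Du_def[abs_def] by (intro continuous_intros R_cont u_cont outer.continuous_on)

lemma yu_bounded: "bounded (range (\<lambda>y. 1 - lam * (y \<bullet> u y)))"
proof -
  have "norm (1 - lam * (y \<bullet> u y)) \<le> 1" for y
    using u_bound[of y] mult_nonneg_nonneg[of lam "y \<bullet> u y"] lam by (simp add: abs_le_iff)
  then show ?thesis unfolding bounded_iff by blast
qed

lemma R_bounded: "bounded (range R)"
proof -
  obtain C :: "real ^ 'p ^ 'p" where C: "matrix_inv B = C ** transpose C"
    using pos_def_factorization[OF pos_def_matrix_inv[OF pd]] by blast
  obtain k where k: "0 < k" "\<And>(A :: real ^ 'p ^ 'p) v. norm (A *v v) \<le> norm A * norm v * k"
    using matrix_vector.pos_bounded by blast
  obtain l where l: "0 < l" "\<And>(a :: real ^ 'p) (b :: real ^ 'p). norm (outer a b) \<le> norm a * norm b * l"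
    using outer.pos_bounded by blast
  define c where "c = (norm C * k)\<^sup>2"
  have "norm (R y) \<le> norm (matrix_inv B) + c * l" for y
  proof -
    define b where "b = matrix_inv B *v y"
    define t where "t = 1 + lam * (y \<bullet> b)"
    define w where "w = transpose C *v y"
    have bw: "b = C *v w" unfolding b_def w_def C by (simp only: matrix_vector_mul_assoc)
    have yb: "y \<bullet> b = w \<bullet> w" unfolding bw w_def by (rule inner_matrix_vector)
    have t: "t > 0" "lam * (w \<bullet> w) \<le> t" unfolding t_def yb using lam by (auto simp: add_pos_nonneg)
    have "(norm b)\<^sup>2 \<le> (norm C * norm w * k)\<^sup>2" unfolding bw by (intro power_mono k) auto
    then have b2: "(norm b)\<^sup>2 \<le> c * (w \<bullet> w)"
      by (simp add: c_def power_mult_distrib power2_norm_eq_inner mult_ac)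
    have "norm ((lam / t) *\<^sub>R outer b b) = lam / t * norm (outer b b)" using lam t by simp
    also have "\<dots> \<le> lam / t * ((norm b)\<^sup>2 * l)"
      using lam t l(2)[of b b] by (intro mult_left_mono) (auto simp: power2_eq_square)
    also have "\<dots> \<le> lam / t * (c * (w \<bullet> w) * l)"
      using lam t l(1) b2 by (intro mult_left_mono mult_right_mono) auto
    also have "\<dots> = (lam * (w \<bullet> w) / t) * (c * l)" by simp
    also have "\<dots> \<le> 1 * (c * l)"
      using t l(1) by (intro mult_right_mono) (auto simp: c_def)
    finally have "norm ((lam / t) *\<^sub>R outer b b) \<le> c * l" by simp
    then show ?thesis
      unfolding R_eq b_def[symmetric] t_def[symmetric]
      using norm_triangle_ineq4[of "matrix_inv B" "(lam / t) *\<^sub>R outer b b"] by linarith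
  qed
  then show ?thesis unfolding bounded_iff by blast
qed

text \<open>
  From \<open>(B + \<lambda> y y\<^sup>T) u = y\<close> follows \<open>u \<bullet> B u \<le> y \<bullet> u \<le> 1 / \<lambda>\<close>.
\<close>

lemma u_bounded: "bounded (range u)"
proof -
  obtain C :: "real ^ 'p ^ 'p" where C: "B = C ** transpose C" "invertible C"
    using pos_def_factorization[OF pd] by blast
  have Bq: "x \<bullet> (B *v x) = (transpose C *v x) \<bullet> (transpose C *v x)" for x
    by (simp only: C(1) matrix_vector_mul_assoc[symmetric] inner_matrix_vector[of x C])
  define E where "E = transpose (matrix_inv C)"
  have "transpose C ** E = mat 1 \<and> E ** transpose C = mat 1"
    using matrix_inv_inverse[OF C(2)] unfolding E_def by (metis matrix_transpose_mul transpose_mat)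
  then have E: "E ** transpose C = mat 1" by blast
  obtain k where k: "0 < k" "\<And>(A :: real ^ 'p ^ 'p) v. norm (A *v v) \<le> norm A * norm v * k"
    using matrix_vector.pos_bounded by blast
  have "norm (u y) \<le> norm E * sqrt (1 / lam) * k" for y
  proof -
    define w where "w = transpose C *v u y"
    have uw: "u y = E *v w" unfolding w_def by (simp only: matrix_vector_mul_assoc E matrix_vector_mul_lid)
    have "(B + lam *\<^sub>R outer y y) *v u y = y"
      unfolding u_def by (simp add: matrix_vector_mul_assoc R_inv)
    then have "y \<bullet> u y = u y \<bullet> (B *v u y) + lam * (y \<bullet> u y)\<^sup>2"
      using quad_update[of "u y" y] by (simp add: inner_commute)
    moreover have "0 \<le> lam * (y \<bullet> u y)\<^sup>2" using lam by simp
    ultimately have "u y \<bullet> (B *v u y) \<le> y \<bullet> u y" by linarith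
    moreover have "u y \<bullet> (B *v u y) = w \<bullet> w"
      unfolding w_def by (rule Bq)
    ultimately have "lam * (w \<bullet> w) \<le> lam * (y \<bullet> u y)" using lam by simp
    also note u_bound(2)[of y]
    finally have "w \<bullet> w \<le> 1 / lam" using lam by (simp add: pos_le_divide_eq mult.commute)
    then have "norm w \<le> sqrt (1 / lam)" by (simp add: norm_eq_sqrt_inner)
    then have "norm E * norm w * k \<le> norm E * sqrt (1 / lam) * k"
      using k(1) by (intro mult_right_mono mult_left_mono) auto
    then show ?thesis using k(2)[of E w] uw by simp
  qed
  then show ?thesis unfolding bounded_iff by blast
qed

lemma Du_bounded: "bounded (range Du)"
proof -
  have "Du = (\<lambda>y. (1 - lam * (y \<bullet> u y)) *\<^sub>R R y + (- lam) *\<^sub>R outer (u y) (u y))"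
    by (simp add: Du_def fun_eq_iff)
  moreover have "bounded (range \<dots>)"
    by (intro bounded_range_add bounded_bilinear_bounded_range[OF bounded_bilinear_scaleR]
        bounded_bilinear_bounded_range[OF bounded_bilinear_outer] yu_bounded R_bounded u_bounded bounded_range_const)
  ultimately show ?thesis by simp
qed

lemma field1:
  shows "((\<lambda>y. K *v u y) has_derivative (\<lambda>v. (K ** Du y) *v v)) (at y)"
    and "continuous_on UNIV (\<lambda>y. K ** Du y)" and "bounded (range (\<lambda>y. K ** Du y))"
proof -
  show "((\<lambda>y. K *v u y) has_derivative (\<lambda>v. (K ** Du y) *v v)) (at y)"
    using bounded_linear.has_derivative[OF matrix_vector.bounded_linear_right u_deriv]
    by (simp add: matrix_vector_mul_assoc)
  show "continuous_on UNIV (\<lambda>y. K ** Du y)"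
    by (intro matrix_mult.continuous_on continuous_on_const Du_cont)
  show "bounded (range (\<lambda>y. K ** Du y))"
    by (intro bounded_bilinear_bounded_range[OF bounded_bilinear_matrix_mult] bounded_range_const Du_bounded)
qed

text \<open>
  The Jacobian of \<open>K R y K u y\<close>.
\<close>

definition "D2 K y = (- lam) *\<^sub>R ((u y \<bullet> (K *v u y)) *\<^sub>R (K ** R y) + outer (K *v u y) (R y *v (K *v u y)))
  + K ** R y ** (K ** Du y)"

lemma field2:
  shows "((\<lambda>y. K *v (R y *v (K *v u y))) has_derivative (\<lambda>v. D2 K y *v v)) (at y)"
    and "continuous_on UNIV (D2 K)" and "bounded (range (D2 K))"
proof -
  have "((\<lambda>y. R y *v (K *v u y)) has_derivative
      (\<lambda>v. R y *v ((K ** Du y) *v v) + (- lam *\<^sub>R (R y ** (outer v y + outer y v) ** R y)) *v (K *v u y))) (at y)"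
    by (rule matrix_vector.FDERIV[OF R_deriv field1(1)])
  from bounded_linear.has_derivative[OF matrix_vector.bounded_linear_right[of K] this]
  have "((\<lambda>y. K *v (R y *v (K *v u y))) has_derivative
      (\<lambda>v. K *v (R y *v ((K ** Du y) *v v) + (- lam *\<^sub>R (R y ** (outer v y + outer y v) ** R y)) *v (K *v u y)))) (at y)" .
  moreover have "K *v (R y *v ((K ** Du y) *v v) + (- lam *\<^sub>R (R y ** (outer v y + outer y v) ** R y)) *v (K *v u y)) =
      D2 K y *v v" for v
    unfolding R_deriv_vector D2_def
    by (simp add: matrix_vector.add_left matrix_vector.add_right matrix_vector.scaleR_left
        matrix_vector.scaleR_right matrix_vector_mul_assoc matrix_mul_assoc matrix_vector.minus_left
        matrix_vector.minus_right matrix_mult.add_right matrix_mult.scaleR_right matrix_outer algebra_simps)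
  ultimately show "((\<lambda>y. K *v (R y *v (K *v u y))) has_derivative (\<lambda>v. D2 K y *v v)) (at y)" by simp
  show "continuous_on UNIV (D2 K)"
    unfolding D2_def[abs_def]
    by (intro continuous_intros matrix_mult.continuous_on matrix_vector.continuous_on outer.continuous_on
        R_cont u_cont Du_cont)
  show "bounded (range (D2 K))"
    unfolding D2_def[abs_def]
    by (intro bounded_range_add bounded_bilinear_bounded_range[OF bounded_bilinear_scaleR]
        bounded_bilinear_bounded_range[OF bounded_bilinear_outer] bounded_bilinear_bounded_range[OF bounded_bilinear_inner]
        bounded_bilinear_bounded_range[OF bounded_bilinear_matrix_mult]
        bounded_bilinear_bounded_range[OF bounded_bilinear_matrix_vector_mult]
        R_bounded u_bounded Du_bounded bounded_range_const)
qed

end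

section \<open>Integration by parts for the two estimators\<close>

lemma scatter_update:
  assumes "i \<in> I" "finite I"
  shows "scatter I (x(i := y)) = scatter (I - {i}) x + outer y y"
proof -
  have "scatter I (x(i := y)) = outer y y + (\<Sum>l\<in>I - {i}. outer ((x(i := y)) l) ((x(i := y)) l))"
    unfolding scatter_def using assms by (subst sum.remove[of I i]) auto
  also have "(\<Sum>l\<in>I - {i}. outer ((x(i := y)) l) ((x(i := y)) l)) = scatter (I - {i}) x"
    unfolding scatter_def by (intro sum.cong) auto
  finally show ?thesis by (simp only: add.commute[of "outer y y"])
qed

lemma sum_quad_scatter:
  "(\<Sum>i\<in>I. (G *v z i) \<bullet> (M *v (H *v z i))) = trace (M ** H ** scatter I z ** transpose G)"
proof -
  have "trace (M ** H ** scatter I z ** transpose G) = trace (transpose G ** (M ** H ** scatter I z))"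
    by (rule trace_mul_sym)
  also have "\<dots> = trace ((transpose G ** M ** H) ** scatter I z)" by (simp only: matrix_mul_assoc)
  also have "\<dots> = (\<Sum>i\<in>I. z i \<bullet> ((transpose G ** M ** H) *v z i))" by (rule trace_mult_scatter)
  also have "\<dots> = (\<Sum>i\<in>I. (G *v z i) \<bullet> (M *v (H *v z i)))"
    by (simp only: matrix_vector_mul_assoc[symmetric] inner_matrix_vector[of _ "transpose G"] transpose_transpose)
  finally show ?thesis ..
qed

text \<open>
  The Gaussian rows play two roles: for \<open>X\<close> the fixed matrix \<open>N\<close> is \<open>S\<close> and the weight \<open>w\<close> is \<open>\<lambda>\<close>; for \<open>S\<close> they
  are \<open>\<lambda> K\<close> and 1.
\<close>

definition scatter_inv :: "real ^ 'p ^ 'p \<Rightarrow> real \<Rightarrow> 'i set \<Rightarrow> ('i \<Rightarrow> real ^ 'p) \<Rightarrow> real ^ 'p ^ 'p" where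
  "scatter_inv N w I x = matrix_inv (N + w *\<^sub>R scatter I x)"

text \<open>
  With \<open>Ai\<close> for the inverse of \<open>N + w \<Sum>\<^sub>i z\<^sub>i z\<^sub>i\<^sup>T\<close>, these are the divergences at \<open>y = z\<^sub>i\<close>, with respect to the
  row \<open>z\<^sub>i\<close>, of the fields \<open>G Ai y\<close> and \<open>G Ai G Ai y\<close>.
\<close>

definition div1 :: "real ^ 'p ^ 'p \<Rightarrow> real ^ 'p ^ 'p \<Rightarrow> real \<Rightarrow> real ^ 'p \<Rightarrow> real" where
  "div1 G Ai w y = (1 - w * (y \<bullet> (Ai *v y))) * trace (G ** Ai) - w * ((Ai *v y) \<bullet> (G *v (Ai *v y)))"

definition div2 :: "real ^ 'p ^ 'p \<Rightarrow> real ^ 'p ^ 'p \<Rightarrow> real \<Rightarrow> real ^ 'p \<Rightarrow> real" where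
  "div2 G Ai w y = (1 - w * (y \<bullet> (Ai *v y))) * trace (G ** Ai ** G ** Ai)
      - w * (((Ai *v y) \<bullet> (G *v (Ai *v y))) * trace (G ** Ai))
      - w * ((G *v (Ai *v y)) \<bullet> (Ai *v (G *v (Ai *v y))))
      - w * ((Ai *v y) \<bullet> ((G ** Ai ** G) *v (Ai *v y)))"

lemma component_measurable:
  "i \<in> I \<Longrightarrow> (\<lambda>x. x i) \<in> borel_measurable (PiM I (\<lambda>i. mvn (\<theta> i) \<Sigma>))"
  using measurable_component_singleton[of i I "\<lambda>i. mvn (\<theta> i) \<Sigma>"] by (simp cong: measurable_cong_sets)

lemma scatter_inv_measurable [measurable]:
  "scatter_inv N w I \<in> borel_measurable (PiM I (\<lambda>i. mvn (\<theta> i) \<Sigma>))"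
  unfolding scatter_inv_def[abs_def] by measurable

lemma div_measurable [measurable (raw)]:
  assumes [measurable]: "f \<in> borel_measurable M" "g \<in> borel_measurable M"
  shows "(\<lambda>x. div1 G (f x) w (g x)) \<in> borel_measurable M" "(\<lambda>x. div2 G (f x) w (g x)) \<in> borel_measurable M"
  unfolding div1_def div2_def by measurable

text \<open>
  Fixing all rows but one turns the inverse into a rank-one update, whose base matrix has to be
  positive definite; then both vector fields are smooth with bounded derivative along the slice.
\<close>

lemma stein_fields:
  fixes \<theta> :: "'i \<Rightarrow> real ^ 'p" and N G :: "real ^ 'p ^ 'p"
  assumes fin: "finite I" and i: "i \<in> I" and \<Sigma>: "pos_def \<Sigma>" and w: "0 < w"
    and slice: "AE x in PiM (I - {i}) (\<lambda>i. mvn (\<theta> i) \<Sigma>). pos_def (N + w *\<^sub>R scatter (I - {i}) x)"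
  shows "integrable (PiM I (\<lambda>i. mvn (\<theta> i) \<Sigma>))
        (\<lambda>x. (matrix_inv \<Sigma> *v (x i - \<theta> i)) \<bullet> (G *v (scatter_inv N w I x *v x i))) \<Longrightarrow>
      integrable (PiM I (\<lambda>i. mvn (\<theta> i) \<Sigma>)) (\<lambda>x. div1 G (scatter_inv N w I x) w (x i)) \<Longrightarrow>
      (\<integral>x. (matrix_inv \<Sigma> *v (x i - \<theta> i)) \<bullet> (G *v (scatter_inv N w I x *v x i)) \<partial>PiM I (\<lambda>i. mvn (\<theta> i) \<Sigma>)) =
      (\<integral>x. div1 G (scatter_inv N w I x) w (x i) \<partial>PiM I (\<lambda>i. mvn (\<theta> i) \<Sigma>))"
    and "integrable (PiM I (\<lambda>i. mvn (\<theta> i) \<Sigma>))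
        (\<lambda>x. (matrix_inv \<Sigma> *v (x i - \<theta> i)) \<bullet> (G *v (scatter_inv N w I x *v (G *v (scatter_inv N w I x *v x i))))) \<Longrightarrow>
      integrable (PiM I (\<lambda>i. mvn (\<theta> i) \<Sigma>)) (\<lambda>x. div2 G (scatter_inv N w I x) w (x i)) \<Longrightarrow>
      (\<integral>x. (matrix_inv \<Sigma> *v (x i - \<theta> i)) \<bullet> (G *v (scatter_inv N w I x *v (G *v (scatter_inv N w I x *v x i))))
        \<partial>PiM I (\<lambda>i. mvn (\<theta> i) \<Sigma>)) =
      (\<integral>x. div2 G (scatter_inv N w I x) w (x i) \<partial>PiM I (\<lambda>i. mvn (\<theta> i) \<Sigma>))"
proof -
  let ?P = "PiM I (\<lambda>i. mvn (\<theta> i) \<Sigma>)" and ?A = "scatter_inv N w I"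
  define U where "U = (\<lambda>x. ?A x *v x i)"
  have U': "?A x *v x i = U x" for x by (simp add: U_def)
  define J where "J = (\<lambda>x. (1 - w * (x i \<bullet> U x)) *\<^sub>R ?A x - w *\<^sub>R outer (U x) (U x))"
  define J2 where "J2 = (\<lambda>x. (- w) *\<^sub>R ((U x \<bullet> (G *v U x)) *\<^sub>R (G ** ?A x) +
    outer (G *v U x) (?A x *v (G *v U x))) + G ** ?A x ** (G ** J x))"
  have tr: "trace (M ** J x) = (1 - w * (x i \<bullet> U x)) * trace (M ** ?A x) - w * (U x \<bullet> (M *v U x))" for M x
    unfolding J_def
    by (simp add: matrix_mult.diff_right matrix_mult.scaleR_right trace_sub trace_scaleR trace_mult_outer)
  have tr1: "trace (G ** J x) = div1 G (?A x) w (x i)" for x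
    unfolding tr by (simp add: div1_def U_def)
  have tr2: "trace (J2 x) = div2 G (?A x) w (x i)" for x
  proof -
    have "G ** ?A x ** (G ** J x) = (G ** ?A x ** G) ** J x" by (simp only: matrix_mul_assoc)
    then show ?thesis
      unfolding J2_def div2_def U'
      by (simp add: trace_add trace_sub trace_scaleR trace_outer tr algebra_simps)
  qed
  have slice_eq: "?A (x(i := y)) = matrix_inv ((N + w *\<^sub>R scatter (I - {i}) x) + w *\<^sub>R outer y y)" for x y
    unfolding scatter_inv_def using scatter_update[OF i fin, of x y] by (simp add: scaleR_add_right add.assoc)
  have reg: "((\<forall>y. ((\<lambda>y. G *v U (x(i := y))) has_derivative (\<lambda>v. (G ** J (x(i := y))) *v v)) (at y)) \<and>
        continuous_on UNIV (\<lambda>y. G ** J (x(i := y))) \<and> bounded (range (\<lambda>y. G ** J (x(i := y))))) \<and>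
      ((\<forall>y. ((\<lambda>y. G *v (?A (x(i := y)) *v (G *v U (x(i := y))))) has_derivative (\<lambda>v. J2 (x(i := y)) *v v)) (at y)) \<and>
        continuous_on UNIV (\<lambda>y. J2 (x(i := y))) \<and> bounded (range (\<lambda>y. J2 (x(i := y)))))"
    if pd: "pos_def (N + w *\<^sub>R scatter (I - {i}) x)" for x
  proof -
    interpret rank_one_update "N + w *\<^sub>R scatter (I - {i}) x" w
      by unfold_locales (rule pd, rule w)
    have R: "?A (x(i := y)) = R y" for y unfolding slice_eq R_def ..
    have U: "U (x(i := y)) = u y" for y by (simp add: U_def u_def R)
    have J: "J (x(i := y)) = Du y" for y by (simp add: J_def Du_def R U)
    have J2: "J2 (x(i := y)) = D2 G y" for y by (simp add: J2_def D2_def R U J)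
    show ?thesis unfolding U J J2 R using field1[of G] field2[of G] by simp
  qed
  show "(\<integral>x. (matrix_inv \<Sigma> *v (x i - \<theta> i)) \<bullet> (G *v (?A x *v x i)) \<partial>?P) = (\<integral>x. div1 G (?A x) w (x i) \<partial>?P)"
    if "integrable ?P (\<lambda>x. (matrix_inv \<Sigma> *v (x i - \<theta> i)) \<bullet> (G *v (?A x *v x i)))"
      "integrable ?P (\<lambda>x. div1 G (?A x) w (x i))"
    using that unfolding U' tr1[symmetric]
  proof (rule stein_PiM[OF fin i \<Sigma>])
    show "AE x in PiM (I - {i}) (\<lambda>i. mvn (\<theta> i) \<Sigma>).
        (\<forall>y. ((\<lambda>y. G *v U (x(i := y))) has_derivative (\<lambda>v. (G ** J (x(i := y))) *v v)) (at y)) \<and>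
        continuous_on UNIV (\<lambda>y. G ** J (x(i := y))) \<and> bounded (range (\<lambda>y. G ** J (x(i := y))))"
      using slice by eventually_elim (use reg in blast)
  qed
  show "(\<integral>x. (matrix_inv \<Sigma> *v (x i - \<theta> i)) \<bullet> (G *v (?A x *v (G *v (?A x *v x i)))) \<partial>?P) =
      (\<integral>x. div2 G (?A x) w (x i) \<partial>?P)"
    if "integrable ?P (\<lambda>x. (matrix_inv \<Sigma> *v (x i - \<theta> i)) \<bullet> (G *v (?A x *v (G *v (?A x *v x i)))))"
      "integrable ?P (\<lambda>x. div2 G (?A x) w (x i))"
    using that unfolding U' tr2[symmetric]
  proof (rule stein_PiM[OF fin i \<Sigma>])
    show "AE x in PiM (I - {i}) (\<lambda>i. mvn (\<theta> i) \<Sigma>).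
        (\<forall>y. ((\<lambda>y. G *v (?A (x(i := y)) *v (G *v U (x(i := y))))) has_derivative (\<lambda>v. J2 (x(i := y)) *v v)) (at y)) \<and>
        continuous_on UNIV (\<lambda>y. J2 (x(i := y))) \<and> bounded (range (\<lambda>y. J2 (x(i := y))))"
      using slice by eventually_elim (use reg in blast)
  qed
qed

text \<open>Expand the form at \<open>a + b\<close> and at \<open>a - b\<close>.\<close>

lemma pos_def_inner_bound:
  assumes M: "pos_def M"
  shows "\<bar>(M *v a) \<bullet> b\<bar> \<le> (a \<bullet> (M *v a) + b \<bullet> (M *v b)) / 2"
proof -
  have s: "(M *v a) \<bullet> b = a \<bullet> (M *v b)" "b \<bullet> (M *v a) = a \<bullet> (M *v b)"
    using pos_def_sym[OF M] by (metis inner_matrix_vector, metis inner_matrix_vector inner_commute)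
  have "0 \<le> (a + b) \<bullet> (M *v (a + b))" "0 \<le> (a - b) \<bullet> (M *v (a - b))"
    by (rule pos_def_nonneg[OF M])+
  then show ?thesis
    unfolding s(1) by (simp add: matrix_vector.add_right matrix_vector.diff_right inner_add_left inner_add_right
        inner_diff_left inner_diff_right s(2) abs_le_iff)
qed

lemma member_le_trace_quad:
  assumes M: "pos_def M" and "finite I" "i \<in> I"
  shows "(G *v z i) \<bullet> (M *v (G *v z i)) \<le> trace (M ** G ** scatter I z ** transpose G)"
  unfolding sum_quad_scatter[symmetric]
  by (rule member_le_sum[OF assms(3) _ assms(2)]) (rule pos_def_nonneg[OF M])

lemma sum_div1:
  assumes Ai: "transpose Ai = Ai"
  shows "(\<Sum>i\<in>I. div1 G Ai w (z i)) =
    trace (G ** Ai) * (card I - w * trace (Ai ** scatter I z)) - w * trace (G ** Ai ** scatter I z ** Ai)"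
proof -
  have "(\<Sum>i\<in>I. div1 G Ai w (z i)) = (\<Sum>i\<in>I. trace (G ** Ai) - w * trace (G ** Ai) * (z i \<bullet> (Ai *v z i))
      - w * ((Ai *v z i) \<bullet> (G *v (Ai *v z i))))"
    unfolding div1_def by (intro sum.cong refl) (simp add: algebra_simps)
  also have "\<dots> = card I * trace (G ** Ai) - w * trace (G ** Ai) * (\<Sum>i\<in>I. z i \<bullet> (Ai *v z i))
      - w * (\<Sum>i\<in>I. (Ai *v z i) \<bullet> (G *v (Ai *v z i)))"
    by (simp add: sum_subtractf sum_distrib_left)
  also have "(\<Sum>i\<in>I. z i \<bullet> (Ai *v z i)) = trace (Ai ** scatter I z)" by (rule trace_mult_scatter[symmetric])
  also have "(\<Sum>i\<in>I. (Ai *v z i) \<bullet> (G *v (Ai *v z i))) = trace (G ** Ai ** scatter I z ** Ai)"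
    using sum_quad_scatter[where G = Ai and M = G and H = Ai] by (simp only: Ai)
  finally show ?thesis by (simp add: algebra_simps)
qed

lemma sum_div2:
  assumes Ai: "transpose Ai = Ai" and G: "transpose G = G"
  shows "(\<Sum>i\<in>I. div2 G Ai w (z i)) =
    (card I - w * trace (Ai ** scatter I z)) * trace (G ** Ai ** G ** Ai)
    - w * (trace (G ** Ai) * trace (G ** Ai ** scatter I z ** Ai))
    - 2 * w * trace (G ** Ai ** G ** Ai ** scatter I z ** Ai)"
proof -
  let ?t = "trace (G ** Ai ** G ** Ai)"
  have "(\<Sum>i\<in>I. div2 G Ai w (z i)) = (\<Sum>i\<in>I. ?t - w * ?t * (z i \<bullet> (Ai *v z i))
      - w * trace (G ** Ai) * ((Ai *v z i) \<bullet> (G *v (Ai *v z i)))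
      - w * (((G ** Ai) *v z i) \<bullet> (Ai *v ((G ** Ai) *v z i)))
      - w * ((Ai *v z i) \<bullet> ((G ** Ai ** G) *v (Ai *v z i))))"
    unfolding div2_def by (intro sum.cong refl) (simp add: algebra_simps matrix_vector_mul_assoc)
  also have "\<dots> = card I * ?t - w * ?t * (\<Sum>i\<in>I. z i \<bullet> (Ai *v z i))
      - w * trace (G ** Ai) * (\<Sum>i\<in>I. (Ai *v z i) \<bullet> (G *v (Ai *v z i)))
      - w * (\<Sum>i\<in>I. ((G ** Ai) *v z i) \<bullet> (Ai *v ((G ** Ai) *v z i)))
      - w * (\<Sum>i\<in>I. (Ai *v z i) \<bullet> ((G ** Ai ** G) *v (Ai *v z i)))"
    by (simp add: sum_subtractf sum_distrib_left)
  also have "(\<Sum>i\<in>I. ((G ** Ai) *v z i) \<bullet> (Ai *v ((G ** Ai) *v z i))) = trace (G ** Ai ** G ** Ai ** scatter I z ** Ai)"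
  proof -
    have "(\<Sum>i\<in>I. ((G ** Ai) *v z i) \<bullet> (Ai *v ((G ** Ai) *v z i))) =
        trace (Ai ** (G ** Ai) ** scatter I z ** (Ai ** G))"
      unfolding sum_quad_scatter matrix_transpose_mul Ai G ..
    also have "\<dots> = trace ((Ai ** G ** Ai ** scatter I z ** Ai) ** G)" by (simp only: matrix_mul_assoc)
    also have "\<dots> = trace (G ** (Ai ** G ** Ai ** scatter I z ** Ai))" by (rule trace_mul_sym)
    finally show ?thesis by (simp only: matrix_mul_assoc)
  qed
  also have "(\<Sum>i\<in>I. z i \<bullet> (Ai *v z i)) = trace (Ai ** scatter I z)" by (rule trace_mult_scatter[symmetric])
  also have "(\<Sum>i\<in>I. (Ai *v z i) \<bullet> (G *v (Ai *v z i))) = trace (G ** Ai ** scatter I z ** Ai)"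
    using sum_quad_scatter[where G = Ai and M = G and H = Ai] by (simp only: Ai)
  also have "(\<Sum>i\<in>I. (Ai *v z i) \<bullet> ((G ** Ai ** G) *v (Ai *v z i))) =
      trace (G ** Ai ** G ** Ai ** scatter I z ** Ai)"
    using sum_quad_scatter[where G = Ai and M = "G ** Ai ** G" and H = Ai] by (simp only: Ai)
  finally show ?thesis by (simp add: algebra_simps)
qed

context diagonal_pencil
begin

lemma trace_diag_scaleR:
  "trace (M ** (C ** diag_mat (c *\<^sub>R a) ** transpose C)) = c * trace (M ** (C ** diag_mat a ** transpose C))"
  by (simp add: diag_mat_scaleR[symmetric] matrix_mult.scaleR_left matrix_mult.scaleR_right trace_scaleR)

lemma trace_diag_nonneg:
  assumes M: "\<And>x. 0 \<le> x \<bullet> (M *v x)" and "\<And>j. 0 \<le> a $ j"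
  shows "0 \<le> trace (M ** (C ** diag_mat a ** transpose C))"
proof -
  have "trace (M ** (C ** diag_mat (0 *\<^sub>R a) ** transpose C)) \<le> trace (M ** (C ** diag_mat a ** transpose C))"
    using assms by (intro trace_diag_mono) auto
  then show ?thesis unfolding trace_diag_scaleR by simp
qed

lemma trace_diag_le:
  assumes M: "\<And>x. 0 \<le> x \<bullet> (M *v x)" and "\<And>j. a $ j \<le> c * b $ j"
  shows "trace (M ** (C ** diag_mat a ** transpose C)) \<le> c * trace (M ** (C ** diag_mat b ** transpose C))"
  unfolding trace_diag_scaleR[symmetric] using assms by (intro trace_diag_mono) auto

lemma v_bounds: "0 \<le> v $ j" "v $ j \<le> 1" "0 \<le> 1 - v $ j" "1 - v $ j \<le> 1"
  using v_nonneg[of j] v_less[of j] by auto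

text \<open>
  These five bounds serve integrability: the products are at most a multiple of \<open>S\<close> or \<open>K\<close> in the order of
  quadratic forms, uniformly in the remaining variables.
\<close>

lemma trace_KAS_bounds:
  assumes M: "\<And>x. 0 \<le> x \<bullet> (M *v x)"
  shows "0 \<le> trace (M ** (K ** Ai ** S))" "trace (M ** (K ** Ai ** S)) \<le> (1 / lam) * trace (M ** S)"
proof -
  show "0 \<le> trace (M ** (K ** Ai ** S))"
    unfolding KAS using v_bounds lam_pos by (intro trace_diag_nonneg M) auto
  have "v $ j * (1 - v $ j) \<le> 1 * (1 - v $ j)" for j using v_bounds by (intro mult_right_mono) auto
  then show "trace (M ** (K ** Ai ** S)) \<le> (1 / lam) * trace (M ** S)"
    unfolding KAS using lam_pos by (subst S_eq) (intro trace_diag_le M, auto simp: divide_right_mono)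
qed

lemma trace_KAKAS_bounds:
  assumes M: "\<And>x. 0 \<le> x \<bullet> (M *v x)"
  shows "0 \<le> trace (M ** (K ** Ai ** K ** Ai ** S))"
    "trace (M ** (K ** Ai ** K ** Ai ** S)) \<le> (1 / lam\<^sup>2) * trace (M ** S)"
proof -
  show "0 \<le> trace (M ** (K ** Ai ** K ** Ai ** S))"
    unfolding KAKAS using v_bounds lam_pos by (intro trace_diag_nonneg M) auto
  have "(v $ j)\<^sup>2 * (1 - v $ j) \<le> 1 * (1 - v $ j)" for j
    using v_bounds by (intro mult_right_mono) (auto simp: power_le_one)
  then show "trace (M ** (K ** Ai ** K ** Ai ** S)) \<le> (1 / lam\<^sup>2) * trace (M ** S)"
    unfolding KAKAS using lam_pos by (subst S_eq) (intro trace_diag_le M, auto simp: divide_right_mono)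
qed

lemma trace_SAKAS_bounds:
  assumes M: "\<And>x. 0 \<le> x \<bullet> (M *v x)"
  shows "trace (M ** (S ** Ai ** K ** Ai ** S)) \<le> (1 / lam) * trace (M ** S)"
proof -
  have "v $ j * (1 - v $ j)\<^sup>2 \<le> 1 * (1 - v $ j)" for j
    using v_bounds[of j] unfolding power2_eq_square by (intro mult_mono) (auto simp: mult_left_le)
  then show "trace (M ** (S ** Ai ** K ** Ai ** S)) \<le> (1 / lam) * trace (M ** S)"
    unfolding SAKAS using lam_pos by (subst S_eq) (intro trace_diag_le M, auto simp: divide_right_mono)
qed

lemma trace_KASAK_bounds:
  assumes M: "\<And>x. 0 \<le> x \<bullet> (M *v x)"
  shows "trace (M ** (K ** Ai ** S ** Ai ** K)) \<le> (1 / lam) * trace (M ** K)"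
proof -
  have "(v $ j)\<^sup>2 * (1 - v $ j) \<le> v $ j" for j
  proof -
    have "v $ j * (1 - v $ j) \<le> 1 * 1" using v_bounds[of j] by (intro mult_mono) auto
    then have "v $ j * (v $ j * (1 - v $ j)) \<le> v $ j * 1" using v_bounds[of j] by (intro mult_left_mono) auto
    then show ?thesis by (simp add: power2_eq_square mult.assoc)
  qed
  then show ?thesis
    unfolding KASAK using lam_pos
    by (subst K_eq) (intro trace_diag_le M, auto simp: divide_simps power2_eq_square)
qed

lemma trace_KAKASAKAK_bounds:
  assumes M: "\<And>x. 0 \<le> x \<bullet> (M *v x)"
  shows "trace (M ** (K ** Ai ** K ** Ai ** S ** Ai ** K ** Ai ** K)) \<le> (1 / lam ^ 3) * trace (M ** K)"
proof -
  have "(v $ j) ^ 4 * (1 - v $ j) \<le> v $ j" for j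
  proof -
    have "(v $ j) ^ 3 * (1 - v $ j) \<le> 1 * 1"
      using v_bounds[of j] by (intro mult_mono) (auto simp: power_le_one)
    then have "v $ j * ((v $ j) ^ 3 * (1 - v $ j)) \<le> v $ j * 1" using v_bounds[of j] by (intro mult_left_mono) auto
    then show ?thesis by (simp add: power4_eq_xxxx power3_eq_cube mult_ac)
  qed
  then show ?thesis
    unfolding KAKASAKAK using lam_pos
    by (subst K_eq) (intro trace_diag_le M, auto simp: divide_simps power4_eq_xxxx power3_eq_cube)
qed

text \<open>
  Substitute \<open>S A\<^sup>-\<^sup>1 = 1 - \<lambda> K A\<^sup>-\<^sup>1\<close>. Of the three products only the two on the right are integrated by parts.
\<close>

lemma SAKAS_eq: "S ** Ai ** K ** Ai ** S = K ** Ai ** S - lam *\<^sub>R (K ** Ai ** K ** Ai ** S)"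
proof -
  have "S ** Ai = mat 1 - lam *\<^sub>R (K ** Ai)"
  proof -
    have "A ** Ai = mat 1" by (rule matrix_inv_inverse[OF pos_def_invertible[OF pd_A]])
    moreover have "A ** Ai = S ** Ai + lam *\<^sub>R (K ** Ai)"
      by (subst A_def) (simp add: matrix_mult.add_left matrix_mult.scaleR_left)
    ultimately show ?thesis by (metis add_diff_cancel_right')
  qed
  then have "S ** Ai ** (K ** Ai ** S) = K ** Ai ** S - lam *\<^sub>R ((K ** Ai) ** (K ** Ai ** S))"
    by (simp add: matrix_mult.diff_left matrix_mult.scaleR_left)
  then show ?thesis by (simp only: matrix_mul_assoc)
qed

end

lemma integrable_PiM_component:
  fixes g :: "_ \<Rightarrow> real"
  assumes "\<And>i. i \<in> I \<Longrightarrow> prob_space (N i)" "i \<in> I" "integrable (N i) g"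
  shows "integrable (PiM I N) (\<lambda>x. g (x i))"
proof -
  have "distr (PiM I N) (N i) (\<lambda>x. x i) = N i"
    using assms(1,2) by (rule distr_PiM_component)
  then have "integrable (distr (PiM I N) (N i) (\<lambda>x. x i)) g"
    using assms(3) by simp
  then show ?thesis by (rule integrable_distr[rotated]) (use assms(2) in simp)
qed

text \<open>
  The terms of a divergence stay bounded although the row \<open>y\<close> does not, because \<open>A\<close> dominates \<open>c y y\<^sup>T\<close>.
\<close>

lemma (in diagonal_pencil) scatter_quads:
  assumes "\<And>x. c * (y \<bullet> x)\<^sup>2 \<le> x \<bullet> (A *v x)" "0 < c"
  shows "0 \<le> c * (y \<bullet> (Ai *v y))" "c * (y \<bullet> (Ai *v y)) \<le> 1"
    and "0 \<le> c * ((Ai *v y) \<bullet> (S *v (Ai *v y)))" "c * ((Ai *v y) \<bullet> (S *v (Ai *v y))) \<le> 1"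
    and "0 \<le> c * ((Ai *v y) \<bullet> (K *v (Ai *v y)))" "c * ((Ai *v y) \<bullet> (K *v (Ai *v y))) \<le> 1 / lam"
    and "0 \<le> c * ((Ai *v y) \<bullet> ((K ** Ai ** K) *v (Ai *v y)))"
      "c * ((Ai *v y) \<bullet> ((K ** Ai ** K) *v (Ai *v y))) \<le> 1 / lam\<^sup>2"
proof -
  note one = quad_inverse_le_one[OF pd_A assms]
  show 1: "0 \<le> c * (y \<bullet> (Ai *v y))" "c * (y \<bullet> (Ai *v y)) \<le> 1"
    using one assms(2) by auto
  have tAi: "transpose Ai = Ai" by (intro pos_def_sym pos_def_matrix_inv pd_A)
  have fold: "(Ai *v y) \<bullet> (N *v (Ai *v y)) = y \<bullet> ((Ai ** N ** Ai) *v y)" for N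
    by (metis inner_matrix_vector matrix_vector_mul_assoc tAi)
  have K1: "(Ai *v y) \<bullet> (K *v (Ai *v y)) = y \<bullet> ((Ai ** K ** Ai) *v y)" by (rule fold)
  have K2: "(Ai *v y) \<bullet> ((K ** Ai ** K) *v (Ai *v y)) = y \<bullet> ((Ai ** K ** Ai ** K ** Ai) *v y)"
    unfolding fold by (simp only: matrix_mul_assoc)
  show "0 \<le> c * ((Ai *v y) \<bullet> (K *v (Ai *v y)))" "0 \<le> c * ((Ai *v y) \<bullet> ((K ** Ai ** K) *v (Ai *v y)))"
    unfolding K1 K2 using quad_AKA(1) quad_AKAKA(1) assms(2) by auto
  have "c * ((Ai *v y) \<bullet> (K *v (Ai *v y))) \<le> c * (y \<bullet> (Ai *v y) / lam)"
    unfolding K1 using quad_AKA(2) assms(2) by (intro mult_left_mono) auto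
  also have "\<dots> = (c * (y \<bullet> (Ai *v y))) / lam" by simp
  also have "\<dots> \<le> 1 / lam" using 1(2) lam_pos by (intro divide_right_mono) auto
  finally show "c * ((Ai *v y) \<bullet> (K *v (Ai *v y))) \<le> 1 / lam" .
  have "c * ((Ai *v y) \<bullet> ((K ** Ai ** K) *v (Ai *v y))) \<le> c * (y \<bullet> (Ai *v y) / lam\<^sup>2)"
    unfolding K2 using quad_AKAKA(2) assms(2) by (intro mult_left_mono) auto
  also have "\<dots> = (c * (y \<bullet> (Ai *v y))) / lam\<^sup>2" by simp
  also have "\<dots> \<le> 1 / lam\<^sup>2" using 1(2) lam_pos by (intro divide_right_mono) auto
  finally show "c * ((Ai *v y) \<bullet> ((K ** Ai ** K) *v (Ai *v y))) \<le> 1 / lam\<^sup>2" .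
  show "0 \<le> c * ((Ai *v y) \<bullet> (S *v (Ai *v y)))"
    using pos_def_nonneg[OF pd_S] assms(2) by simp
  have "y = A *v (Ai *v y)"
    by (simp add: matrix_vector_mul_assoc matrix_inv_inverse pos_def_invertible[OF pd_A])
  then have "y \<bullet> (Ai *v y) = (Ai *v y) \<bullet> (A *v (Ai *v y))" by (metis inner_commute)
  also have "\<dots> = (Ai *v y) \<bullet> (S *v (Ai *v y)) + lam * ((Ai *v y) \<bullet> (K *v (Ai *v y)))"
    by (subst A_def) (simp add: matrix_vector.add_left matrix_vector.scaleR_left inner_add_right)
  finally have "(Ai *v y) \<bullet> (S *v (Ai *v y)) \<le> y \<bullet> (Ai *v y)"
    using quad_AKA(1)[of y] lam_pos K1 by simp
  then have "c * ((Ai *v y) \<bullet> (S *v (Ai *v y))) \<le> c * (y \<bullet> (Ai *v y))"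
    using assms(2) by (intro mult_left_mono) auto
  then show "c * ((Ai *v y) \<bullet> (S *v (Ai *v y))) \<le> 1" using 1(2) by linarith
qed

text \<open>
  Both divergences have this form: \<open>t\<close> is \<open>w (y \<bullet> Ai y)\<close>, \<open>\<tau>\<close> is a trace and \<open>\<beta>\<close> collects the other terms.
\<close>

lemma abs_div_bound:
  fixes t \<tau> \<beta> :: real
  assumes "0 \<le> t" "t \<le> 1" "0 \<le> \<tau>" "\<tau> \<le> b" "0 \<le> \<beta>" "\<beta> \<le> c"
  shows "\<bar>(1 - t) * \<tau> - \<beta>\<bar> \<le> b + c"
proof -
  have "0 \<le> (1 - t) * \<tau>" using assms by simp
  moreover have "(1 - t) * \<tau> \<le> 1 * b" using assms by (intro mult_mono) auto
  ultimately show ?thesis using assms by (intro abs_leI) linarith+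
qed

lemma scatter_member: "finite I \<Longrightarrow> i \<in> I \<Longrightarrow> (z i \<bullet> x)\<^sup>2 \<le> x \<bullet> (scatter I z *v x)"
  unfolding scatter_quad by (rule member_le_sum) auto

text \<open>
  The fields \<open>S A\<^sup>-\<^sup>1 x\<^sub>i\<close> are integrated by parts for a fixed positive definite \<open>S\<close>, and their divergences are
  summed over the rows.
\<close>

lemma integral_by_parts_rows:
  fixes \<Theta> :: "real ^ 'p ^ 'm" and \<Sigma> S :: "real ^ 'p ^ 'p"
  assumes \<Sigma>: "pos_def \<Sigma>" and S: "pos_def S" and lam: "0 < lam"
  defines "P \<equiv> PiM UNIV (\<lambda>i. mvn (\<Theta> $ i) \<Sigma>)"
  shows "(\<integral>x. (\<Sum>i\<in>UNIV. (matrix_inv \<Sigma> *v (x i - \<Theta> $ i)) \<bullet> (S *v (scatter_inv S lam UNIV x *v x i))) \<partial>P) =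
    (\<integral>x. trace (S ** scatter_inv S lam UNIV x) * (CARD('m) - lam * trace (scatter_inv S lam UNIV x ** scatter UNIV x))
      - lam * trace (S ** scatter_inv S lam UNIV x ** scatter UNIV x ** scatter_inv S lam UNIV x) \<partial>P)"
proof -
  let ?M = "matrix_inv \<Sigma>" and ?A = "scatter_inv S lam UNIV"
  interpret prob_space P unfolding P_def by (intro prob_space_PiM prob_space_mvn \<Sigma>)
  have [measurable]: "(\<lambda>x. x i) \<in> borel_measurable P" for i
    unfolding P_def by (rule component_measurable) simp
  have [measurable]: "?A \<in> borel_measurable P" unfolding P_def by measurable
  have pM: "pos_def ?M" by (rule pos_def_matrix_inv[OF \<Sigma>])
  have pencil: "\<exists>C Ci v. diagonal_pencil C Ci v lam S (scatter UNIV x) (S + lam *\<^sub>R scatter UNIV x)" for x :: "'m \<Rightarrow> real ^ 'p"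
    by (intro diagonal_pencil_exists S scatter_sym scatter_nonneg lam)
  have A_quad: "lam * (x i \<bullet> y)\<^sup>2 \<le> y \<bullet> ((S + lam *\<^sub>R scatter UNIV x) *v y)" for x :: "'m \<Rightarrow> real ^ 'p" and i y
  proof -
    have "lam * (x i \<bullet> y)\<^sup>2 \<le> lam * (y \<bullet> (scatter UNIV x *v y))"
      using lam by (intro mult_left_mono scatter_member) auto
    moreover have "y \<bullet> ((S + lam *\<^sub>R scatter UNIV x) *v y) = y \<bullet> (S *v y) + lam * (y \<bullet> (scatter UNIV x *v y))"
      by (simp add: matrix_vector.add_left matrix_vector.scaleR_left inner_add_right)
    ultimately show ?thesis using pos_def_nonneg[OF S, of y] by linarith
  qed
  have int2: "integrable P (\<lambda>x. div1 S (?A x) lam (x i))" for i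
  proof (rule integrable_const_bound[of _ "CARD('p) + 1"])
    have "norm (div1 S (?A x) lam (x i)) \<le> CARD('p) + 1" for x
    proof -
      obtain C Ci v where "diagonal_pencil C Ci v lam S (scatter UNIV x) (S + lam *\<^sub>R scatter UNIV x)"
        using pencil by blast
      then interpret diagonal_pencil C Ci v lam S "scatter UNIV x" "S + lam *\<^sub>R scatter UNIV x" .
      have s: "0 \<le> s" unfolding s_def using v_nonneg by (intro sum_nonneg) auto
      have "\<bar>(1 - lam * (x i \<bullet> (Ai *v x i))) * trace (S ** Ai) - lam * ((Ai *v x i) \<bullet> (S *v (Ai *v x i)))\<bar> \<le> real CARD('p) + 1"
        using scatter_quads(1-4)[OF A_quad lam, of i] s s_le
        by (intro abs_div_bound) (auto simp: trace_SA)
      then show ?thesis by (simp add: div1_def scatter_inv_def)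
    qed
    then show "AE x in P. norm (div1 S (?A x) lam (x i)) \<le> CARD('p) + 1" by simp
  qed measurable
  have int1: "integrable P (\<lambda>x. (?M *v (x i - \<Theta> $ i)) \<bullet> (S *v (?A x *v x i)))" for i
  proof (rule Bochner_Integration.integrable_bound)
    show "integrable P (\<lambda>x. ((x i - \<Theta> $ i) \<bullet> (?M *v (x i - \<Theta> $ i)) + (1 / lam) * trace (?M ** S)) / 2)"
      unfolding P_def
      by (intro integrable_divide Bochner_Integration.integrable_add
          integrable_PiM_component[where g = "\<lambda>y. (y - \<Theta> $ i) \<bullet> (?M *v (y - \<Theta> $ i))"]
          integrable_mvn_quadratic prob_space_mvn \<Sigma> UNIV_I)
        (simp add: P_def[symmetric])
    have bnd: "norm ((?M *v (x i - \<Theta> $ i)) \<bullet> (S *v (?A x *v x i))) \<le>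
        ((x i - \<Theta> $ i) \<bullet> (?M *v (x i - \<Theta> $ i)) + (1 / lam) * trace (?M ** S)) / 2" for x
    proof -
      obtain C Ci v where "diagonal_pencil C Ci v lam S (scatter UNIV x) (S + lam *\<^sub>R scatter UNIV x)"
        using pencil by blast
      then interpret diagonal_pencil C Ci v lam S "scatter UNIV x" "S + lam *\<^sub>R scatter UNIV x" .
      have tAi: "transpose Ai = Ai" by (intro pos_def_sym pos_def_matrix_inv pd_A)
      have Ai_eq: "?A x = Ai" by (simp add: scatter_inv_def)
      have "((S ** Ai) *v x i) \<bullet> (?M *v ((S ** Ai) *v x i)) \<le>
          trace (?M ** (S ** Ai) ** scatter UNIV x ** transpose (S ** Ai))"
        by (rule member_le_trace_quad[OF pM]) auto
      also have "\<dots> = trace (?M ** (S ** Ai ** scatter UNIV x ** Ai ** S))"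
        by (simp only: matrix_transpose_mul tAi pos_def_sym[OF S] matrix_mul_assoc)
      also have "\<dots> \<le> (1 / lam) * trace (?M ** S)"
        by (rule trace_SAKAS_bounds) (rule pos_def_nonneg[OF pM])
      finally have "(S *v (?A x *v x i)) \<bullet> (?M *v (S *v (?A x *v x i))) \<le> (1 / lam) * trace (?M ** S)"
        by (simp add: Ai_eq matrix_vector_mul_assoc)
      then show ?thesis
        using pos_def_inner_bound[OF pM, of "x i - \<Theta> $ i" "S *v (?A x *v x i)"] by (simp add: field_simps)
    qed
    show "AE x in P. norm ((?M *v (x i - \<Theta> $ i)) \<bullet> (S *v (?A x *v x i))) \<le>
        norm (((x i - \<Theta> $ i) \<bullet> (?M *v (x i - \<Theta> $ i)) + (1 / lam) * trace (?M ** S)) / 2)"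
      by (intro AE_I2) (rule order_trans[OF bnd], simp only: real_norm_def abs_ge_self)
  qed measurable
  have "(\<integral>x. (?M *v (x i - \<Theta> $ i)) \<bullet> (S *v (?A x *v x i)) \<partial>P) = (\<integral>x. div1 S (?A x) lam (x i) \<partial>P)" for i
    unfolding P_def
  proof (rule stein_fields(1)[OF _ _ \<Sigma> lam])
    show "AE x in PiM (UNIV - {i}) (\<lambda>i. mvn (\<Theta> $ i) \<Sigma>). pos_def (S + lam *\<^sub>R scatter (UNIV - {i}) x)"
      by (intro AE_I2 pencil_invertible(2) S scatter_sym scatter_nonneg lam)
  qed (rule finite UNIV_I int1[unfolded P_def] int2[unfolded P_def])+
  then have "(\<integral>x. (\<Sum>i\<in>UNIV. (?M *v (x i - \<Theta> $ i)) \<bullet> (S *v (?A x *v x i))) \<partial>P) =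
      (\<integral>x. (\<Sum>i\<in>UNIV. div1 S (?A x) lam (x i)) \<partial>P)"
    by (simp add: Bochner_Integration.integral_sum int1 int2)
  moreover have "transpose (?A x) = ?A x" for x :: "'m \<Rightarrow> real ^ 'p"
    unfolding scatter_inv_def
    by (intro pos_def_sym pos_def_matrix_inv pencil_invertible(2) S scatter_sym scatter_nonneg lam)
  then have "(\<Sum>i\<in>UNIV. div1 S (?A x) lam (x i)) =
      trace (S ** ?A x) * (CARD('m) - lam * trace (?A x ** scatter UNIV x))
        - lam * trace (S ** ?A x ** scatter UNIV x ** ?A x)" for x :: "'m \<Rightarrow> real ^ 'p"
    by (rule sum_div1)
  ultimately show ?thesis by simp
qed

text \<open>
  The traces are \<open>\<Sum>\<^sub>i \<Sigma>\<^sup>-\<^sup>1 z\<^sub>i \<bullet> h z\<^sub>i\<close> for \<open>h = K A\<^sup>-\<^sup>1\<close> and for \<open>h = K A\<^sup>-\<^sup>1 K A\<^sup>-\<^sup>1\<close>, with \<open>X\<close> fixed.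
  The almost sure statements come from the positive definiteness of the scatter matrix.
\<close>

lemma integral_by_parts_scatter:
  fixes X :: "real ^ 'p ^ 'm" and \<Sigma> :: "real ^ 'p ^ 'p"
  assumes \<Sigma>: "pos_def \<Sigma>" and n: "CARD('p) \<le> n" and lam: "0 < lam"
  defines "K \<equiv> transpose X ** X" and "P \<equiv> PiM {..<n} (\<lambda>_. mvn 0 \<Sigma>)"
    and "Inv \<equiv> (\<lambda>S. matrix_inv (S + lam *\<^sub>R (transpose X ** X)))"
  defines "S \<equiv> scatter {..<n}"
  shows "(\<integral>z. trace (matrix_inv \<Sigma> ** (K ** Inv (S z) ** S z)) \<partial>P) =
      (\<integral>z. trace (K ** Inv (S z)) * (n - trace (Inv (S z) ** S z)) - trace (K ** Inv (S z) ** S z ** Inv (S z)) \<partial>P)"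
    and "(\<integral>z. trace (matrix_inv \<Sigma> ** (K ** Inv (S z) ** K ** Inv (S z) ** S z)) \<partial>P) =
      (\<integral>z. (n - trace (Inv (S z) ** S z)) * trace (K ** Inv (S z) ** K ** Inv (S z))
        - trace (K ** Inv (S z)) * trace (K ** Inv (S z) ** S z ** Inv (S z))
        - 2 * trace (K ** Inv (S z) ** K ** Inv (S z) ** S z ** Inv (S z)) \<partial>P)"
proof -
  let ?M = "matrix_inv \<Sigma>" and ?A = "scatter_inv (lam *\<^sub>R K) 1 {..<n}"
  interpret prob_space P unfolding P_def by (intro prob_space_PiM prob_space_mvn \<Sigma>)
  have xm [measurable]: "(\<lambda>x. x i) \<in> borel_measurable P" if "i < n" for i
    unfolding P_def using that by (intro component_measurable) simp
  have [measurable]: "?A \<in> borel_measurable P" "S \<in> borel_measurable P"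
    unfolding P_def S_def by measurable
  have pM: "pos_def ?M" by (rule pos_def_matrix_inv[OF \<Sigma>])
  have K: "transpose K = K" "\<And>x. 0 \<le> x \<bullet> (K *v x)"
    unfolding K_def by (rule gram_sym, rule gram_nonneg)
  have Inv: "Inv (S z) = ?A z" for z
    by (simp add: Inv_def scatter_inv_def S_def K_def add.commute)
  have AE_S: "AE z in P. pos_def (S z)"
    unfolding P_def S_def by (rule AE_pos_def_scatter[OF \<Sigma>]) (use n in auto)
  have A_quad: "1 * (z i \<bullet> y)\<^sup>2 \<le> y \<bullet> ((S z + lam *\<^sub>R K) *v y)" if "i < n" for z i y
    using scatter_member[of "{..<n}" i z y] that lam K(2)[of y]
    by (simp add: matrix_vector.add_left matrix_vector.scaleR_left inner_add_right S_def add_increasing2)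
  have AE_sym: "AE z in P. transpose (?A z) = ?A z"
    using AE_S
  proof eventually_elim
    case (elim z)
    show ?case
      unfolding Inv[symmetric] Inv_def K_def[symmetric]
      by (intro pos_def_sym pos_def_matrix_inv pencil_invertible(2) elim K lam)
  qed
  have div_bounds: "norm (div1 K (?A z) 1 (z i)) \<le> CARD('p) / lam + 1 / lam \<and>
      norm (div2 K (?A z) 1 (z i)) \<le> CARD('p) / lam\<^sup>2 + (CARD('p) / lam\<^sup>2 + 2 / lam\<^sup>2)"
    if pd: "pos_def (S z)" and i: "i < n" for z i
  proof -
    obtain C Ci v where "diagonal_pencil C Ci v lam (S z) K (S z + lam *\<^sub>R K)"
      using diagonal_pencil_exists[OF pd K lam] by blast
    then interpret diagonal_pencil C Ci v lam "S z" K "S z + lam *\<^sub>R K" .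
    have A_eq: "?A z = Ai" using Inv[of z] by (simp add: Inv_def K_def)
    have s: "0 \<le> s" unfolding s_def using v_nonneg by (intro sum_nonneg) auto
    have q: "0 \<le> q" unfolding q_def by (intro sum_nonneg) auto
    note b = scatter_quads[OF A_quad[OF i] zero_less_one, unfolded mult_1]
    let ?y = "Ai *v z i"
    have tAi: "transpose Ai = Ai" by (intro pos_def_sym pos_def_matrix_inv pd_A)
    have KAK: "(K *v ?y) \<bullet> (Ai *v (K *v ?y)) = ?y \<bullet> ((K ** Ai ** K) *v ?y)"
      by (metis K(1) inner_matrix_vector matrix_vector_mul_assoc)
    have sl: "s / lam \<le> CARD('p) / lam" using s_le lam by (intro divide_right_mono) auto
    have ql: "q / lam\<^sup>2 \<le> CARD('p) / lam\<^sup>2" using s_le q_le_s lam by (intro divide_right_mono) auto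
    have "\<bar>(1 - z i \<bullet> ?y) * trace (K ** Ai) - ?y \<bullet> (K *v ?y)\<bar> \<le> CARD('p) / lam + 1 / lam"
      using b s sl lam by (intro abs_div_bound) (auto simp: trace_KA)
    moreover have "(?y \<bullet> (K *v ?y)) * trace (K ** Ai) \<le> (1 / lam) * (CARD('p) / lam)"
      using b s sl lam by (intro mult_mono) (auto simp: trace_KA)
    then have "\<bar>(1 - z i \<bullet> ?y) * trace (K ** Ai ** K ** Ai)
        - ((?y \<bullet> (K *v ?y)) * trace (K ** Ai) + 2 * (?y \<bullet> ((K ** Ai ** K) *v ?y)))\<bar> \<le>
        CARD('p) / lam\<^sup>2 + (CARD('p) / lam\<^sup>2 + 2 / lam\<^sup>2)"
      using b s q ql lam by (intro abs_div_bound) (auto simp: trace_KA trace_KAKA power2_eq_square)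
    ultimately show ?thesis
      unfolding div1_def div2_def A_eq by (simp add: KAK algebra_simps)
  qed
  have int_div: "integrable P (\<lambda>z. div1 K (?A z) 1 (z i))" "integrable P (\<lambda>z. div2 K (?A z) 1 (z i))"
    if i: "i < n" for i
  proof -
    note [measurable] = xm[OF i]
    show "integrable P (\<lambda>z. div1 K (?A z) 1 (z i))"
      by (rule integrable_const_bound[of _ "CARD('p) / lam + 1 / lam"])
        (use AE_S in eventually_elim, use div_bounds[OF _ i] in blast, measurable)
    show "integrable P (\<lambda>z. div2 K (?A z) 1 (z i))"
      by (rule integrable_const_bound[of _ "CARD('p) / lam\<^sup>2 + (CARD('p) / lam\<^sup>2 + 2 / lam\<^sup>2)"])
        (use AE_S in eventually_elim, use div_bounds[OF _ i] in blast, measurable)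
  qed
  have int_field: "integrable P (\<lambda>z. (?M *v (z i - 0)) \<bullet> f z)"
    if i: "i < n" and [measurable]: "f \<in> borel_measurable P"
      and f: "\<And>z. pos_def (S z) \<Longrightarrow> f z \<bullet> (?M *v f z) \<le> c" for f :: "(nat \<Rightarrow> real ^ 'p) \<Rightarrow> real ^ 'p" and i c
  proof (rule Bochner_Integration.integrable_bound)
    note [measurable] = xm[OF i]
    show "integrable P (\<lambda>z. ((z i - 0) \<bullet> (?M *v (z i - 0)) + c) / 2)"
      unfolding P_def using i
      by (intro integrable_divide Bochner_Integration.integrable_add
          integrable_PiM_component[where g = "\<lambda>y. (y - 0) \<bullet> (?M *v (y - 0))"]
          integrable_mvn_quadratic prob_space_mvn \<Sigma>)
        (simp_all add: P_def[symmetric])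
    show "AE z in P. norm ((?M *v (z i - 0)) \<bullet> f z) \<le> norm (((z i - 0) \<bullet> (?M *v (z i - 0)) + c) / 2)"
      using AE_S
    proof eventually_elim
      case (elim z)
      show ?case
        using pos_def_inner_bound[OF pM, of "z i - 0" "f z"] f[OF elim] by (simp add: field_simps)
    qed
    show "(\<lambda>z. (?M *v (z i - 0)) \<bullet> f z) \<in> borel_measurable P" by measurable
  qed
  have field_bounds: "(K *v (?A z *v z i)) \<bullet> (?M *v (K *v (?A z *v z i))) \<le> (1 / lam) * trace (?M ** K) \<and>
      (K *v (?A z *v (K *v (?A z *v z i)))) \<bullet> (?M *v (K *v (?A z *v (K *v (?A z *v z i))))) \<le> (1 / lam ^ 3) * trace (?M ** K)"
    if pd: "pos_def (S z)" and i: "i < n" for z i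
  proof -
    obtain C Ci v where "diagonal_pencil C Ci v lam (S z) K (S z + lam *\<^sub>R K)"
      using diagonal_pencil_exists[OF pd K lam] by blast
    then interpret diagonal_pencil C Ci v lam "S z" K "S z + lam *\<^sub>R K" .
    have A_eq: "?A z = Ai" using Inv[of z] by (simp add: Inv_def K_def)
    have tAi: "transpose Ai = Ai" by (intro pos_def_sym pos_def_matrix_inv pd_A)
    have "((K ** Ai) *v z i) \<bullet> (?M *v ((K ** Ai) *v z i)) \<le> trace (?M ** (K ** Ai) ** S z ** transpose (K ** Ai))"
      unfolding S_def by (rule member_le_trace_quad[OF pM]) (use i in auto)
    also have "\<dots> = trace (?M ** (K ** Ai ** S z ** Ai ** K))"
      by (simp only: matrix_transpose_mul tAi K(1) matrix_mul_assoc)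
    also have "\<dots> \<le> (1 / lam) * trace (?M ** K)"
      by (rule trace_KASAK_bounds) (rule pos_def_nonneg[OF pM])
    finally have 1: "((K ** Ai) *v z i) \<bullet> (?M *v ((K ** Ai) *v z i)) \<le> (1 / lam) * trace (?M ** K)" .
    have "((K ** Ai ** K ** Ai) *v z i) \<bullet> (?M *v ((K ** Ai ** K ** Ai) *v z i)) \<le>
        trace (?M ** (K ** Ai ** K ** Ai) ** S z ** transpose (K ** Ai ** K ** Ai))"
      unfolding S_def by (rule member_le_trace_quad[OF pM]) (use i in auto)
    also have "\<dots> = trace (?M ** (K ** Ai ** K ** Ai ** S z ** Ai ** K ** Ai ** K))"
      by (simp only: matrix_transpose_mul tAi K(1) matrix_mul_assoc)
    also have "\<dots> \<le> (1 / lam ^ 3) * trace (?M ** K)"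
      by (rule trace_KAKASAKAK_bounds) (rule pos_def_nonneg[OF pM])
    finally show ?thesis using 1 by (simp add: A_eq matrix_vector_mul_assoc matrix_mul_assoc)
  qed
  have int1: "integrable P (\<lambda>z. (?M *v (z i - 0)) \<bullet> (K *v (?A z *v z i)))" if i: "i < n" for i
  proof (rule int_field[OF i])
    note [measurable] = xm[OF i]
    show "(\<lambda>z. K *v (?A z *v z i)) \<in> borel_measurable P" by measurable
  qed (use field_bounds[OF _ i] in blast)
  have int2: "integrable P (\<lambda>z. (?M *v (z i - 0)) \<bullet> (K *v (?A z *v (K *v (?A z *v z i)))))" if i: "i < n" for i
  proof (rule int_field[OF i])
    note [measurable] = xm[OF i]
    show "(\<lambda>z. K *v (?A z *v (K *v (?A z *v z i)))) \<in> borel_measurable P" by measurable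
  qed (use field_bounds[OF _ i] in blast)
  have stein: "(\<integral>z. (?M *v (z i - 0)) \<bullet> (K *v (?A z *v z i)) \<partial>P) = (\<integral>z. div1 K (?A z) 1 (z i) \<partial>P) \<and>
      (\<integral>z. (?M *v (z i - 0)) \<bullet> (K *v (?A z *v (K *v (?A z *v z i)))) \<partial>P) = (\<integral>z. div2 K (?A z) 1 (z i) \<partial>P)"
    if i: "i < n" for i
  \<comment> \<open>If X = 0, both fields vanish. Otherwise a nonzero row of X supplies the direction that the
    remaining n - 1 vectors may miss.\<close>
  proof (cases "X = 0")
    case True
    then have "K = 0" by (simp add: K_def matrix_mult.zero_right)
    then show ?thesis
      by (simp add: div1_def div2_def matrix_mult.zero_left matrix_vector.zero_left matrix_mult.zero_right
          trace_def)
  next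
    case False
    then obtain l where l: "X $ l \<noteq> 0" by (auto simp: vec_eq_iff)
    have "lam * (X $ l \<bullet> v)\<^sup>2 \<le> v \<bullet> ((lam *\<^sub>R K) *v v)" for v
    proof -
      have "(X $ l \<bullet> v)\<^sup>2 \<le> v \<bullet> (K *v v)"
        unfolding K_def gram_outer using scatter_member[of UNIV l "\<lambda>i. X $ i" v] by (simp add: scatter_def)
      then show ?thesis using lam by (simp add: matrix_vector.scaleR_left)
    qed
    then have "AE z in PiM ({..<n} - {i}) (\<lambda>_. mvn 0 \<Sigma>). pos_def (lam *\<^sub>R K + scatter ({..<n} - {i}) z)"
      using n i lam l by (intro AE_pos_def_plus_scatter[OF \<Sigma>]) (auto simp: transpose_scalar K)
    then have slice: "AE z in PiM ({..<n} - {i}) (\<lambda>_. mvn 0 \<Sigma>). pos_def (lam *\<^sub>R K + 1 *\<^sub>R scatter ({..<n} - {i}) z)"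
      by simp
    have i': "i \<in> {..<n}" using i by simp
    note fields = stein_fields[OF finite_lessThan i' \<Sigma> zero_less_one slice, of K, folded P_def]
    show ?thesis
      using fields(1)[OF int1[OF i] int_div(1)[OF i]] fields(2)[OF int2[OF i] int_div(2)[OF i]] by blast
  qed
  have sym: "transpose ?M = ?M" by (rule pos_def_sym[OF pM])
  have "(\<integral>z. (\<Sum>i<n. (?M *v (z i - 0)) \<bullet> (K *v (?A z *v z i))) \<partial>P) = (\<integral>z. (\<Sum>i<n. div1 K (?A z) 1 (z i)) \<partial>P)"
    by (subst (1 2) Bochner_Integration.integral_sum) (auto simp: int1[simplified] int_div stein[simplified])
  also have "\<dots> = (\<integral>z. trace (K ** Inv (S z)) * (n - trace (Inv (S z) ** S z)) - trace (K ** Inv (S z) ** S z ** Inv (S z)) \<partial>P)"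
    unfolding Inv
  proof (rule integral_cong_AE)
    show "AE z in P. (\<Sum>i<n. div1 K (?A z) 1 (z i)) =
        trace (K ** ?A z) * (n - trace (?A z ** S z)) - trace (K ** ?A z ** S z ** ?A z)"
      using AE_sym by eventually_elim (simp add: sum_div1 S_def)
    show "(\<lambda>z. \<Sum>i<n. div1 K (?A z) 1 (z i)) \<in> borel_measurable P"
      by (intro borel_measurable_sum div_measurable) (auto intro: xm)
  qed measurable
  also have "(\<lambda>z. \<Sum>i<n. (?M *v (z i - 0)) \<bullet> (K *v (?A z *v z i))) = (\<lambda>z. trace (?M ** (K ** Inv (S z) ** S z)))"
  proof
    fix z
    have "trace (?M ** (K ** ?A z ** scatter {..<n} z)) = trace ((?M ** K ** ?A z) ** scatter {..<n} z)"
      by (simp only: matrix_mul_assoc)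
    also have "\<dots> = (\<Sum>i<n. z i \<bullet> ((?M ** K ** ?A z) *v z i))" by (rule trace_mult_scatter)
    also have "\<dots> = (\<Sum>i<n. (?M *v (z i - 0)) \<bullet> (K *v (?A z *v z i)))"
      by (intro sum.cong refl) (simp only: matrix_vector_mul_assoc[symmetric] inner_matrix_vector[of _ ?M] sym diff_zero)
    finally show "(\<Sum>i<n. (?M *v (z i - 0)) \<bullet> (K *v (?A z *v z i))) = trace (?M ** (K ** Inv (S z) ** S z))"
      by (simp only: Inv[unfolded S_def] S_def)
  qed
  finally show "(\<integral>z. trace (?M ** (K ** Inv (S z) ** S z)) \<partial>P) =
      (\<integral>z. trace (K ** Inv (S z)) * (n - trace (Inv (S z) ** S z)) - trace (K ** Inv (S z) ** S z ** Inv (S z)) \<partial>P)" .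
  have "(\<integral>z. (\<Sum>i<n. (?M *v (z i - 0)) \<bullet> (K *v (?A z *v (K *v (?A z *v z i))))) \<partial>P) =
      (\<integral>z. (\<Sum>i<n. div2 K (?A z) 1 (z i)) \<partial>P)"
    by (subst (1 2) Bochner_Integration.integral_sum) (auto simp: int2[simplified] int_div stein[simplified])
  also have "\<dots> = (\<integral>z. (n - trace (Inv (S z) ** S z)) * trace (K ** Inv (S z) ** K ** Inv (S z))
        - trace (K ** Inv (S z)) * trace (K ** Inv (S z) ** S z ** Inv (S z))
        - 2 * trace (K ** Inv (S z) ** K ** Inv (S z) ** S z ** Inv (S z)) \<partial>P)"
    unfolding Inv
  proof (rule integral_cong_AE)
    show "AE z in P. (\<Sum>i<n. div2 K (?A z) 1 (z i)) =
        (n - trace (?A z ** S z)) * trace (K ** ?A z ** K ** ?A z)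
        - trace (K ** ?A z) * trace (K ** ?A z ** S z ** ?A z) - 2 * trace (K ** ?A z ** K ** ?A z ** S z ** ?A z)"
      using AE_sym by eventually_elim (simp add: sum_div2 K S_def)
    show "(\<lambda>z. \<Sum>i<n. div2 K (?A z) 1 (z i)) \<in> borel_measurable P"
      by (intro borel_measurable_sum div_measurable) (auto intro: xm)
  qed measurable
  also have "(\<lambda>z. \<Sum>i<n. (?M *v (z i - 0)) \<bullet> (K *v (?A z *v (K *v (?A z *v z i))))) =
      (\<lambda>z. trace (?M ** (K ** Inv (S z) ** K ** Inv (S z) ** S z)))"
  proof
    fix z
    have "trace (?M ** (K ** ?A z ** K ** ?A z ** scatter {..<n} z)) =
        trace ((?M ** K ** ?A z ** K ** ?A z) ** scatter {..<n} z)"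
      by (simp only: matrix_mul_assoc)
    also have "\<dots> = (\<Sum>i<n. z i \<bullet> ((?M ** K ** ?A z ** K ** ?A z) *v z i))" by (rule trace_mult_scatter)
    also have "\<dots> = (\<Sum>i<n. (?M *v (z i - 0)) \<bullet> (K *v (?A z *v (K *v (?A z *v z i)))))"
      by (intro sum.cong refl) (simp only: matrix_vector_mul_assoc[symmetric] inner_matrix_vector[of _ ?M] sym diff_zero)
    finally show "(\<Sum>i<n. (?M *v (z i - 0)) \<bullet> (K *v (?A z *v (K *v (?A z *v z i))))) =
        trace (?M ** (K ** Inv (S z) ** K ** Inv (S z) ** S z))"
      by (simp only: Inv[unfolded S_def] S_def)
  qed
  finally show "(\<integral>z. trace (?M ** (K ** Inv (S z) ** K ** Inv (S z) ** S z)) \<partial>P) =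
      (\<integral>z. (n - trace (Inv (S z) ** S z)) * trace (K ** Inv (S z) ** K ** Inv (S z))
        - trace (K ** Inv (S z)) * trace (K ** Inv (S z) ** S z ** Inv (S z))
        - 2 * trace (K ** Inv (S z) ** K ** Inv (S z) ** S z ** Inv (S z)) \<partial>P)" .
qed

section \<open>The risk difference\<close>

lemma det_scaleR: "det (c *\<^sub>R A) = c ^ CARD('n) * det A" for A :: "real ^ 'n ^ 'n"
proof -
  have "c *\<^sub>R A = (c *\<^sub>R mat 1) ** A" by (simp add: matrix_mult.scaleR_left)
  moreover have "det (c *\<^sub>R mat 1 :: real ^ 'n ^ 'n) = c ^ CARD('n)"
    by (subst det_diagonal) (auto simp: mat_def)
  ultimately show ?thesis by (simp add: det_mul)
qed

lemma pos_def_scaleR: "pos_def A \<Longrightarrow> 0 < c \<Longrightarrow> pos_def (c *\<^sub>R A)"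
  by (simp add: pos_def_def transpose_scalar matrix_vector.scaleR_left)

text \<open>
  This form of the condition, a closed one and the nonvanishing of the determinant, is visibly
  measurable.
\<close>

lemma pos_def_iff_det:
  fixes S :: "real ^ 'n ^ 'n"
  shows "pos_def S \<longleftrightarrow> transpose S = S \<and> (\<forall>x. 0 \<le> x \<bullet> (S *v x)) \<and> det S \<noteq> 0"
proof
  assume "pos_def S"
  then show "transpose S = S \<and> (\<forall>x. 0 \<le> x \<bullet> (S *v x)) \<and> det S \<noteq> 0"
    using pos_def_sym pos_def_nonneg det_pos_def by (metis less_irrefl)
next
  assume S: "transpose S = S \<and> (\<forall>x. 0 \<le> x \<bullet> (S *v x)) \<and> det S \<noteq> 0"
  then obtain U :: "real ^ 'n ^ 'n" and d where U: "transpose U ** U = mat 1" and S_eq: "S = U ** diag_mat d ** transpose U"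
    using spectral_theorem by blast
  have UU: "U ** transpose U = mat 1" by (rule matrix_inv_eqI(3)[OF U])
  have "det S = det U * det (transpose U) * (\<Prod>i\<in>UNIV. d $ i)" by (simp add: S_eq det_mul det_diag_mat)
  with S have "(\<Prod>i\<in>UNIV. d $ i) \<noteq> 0" by auto
  then have "d $ i \<noteq> 0" for i by (simp add: prod_zero_iff)
  moreover have "0 \<le> d $ i" for i unfolding congruent_diag_entry[OF U S_eq] using S by blast
  ultimately show "pos_def S"
    unfolding S_eq by (intro pos_def_congruence[OF UU]) (simp add: less_le)
qed

lemma pos_def_sets [measurable]: "{S :: real ^ 'n ^ 'n. pos_def S} \<in> sets borel"
proof -
  have c: "continuous_on UNIV (\<lambda>S :: real ^ 'n ^ 'n. transpose S)"
    unfolding transpose_def by (intro continuous_intros)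
  have "closed {S :: real ^ 'n ^ 'n. transpose S = S}"
    by (intro closed_Collect_eq c continuous_on_id)
  moreover have "closed {S :: real ^ 'n ^ 'n. \<forall>x. 0 \<le> x \<bullet> (S *v x)}"
    unfolding Collect_all_eq
    by (intro closed_INT ballI closed_Collect_le continuous_intros matrix_vector.continuous_on)
  moreover have "{S :: real ^ 'n ^ 'n. det S \<noteq> 0} \<in> sets borel" by measurable
  ultimately have "{S. transpose S = S} \<inter> {S. \<forall>x. 0 \<le> x \<bullet> (S *v x)} \<inter> {S :: real ^ 'n ^ 'n. det S \<noteq> 0} \<in> sets borel"
    by (intro sets.Int) (auto intro: borel_closed)
  also have "{S. transpose S = S} \<inter> {S. \<forall>x. 0 \<le> x \<bullet> (S *v x)} \<inter> {S. det S \<noteq> 0} = {S :: real ^ 'n ^ 'n. pos_def S}"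
    by (auto simp: pos_def_iff_det)
  finally show ?thesis .
qed

lemma sets_wishart [simp, measurable_cong]: "sets (wishart n \<Sigma>) = sets borel"
  by (simp add: wishart_def)

lemma prob_space_wishart: "pos_def \<Sigma> \<Longrightarrow> prob_space (wishart n \<Sigma>)"
  using prob_space.prob_space_distr[OF prob_space_PiM[OF prob_space_mvn] scatter_measurable]
  by (simp add: wishart_scatter)

lemma AE_pos_def_wishart:
  fixes \<Sigma> :: "real ^ 'p ^ 'p"
  assumes "pos_def \<Sigma>" "CARD('p) \<le> n"
  shows "AE S in wishart n \<Sigma>. pos_def S"
  unfolding wishart_scatter[OF assms(1)]
  by (subst AE_distr_iff) (use AE_pos_def_scatter[OF assms(1), of "{..<n}"] assms(2) in auto)

lemma AE_pos_def_snd: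
  fixes \<Theta> :: "real ^ 'p ^ 'm" and \<Sigma> :: "real ^ 'p ^ 'p"
  assumes \<Sigma>: "pos_def \<Sigma>" and n: "CARD('p) \<le> n"
  shows "AE \<omega> in matrix_normal \<Theta> (mat 1) \<Sigma> \<Otimes>\<^sub>M wishart n \<Sigma>. pos_def (snd \<omega>)"
proof -
  let ?MX = "matrix_normal \<Theta> (mat 1) \<Sigma>" and ?W = "wishart n \<Sigma>"
  interpret MX: prob_space ?MX by (rule prob_space_matrix_normal[OF \<Sigma>])
  interpret W: prob_space ?W by (rule prob_space_wishart[OF \<Sigma>])
  interpret pair_prob_space ?MX ?W ..
  show ?thesis
  proof (rule AE_pair_measure)
    have "{\<omega> \<in> space (?MX \<Otimes>\<^sub>M ?W). pos_def (snd \<omega>)} = snd -` {S. pos_def S} \<inter> space (?MX \<Otimes>\<^sub>M ?W)" by auto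
    also have "\<dots> \<in> sets (?MX \<Otimes>\<^sub>M ?W)"
      by (rule measurable_sets[OF measurable_snd]) simp
    finally show "{\<omega> \<in> space (?MX \<Otimes>\<^sub>M ?W). pos_def (snd \<omega>)} \<in> sets (?MX \<Otimes>\<^sub>M ?W)" .
    show "AE x in ?MX. AE y in ?W. pos_def (snd (x, y))"
      using AE_pos_def_wishart[OF \<Sigma> n] by simp
  qed
qed

lemma integrable_trace_wishart:
  fixes \<Sigma> :: "real ^ 'p ^ 'p"
  assumes \<Sigma>: "pos_def \<Sigma>"
  shows "integrable (wishart n \<Sigma>) (\<lambda>S. trace (M ** S))"
proof -
  have "integrable (PiM {..<n} (\<lambda>_. mvn 0 \<Sigma>)) (\<lambda>z. \<Sum>i<n. z i \<bullet> (M *v z i))"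
    using integrable_mvn_quadratic(1)[OF \<Sigma>, of 0 M]
    by (intro Bochner_Integration.integrable_sum integrable_PiM_component[where g = "\<lambda>y. y \<bullet> (M *v y)"]
        prob_space_mvn \<Sigma>) auto
  then have "integrable (PiM {..<n} (\<lambda>_. mvn 0 \<Sigma>)) (\<lambda>z. trace (M ** scatter {..<n} z))"
    by (simp add: trace_mult_scatter)
  then show ?thesis
    unfolding wishart_scatter[OF \<Sigma>] by (subst integrable_distr_eq) auto
qed

lemma integrable_neg_ln_det_wishart:
  fixes \<Sigma> :: "real ^ 'p ^ 'p"
  assumes \<Sigma>: "pos_def \<Sigma>" and n: "CARD('p) \<le> n"
  shows "integrable (wishart n \<Sigma>) (\<lambda>S. max 0 (- ln (det S)))"
proof (rule integrableI_bounded)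
  have "(\<integral>\<^sup>+S. ennreal (norm (max 0 (- ln (det S)))) \<partial>wishart n \<Sigma>) = (\<integral>\<^sup>+S. ennreal (- ln (det S)) \<partial>wishart n \<Sigma>)"
    by (intro nn_integral_cong) (auto simp: max_def ennreal_neg)
  also have "\<dots> = (\<integral>\<^sup>+z. ennreal (- ln (det (scatter {..<n} z))) \<partial>PiM {..<n} (\<lambda>_. mvn 0 \<Sigma>))"
    unfolding wishart_scatter[OF \<Sigma>] by (rule nn_integral_distr) measurable
  also have "\<dots> < \<infinity>" using n by (intro nn_integral_neg_ln_det_scatter \<Sigma>) auto
  finally show "(\<integral>\<^sup>+S. ennreal (norm (max 0 (- ln (det S)))) \<partial>wishart n \<Sigma>) < \<infinity>" .
qed measurable

lemma integrable_pair_fst: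
  fixes g :: "_ \<Rightarrow> real"
  assumes "prob_space M2" "integrable M1 g"
  shows "integrable (M1 \<Otimes>\<^sub>M M2) (\<lambda>\<omega>. g (fst \<omega>))"
proof -
  have "integrable (distr (M1 \<Otimes>\<^sub>M M2) M1 fst) g"
    using assms(2) by (simp add: prob_space.distr_pair_fst[OF assms(1)])
  then show ?thesis by (rule integrable_distr[rotated]) simp
qed

lemma integrable_pair_snd:
  fixes g :: "_ \<Rightarrow> real"
  assumes "prob_space M1" "prob_space M2" "integrable M2 g"
  shows "integrable (M1 \<Otimes>\<^sub>M M2) (\<lambda>\<omega>. g (snd \<omega>))"
proof -
  interpret M1: prob_space M1 by fact
  interpret M2: prob_space M2 by fact
  interpret pair_sigma_finite M2 M1 ..
  from integrable_product_swap[OF integrable_pair_fst[OF assms(1,3)]] show ?thesis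
    by (simp add: case_prod_beta')
qed

lemma row_matrix_mult: "(X ** N) $ i = transpose N *v (X $ i)" for N :: "real ^ 'k ^ 'n"
  by (simp add: vec_eq_iff matrix_matrix_mult_def vector_matrix_mult_def mult.commute)

text \<open>
  Twice the loss difference of the two estimators. Its terms without the logarithm are combinations of the
  three statistics whose expectations integration by parts turns into those of \<open>by_parts1\<close>, \<open>by_parts2\<close>
  and \<open>by_parts3\<close>.
\<close>

definition loss_diff :: "nat \<Rightarrow> real \<Rightarrow> real ^ 'p ^ 'm \<Rightarrow> real ^ 'p ^ 'p \<Rightarrow> real ^ 'p ^ 'm \<Rightarrow> real ^ 'p ^ 'p \<Rightarrow> real" where
  "loss_diff n k \<Theta> M X S =
    (let K = transpose X ** X; Ai = matrix_inv (S + (1 - k) *\<^sub>R K) in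
      real CARD('m) * k / real n * trace (M ** (K ** Ai ** S))
      - real CARD('m) * (ln (det (S + k *\<^sub>R (K ** Ai ** S))) - ln (det S))
      - 2 * k * (\<Sum>i\<in>UNIV. (M *v (X $ i - \<Theta> $ i)) \<bullet> (S *v (Ai *v X $ i)))
      + k\<^sup>2 * (trace (M ** (K ** Ai ** S)) - (1 - k) * trace (M ** (K ** Ai ** K ** Ai ** S))))"

definition by_parts1 :: "nat \<Rightarrow> real ^ 'p ^ 'p \<Rightarrow> real ^ 'p ^ 'p \<Rightarrow> real ^ 'p ^ 'p \<Rightarrow> real" where
  "by_parts1 n K Ai S = trace (K ** Ai) * (n - trace (Ai ** S)) - trace (K ** Ai ** S ** Ai)"

definition by_parts2 :: "nat \<Rightarrow> real ^ 'p ^ 'p \<Rightarrow> real ^ 'p ^ 'p \<Rightarrow> real ^ 'p ^ 'p \<Rightarrow> real" where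
  "by_parts2 n K Ai S = (n - trace (Ai ** S)) * trace (K ** Ai ** K ** Ai)
    - trace (K ** Ai) * trace (K ** Ai ** S ** Ai) - 2 * trace (K ** Ai ** K ** Ai ** S ** Ai)"

definition by_parts3 :: "nat \<Rightarrow> real \<Rightarrow> real ^ 'p ^ 'p \<Rightarrow> real ^ 'p ^ 'p \<Rightarrow> real ^ 'p ^ 'p \<Rightarrow> real" where
  "by_parts3 m lam K Ai S = trace (S ** Ai) * (m - lam * trace (Ai ** K)) - lam * trace (S ** Ai ** K ** Ai)"

context diagonal_pencil
begin

lemma by_parts_eigenvalues:
  shows "by_parts1 n K Ai S = (s * (real n - real CARD('p) + s) - s + q) / lam"
    and "by_parts2 n K Ai S = ((real n - real CARD('p) + s) * q - s * (s - q) - 2 * (q - r)) / lam\<^sup>2"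
    and "by_parts3 m lam K Ai S = (CARD('p) - s) * (m - s) - (s - q)"
proof -
  have AS: "trace (Ai ** S) = CARD('p) - s" using trace_SA trace_mul_sym[of Ai S] by simp
  have AK: "trace (Ai ** K) = s / lam" using trace_KA trace_mul_sym[of Ai K] by simp
  have SAKA: "trace (S ** Ai ** K ** Ai) = (s - q) / lam"
    using trace_mul_sym[of "S ** Ai" "K ** Ai"] trace_KASA by (simp only: matrix_mul_assoc)
  show "by_parts1 n K Ai S = (s * (real n - real CARD('p) + s) - s + q) / lam"
    unfolding by_parts1_def trace_KA AS trace_KASA using lam_pos by (simp add: field_simps)
  show "by_parts2 n K Ai S = ((real n - real CARD('p) + s) * q - s * (s - q) - 2 * (q - r)) / lam\<^sup>2"
    unfolding by_parts2_def trace_KA AS trace_KASA trace_KAKA trace_KAKASA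
    using lam_pos by (simp add: field_simps power2_eq_square)
  show "by_parts3 m lam K Ai S = (CARD('p) - s) * (m - s) - (s - q)"
    unfolding by_parts3_def trace_SA AK SAKA using lam_pos by simp
qed

lemma by_parts_bounded:
  defines "p \<equiv> real CARD('p)"
  shows "\<bar>by_parts1 n K Ai S\<bar> \<le> (p * (n + 2 * p) + p) / lam"
    and "\<bar>by_parts2 n K Ai S\<bar> \<le> ((n + 2 * p) * p + p * p + 2 * p) / lam\<^sup>2"
    and "\<bar>by_parts3 m lam K Ai S\<bar> \<le> p * (m + p) + p"
proof -
  have s: "0 \<le> s" "s \<le> p" using v_nonneg s_le unfolding s_def p_def by (auto intro: sum_nonneg)
  have q: "0 \<le> q" "q \<le> s" using q_le_s unfolding q_def by (auto intro: sum_nonneg)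
  have r: "0 \<le> r" "r \<le> q" using r_nonneg r_le_q by auto
  have p: "0 \<le> p" by (simp add: p_def)
  have np: "\<bar>real n - p + s\<bar> \<le> n + 2 * p" using s p by simp
  have "\<bar>s * (n - p + s)\<bar> \<le> p * (n + 2 * p)"
    unfolding abs_mult using s np by (intro mult_mono) auto
  then have "\<bar>s * (n - p + s) - s + q\<bar> \<le> p * (n + 2 * p) + p" using s q by linarith
  then show "\<bar>by_parts1 n K Ai S\<bar> \<le> (p * (n + 2 * p) + p) / lam"
    unfolding by_parts_eigenvalues p_def[symmetric] using lam_pos by (simp add: divide_right_mono)
  have abs3: "\<bar>a - b - 2 * d\<bar> \<le> x + y + 2 * z" if "\<bar>a\<bar> \<le> x" "\<bar>b\<bar> \<le> y" "0 \<le> d" "d \<le> z" for a b d x y z :: real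
    using that by linarith
  have h1: "\<bar>(n - p + s) * q\<bar> \<le> (n + 2 * p) * p"
    unfolding abs_mult using s q np by (intro mult_mono) auto
  have h2: "\<bar>s * (s - q)\<bar> \<le> p * p"
    unfolding abs_mult using s q by (intro mult_mono) auto
  have "\<bar>(n - p + s) * q - s * (s - q) - 2 * (q - r)\<bar> \<le> (n + 2 * p) * p + p * p + 2 * p"
    by (rule abs3[OF h1 h2]) (use s q r in auto)
  then show "\<bar>by_parts2 n K Ai S\<bar> \<le> ((n + 2 * p) * p + p * p + 2 * p) / lam\<^sup>2"
    unfolding by_parts_eigenvalues p_def[symmetric] using lam_pos by (simp add: divide_right_mono)
  have "\<bar>(p - s) * (m - s)\<bar> \<le> p * (m + p)"
    unfolding abs_mult using s p by (intro mult_mono) auto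
  then show "\<bar>by_parts3 m lam K Ai S\<bar> \<le> p * (m + p) + p"
    unfolding by_parts_eigenvalues p_def[symmetric] using s q by linarith
qed

lemma ln_det_ratio:
  assumes "0 \<le> k"
  shows "ln (det (S + k *\<^sub>R (K ** Ai ** S))) - ln (det S) = (\<Sum>j\<in>UNIV. ln (1 + k / lam * v $ j))"
proof -
  have pos: "0 < 1 + k / lam * v $ j" for j
    using assms lam_pos v_nonneg[of j] by (simp add: add_pos_nonneg)
  then have "0 < (\<Prod>j\<in>UNIV. 1 + k / lam * v $ j)" by (intro prod_pos) auto
  moreover have "ln (\<Prod>j\<in>UNIV. 1 + k / lam * v $ j) = (\<Sum>j\<in>UNIV. ln (1 + k / lam * v $ j))"
    using pos[THEN less_imp_neq] by (intro ln_prod) auto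
  ultimately show ?thesis
    unfolding det_ratio using ln_mult_pos[OF _ det_pos_def[OF pd_S]] by simp
qed

lemma ln_det_ratio_bounded:
  assumes "0 \<le> k"
  shows "\<bar>ln (det (S + k *\<^sub>R (K ** Ai ** S))) - ln (det S)\<bar> \<le> CARD('p) * ln (1 + k / lam)"
proof -
  have "0 \<le> ln (1 + k / lam * v $ j)" "ln (1 + k / lam * v $ j) \<le> ln (1 + k / lam)" for j
  proof -
    have "0 \<le> k / lam * v $ j" using assms lam_pos v_nonneg[of j] by simp
    moreover have "k / lam * v $ j \<le> k / lam * 1"
      using assms lam_pos v_less[of j] by (intro mult_left_mono) auto
    ultimately show "0 \<le> ln (1 + k / lam * v $ j)" "ln (1 + k / lam * v $ j) \<le> ln (1 + k / lam)" by auto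
  qed
  then have "0 \<le> (\<Sum>j\<in>UNIV. ln (1 + k / lam * v $ j))"
    "(\<Sum>j\<in>UNIV. ln (1 + k / lam * v $ j)) \<le> CARD('p) * ln (1 + k / lam)"
    by (auto intro: sum_nonneg sum_bounded_above)
  then show ?thesis unfolding ln_det_ratio[OF assms] by simp
qed

end

text \<open>
  The trace and the determinant of the covariance estimate give the first two terms of \<open>loss_diff\<close>. The
  other two come from expanding the square \<open>(X - \<Theta>) - k X A\<^sup>-\<^sup>1 S\<close> of the mean; its quadratic part
  \<open>S A\<^sup>-\<^sup>1 K A\<^sup>-\<^sup>1 S\<close> is rewritten by \<open>SAKAS_eq\<close>.
\<close>

lemma kl_formula_difference:
  fixes \<Theta> X :: "real ^ 'p ^ 'm" and \<Sigma> S :: "real ^ 'p ^ 'p"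
  assumes \<Sigma>: "pos_def \<Sigma>" and S: "pos_def S" and n: "0 < n"
    and k: "k = k0 n CARD('m) c" "0 < k" "k < 1"
  shows "kl_formula (Theta_GB n c X S) (Sigma_GB n c X S) \<Theta> \<Sigma> =
      kl_formula X (Sigma0 n S) \<Theta> \<Sigma> + loss_diff n k \<Theta> (matrix_inv \<Sigma>) X S / 2"
    and "pos_def (Sigma_GB n c X S)"
proof -
  define lam where "lam = 1 - k"
  define K where "K = transpose X ** X"
  let ?M = "matrix_inv \<Sigma>"
  have lam: "0 < lam" using k by (simp add: lam_def)
  obtain C Ci v where "diagonal_pencil C Ci v lam S K (S + lam *\<^sub>R K)"
    using gram_pencil_exists[OF S lam] unfolding K_def by blast
  then interpret diagonal_pencil C Ci v lam S K "S + lam *\<^sub>R K" .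
  have pM: "pos_def ?M" by (rule pos_def_matrix_inv[OF \<Sigma>])
  have tAi: "transpose Ai = Ai" by (intro pos_def_sym pos_def_matrix_inv pd_A)
  have theta: "Theta_GB n c X S = X - k *\<^sub>R (X ** Ai ** S)"
    using Theta_GB_eq[OF S k(1)] lam by (simp add: lam_def K_def)
  have sigma: "Sigma_GB n c X S = (1 / n) *\<^sub>R (S + k *\<^sub>R (K ** Ai ** S))"
    using Sigma_GB_eq[OF S k(1)] lam by (simp add: lam_def K_def)
  show "pos_def (Sigma_GB n c X S)"
    unfolding sigma using n k by (intro pos_def_scaleR pd_shrunk) auto
  have pdGB: "pos_def (S + k *\<^sub>R (K ** Ai ** S))" using k by (intro pd_shrunk) auto
  define b where "b = (\<lambda>i. S *v (Ai *v X $ i))"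
  have row: "(Theta_GB n c X S - \<Theta>) $ i = (X $ i - \<Theta> $ i) - k *\<^sub>R b i" for i
  proof -
    have "(X ** Ai ** S) $ i = (X ** (Ai ** S)) $ i" by (simp only: matrix_mul_assoc)
    also have "\<dots> = transpose (Ai ** S) *v X $ i" by (rule row_matrix_mult)
    also have "\<dots> = b i"
      unfolding b_def matrix_transpose_mul tAi pos_def_sym[OF S] by (simp only: matrix_vector_mul_assoc)
    finally show ?thesis by (simp add: theta)
  qed
  have quad: "(a - k *\<^sub>R y) \<bullet> (?M *v (a - k *\<^sub>R y)) = a \<bullet> (?M *v a) - 2 * k * ((?M *v a) \<bullet> y) + k\<^sup>2 * (y \<bullet> (?M *v y))" for a y
  proof -
    have "a \<bullet> (?M *v y) = (?M *v a) \<bullet> y" by (metis inner_matrix_vector pos_def_sym[OF pM])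
    moreover have "y \<bullet> (?M *v a) = (?M *v a) \<bullet> y" by (rule inner_commute)
    ultimately show ?thesis
      by (simp add: matrix_vector.diff_right matrix_vector.scaleR_right inner_diff_left inner_diff_right
          power2_eq_square algebra_simps)
  qed
  have b2: "(\<Sum>i\<in>UNIV. b i \<bullet> (?M *v b i)) = trace (?M ** (K ** Ai ** S)) - lam * trace (?M ** (K ** Ai ** K ** Ai ** S))"
  proof -
    have K: "K = scatter UNIV (\<lambda>i. X $ i)" by (simp add: K_def gram_outer scatter_def)
    have "(\<Sum>i\<in>UNIV. b i \<bullet> (?M *v b i)) = (\<Sum>i\<in>UNIV. ((S ** Ai) *v X $ i) \<bullet> (?M *v ((S ** Ai) *v X $ i)))"
      unfolding b_def by (simp only: matrix_vector_mul_assoc)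
    also have "\<dots> = trace (?M ** (S ** Ai) ** K ** transpose (S ** Ai))" unfolding K by (rule sum_quad_scatter)
    also have "\<dots> = trace (?M ** (S ** Ai ** K ** Ai ** S))"
      by (simp only: matrix_transpose_mul tAi pos_def_sym[OF S] matrix_mul_assoc)
    finally show ?thesis
      unfolding SAKAS_eq by (simp add: matrix_mult.diff_right matrix_mult.scaleR_right trace_sub trace_scaleR)
  qed
  have mean: "(\<Sum>i\<in>UNIV. (Theta_GB n c X S - \<Theta>) $ i \<bullet> (?M *v (Theta_GB n c X S - \<Theta>) $ i)) =
      (\<Sum>i\<in>UNIV. (X - \<Theta>) $ i \<bullet> (?M *v (X - \<Theta>) $ i)) - 2 * k * (\<Sum>i\<in>UNIV. (?M *v (X $ i - \<Theta> $ i)) \<bullet> b i)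
      + k\<^sup>2 * (trace (?M ** (K ** Ai ** S)) - lam * trace (?M ** (K ** Ai ** K ** Ai ** S)))"
    unfolding row quad b2[symmetric] by (simp add: sum.distrib sum_subtractf sum_distrib_left)
  have tr: "trace (Sigma_GB n c X S ** ?M) = trace (Sigma0 n S ** ?M) + k / n * trace (?M ** (K ** Ai ** S))"
  proof -
    have "trace ((K ** Ai ** S) ** ?M) = trace (?M ** (K ** Ai ** S))" by (rule trace_mul_sym)
    then show ?thesis
      unfolding sigma Sigma0_def
      by (simp add: matrix_mult.add_left matrix_mult.scaleR_left trace_add trace_scaleR algebra_simps)
  qed
  have ld: "ln (det (Sigma_GB n c X S)) = ln (det (Sigma0 n S)) + (ln (det (S + k *\<^sub>R (K ** Ai ** S))) - ln (det S))"
    unfolding sigma Sigma0_def det_scaleR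
    using n det_pos_def[OF pdGB] det_pos_def[OF S] by (simp add: ln_mult)
  show "kl_formula (Theta_GB n c X S) (Sigma_GB n c X S) \<Theta> \<Sigma> =
      kl_formula X (Sigma0 n S) \<Theta> \<Sigma> + loss_diff n k \<Theta> ?M X S / 2"
    unfolding kl_formula_def mean tr ld loss_diff_def Let_def
    unfolding K_def[symmetric] lam_def[symmetric] b_def
    by (simp add: field_simps)
qed

text \<open>
  The statistics are integrable because they are dominated by \<open>tr (\<Sigma>\<^sup>-\<^sup>1 S)\<close> and a quadratic form in \<open>X - \<Theta>\<close>,
  and what replaces them is bounded. Fubini reduces the integration by parts to fixed \<open>X\<close> for the terms with
  \<open>\<Sigma>\<^sup>-\<^sup>1 K\<close> and to fixed \<open>S\<close> for the one with \<open>x\<^sub>i - \<theta>\<^sub>i\<close>.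
\<close>

lemma integral_loss_diff_negative:
  fixes \<Theta> :: "real ^ 'p ^ 'm" and \<Sigma> :: "real ^ 'p ^ 'p" and k :: real
  assumes \<Sigma>: "pos_def \<Sigma>" and n: "CARD('p) \<le> n" and p: "CARD('m) + 1 < CARD('p)"
    and k: "0 < k" "k < 1"
    and lam: "real n - real CARD('p) + 2 * real CARD('m) + 1 \<le> (1 - k) * (real n + real CARD('p) - 1)"
  defines "Q \<equiv> matrix_normal \<Theta> (mat 1) \<Sigma> \<Otimes>\<^sub>M wishart n \<Sigma>"
  shows "integrable Q (\<lambda>\<omega>. loss_diff n k \<Theta> (matrix_inv \<Sigma>) (fst \<omega>) (snd \<omega>))"
    and "(\<integral>\<omega>. loss_diff n k \<Theta> (matrix_inv \<Sigma>) (fst \<omega>) (snd \<omega>) \<partial>Q) < 0"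
proof -
  let ?M = "matrix_inv \<Sigma>" and ?MX = "matrix_normal \<Theta> (mat 1) \<Sigma>" and ?W = "wishart n \<Sigma>"
  let ?P = "PiM {..<n} (\<lambda>_. mvn 0 \<Sigma>)" and ?PX = "PiM UNIV (\<lambda>i. mvn (\<Theta> $ i) \<Sigma>)"
  define lam where "lam = 1 - k"
  have lam0: "0 < lam" "lam < 1" using k by (auto simp: lam_def)
  interpret MX: prob_space ?MX by (rule prob_space_matrix_normal[OF \<Sigma>])
  interpret W: prob_space ?W by (rule prob_space_wishart[OF \<Sigma>])
  interpret pair_prob_space ?MX ?W ..
  interpret Q: prob_space Q unfolding Q_def by (rule prob_space_axioms)
  have pM: "pos_def ?M" by (rule pos_def_matrix_inv[OF \<Sigma>])
  define K where "K = (\<lambda>\<omega> :: (real ^ 'p ^ 'm) \<times> (real ^ 'p ^ 'p). transpose (fst \<omega>) ** fst \<omega>)"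
  define A where "A = (\<lambda>\<omega> :: (real ^ 'p ^ 'm) \<times> (real ^ 'p ^ 'p). matrix_inv (snd \<omega> + lam *\<^sub>R K \<omega>))"
  define S where "S = (\<lambda>\<omega> :: (real ^ 'p ^ 'm) \<times> (real ^ 'p ^ 'p). snd \<omega>)"
  have setsQ: "sets Q = sets (borel \<Otimes>\<^sub>M borel)"
    unfolding Q_def by (intro sets_pair_measure_cong) auto
  have fm [measurable]: "fst \<in> borel_measurable Q" and sm [measurable]: "snd \<in> borel_measurable Q"
    by (simp_all cong: measurable_cong_sets add: setsQ)
  have K_meas [measurable]: "K \<in> borel_measurable Q" unfolding K_def by measurable
  have A_meas [measurable]: "A \<in> borel_measurable Q" unfolding A_def by measurable
  have S_meas [measurable]: "S \<in> borel_measurable Q" unfolding S_def by measurable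
  have AE_S: "AE \<omega> in Q. pos_def (S \<omega>)"
    unfolding Q_def S_def by (rule AE_pos_def_snd[OF \<Sigma> n])
  have pencil: "\<exists>C Ci v. diagonal_pencil C Ci v lam (S \<omega>) (K \<omega>) (S \<omega> + lam *\<^sub>R K \<omega>)" if "pos_def (S \<omega>)" for \<omega>
    unfolding K_def by (rule gram_pencil_exists[OF that lam0(1)])
  have inv_eq: "A \<omega> = matrix_inv (S \<omega> + lam *\<^sub>R K \<omega>)" for \<omega> by (simp add: A_def S_def)
  define T1 where "T1 = (\<lambda>\<omega>. trace (?M ** (K \<omega> ** A \<omega> ** S \<omega>)))"
  define T2 where "T2 = (\<lambda>\<omega>. trace (?M ** (K \<omega> ** A \<omega> ** K \<omega> ** A \<omega> ** S \<omega>)))"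
  define T3 where "T3 = (\<lambda>\<omega>. \<Sum>i\<in>UNIV. (?M *v (fst \<omega> $ i - \<Theta> $ i)) \<bullet> (S \<omega> *v (A \<omega> *v fst \<omega> $ i)))"
  define L where "L = (\<lambda>\<omega>. ln (det (S \<omega> + k *\<^sub>R (K \<omega> ** A \<omega> ** S \<omega>))) - ln (det (S \<omega>)))"
  define E1 where "E1 = (\<lambda>\<omega>. by_parts1 n (K \<omega>) (A \<omega>) (S \<omega>))"
  define E2 where "E2 = (\<lambda>\<omega>. by_parts2 n (K \<omega>) (A \<omega>) (S \<omega>))"
  define E3 where "E3 = (\<lambda>\<omega>. by_parts3 CARD('m) lam (K \<omega>) (A \<omega>) (S \<omega>))"
  have row_meas [measurable]: "(\<lambda>\<omega>. fst \<omega> $ i) \<in> borel_measurable Q" for i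
    by (rule measurable_compose[OF fm vec_nth_measurable])
  have meas [measurable]: "T1 \<in> borel_measurable Q" "T2 \<in> borel_measurable Q" "T3 \<in> borel_measurable Q"
    "L \<in> borel_measurable Q" "E1 \<in> borel_measurable Q" "E2 \<in> borel_measurable Q" "E3 \<in> borel_measurable Q"
    unfolding T1_def T2_def T3_def L_def E1_def E2_def E3_def by_parts1_def by_parts2_def by_parts3_def
    by measurable
  have int_tr: "integrable Q (\<lambda>\<omega>. trace (?M ** S \<omega>))"
    unfolding Q_def S_def
    by (intro integrable_pair_snd[where g = "\<lambda>S. trace (?M ** S)"] integrable_trace_wishart \<Sigma>
        MX.prob_space_axioms W.prob_space_axioms)
  have int_quad: "integrable Q (\<lambda>\<omega>. \<Sum>i\<in>UNIV. (fst \<omega> $ i - \<Theta> $ i) \<bullet> (?M *v (fst \<omega> $ i - \<Theta> $ i)))"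
    unfolding Q_def
    by (intro integrable_pair_fst[where g = "\<lambda>X. \<Sum>i\<in>UNIV. (X $ i - \<Theta> $ i) \<bullet> (?M *v (X $ i - \<Theta> $ i))"]
        Bochner_Integration.integrable_sum W.prob_space_axioms
        integrable_matrix_normal_row[where g = "\<lambda>y. (y - \<Theta> $ _) \<bullet> (?M *v (y - \<Theta> $ _))", OF \<Sigma>]
        integrable_mvn_quadratic \<Sigma>)
  have int_T1: "integrable Q T1"
  proof (rule Bochner_Integration.integrable_bound)
    show "integrable Q (\<lambda>\<omega>. (1 / lam) * trace (?M ** S \<omega>))" using int_tr by simp
    show "AE \<omega> in Q. norm (T1 \<omega>) \<le> norm ((1 / lam) * trace (?M ** S \<omega>))"
      using AE_S
    proof eventually_elim
      case (elim \<omega>)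
      obtain C Ci v where "diagonal_pencil C Ci v lam (S \<omega>) (K \<omega>) (S \<omega> + lam *\<^sub>R K \<omega>)" using pencil[OF elim] by blast
      then interpret diagonal_pencil C Ci v lam "S \<omega>" "K \<omega>" "S \<omega> + lam *\<^sub>R K \<omega>" .
      show ?case
        using trace_KAS_bounds[of ?M, OF pos_def_nonneg[OF pM]] unfolding T1_def inv_eq real_norm_def by linarith
    qed
  qed (rule meas)
  have int_T2: "integrable Q T2"
  proof (rule Bochner_Integration.integrable_bound)
    show "integrable Q (\<lambda>\<omega>. (1 / lam\<^sup>2) * trace (?M ** S \<omega>))" using int_tr by simp
    show "AE \<omega> in Q. norm (T2 \<omega>) \<le> norm ((1 / lam\<^sup>2) * trace (?M ** S \<omega>))"
      using AE_S
    proof eventually_elim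
      case (elim \<omega>)
      obtain C Ci v where "diagonal_pencil C Ci v lam (S \<omega>) (K \<omega>) (S \<omega> + lam *\<^sub>R K \<omega>)" using pencil[OF elim] by blast
      then interpret diagonal_pencil C Ci v lam "S \<omega>" "K \<omega>" "S \<omega> + lam *\<^sub>R K \<omega>" .
      show ?case
        using trace_KAKAS_bounds[of ?M, OF pos_def_nonneg[OF pM]] unfolding T2_def inv_eq real_norm_def by linarith
    qed
  qed (rule meas)
  have int_T3: "integrable Q T3"
  proof (rule Bochner_Integration.integrable_bound)
    show "integrable Q (\<lambda>\<omega>. ((\<Sum>i\<in>UNIV. (fst \<omega> $ i - \<Theta> $ i) \<bullet> (?M *v (fst \<omega> $ i - \<Theta> $ i))) +
        (1 / lam) * trace (?M ** S \<omega>)) / 2)"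
      using int_tr int_quad by simp
    show "AE \<omega> in Q. norm (T3 \<omega>) \<le> norm (((\<Sum>i\<in>UNIV. (fst \<omega> $ i - \<Theta> $ i) \<bullet> (?M *v (fst \<omega> $ i - \<Theta> $ i))) +
        (1 / lam) * trace (?M ** S \<omega>)) / 2)"
      using AE_S
    proof eventually_elim
      case (elim \<omega>)
      obtain C Ci v where "diagonal_pencil C Ci v lam (S \<omega>) (K \<omega>) (S \<omega> + lam *\<^sub>R K \<omega>)" using pencil[OF elim] by blast
      then interpret diagonal_pencil C Ci v lam "S \<omega>" "K \<omega>" "S \<omega> + lam *\<^sub>R K \<omega>" .
      have tAi: "transpose Ai = Ai" by (intro pos_def_sym pos_def_matrix_inv pd_A)
      define b where "b = (\<lambda>i. S \<omega> *v (A \<omega> *v fst \<omega> $ i))"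
      have K: "K \<omega> = scatter UNIV (\<lambda>i. fst \<omega> $ i)" by (simp add: K_def gram_outer scatter_def)
      have "(\<Sum>i\<in>UNIV. b i \<bullet> (?M *v b i)) = (\<Sum>i\<in>UNIV. ((S \<omega> ** Ai) *v fst \<omega> $ i) \<bullet> (?M *v ((S \<omega> ** Ai) *v fst \<omega> $ i)))"
        unfolding b_def inv_eq by (simp only: matrix_vector_mul_assoc)
      also have "\<dots> = trace (?M ** (S \<omega> ** Ai) ** K \<omega> ** transpose (S \<omega> ** Ai))"
        using sum_quad_scatter[where z = "\<lambda>i. fst \<omega> $ i" and I = UNIV and G = "S \<omega> ** Ai" and M = ?M and H = "S \<omega> ** Ai"]
        unfolding K .
      also have "\<dots> = trace (?M ** (S \<omega> ** Ai ** K \<omega> ** Ai ** S \<omega>))"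
        by (simp only: matrix_transpose_mul tAi pos_def_sym[OF elim] matrix_mul_assoc)
      also have "\<dots> \<le> (1 / lam) * trace (?M ** S \<omega>)"
        by (rule trace_SAKAS_bounds) (rule pos_def_nonneg[OF pM])
      finally have b: "(\<Sum>i\<in>UNIV. b i \<bullet> (?M *v b i)) \<le> (1 / lam) * trace (?M ** S \<omega>)" .
      have "\<bar>T3 \<omega>\<bar> \<le> (\<Sum>i\<in>UNIV. \<bar>(?M *v (fst \<omega> $ i - \<Theta> $ i)) \<bullet> b i\<bar>)"
        unfolding T3_def b_def by (rule sum_abs)
      also have "\<dots> \<le> (\<Sum>i\<in>UNIV. ((fst \<omega> $ i - \<Theta> $ i) \<bullet> (?M *v (fst \<omega> $ i - \<Theta> $ i)) + b i \<bullet> (?M *v b i)) / 2)"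
        by (intro sum_mono pos_def_inner_bound pM)
      also have "\<dots> = ((\<Sum>i\<in>UNIV. (fst \<omega> $ i - \<Theta> $ i) \<bullet> (?M *v (fst \<omega> $ i - \<Theta> $ i))) + (\<Sum>i\<in>UNIV. b i \<bullet> (?M *v b i))) / 2"
        by (simp add: sum_divide_distrib[symmetric] sum.distrib)
      also have "\<dots> \<le> ((\<Sum>i\<in>UNIV. (fst \<omega> $ i - \<Theta> $ i) \<bullet> (?M *v (fst \<omega> $ i - \<Theta> $ i))) +
        (1 / lam) * trace (?M ** S \<omega>)) / 2"
        using b by (intro divide_right_mono add_left_mono) auto
      finally show ?case unfolding real_norm_def by (rule order_trans) (rule abs_ge_self)
    qed
  qed (rule meas)
  have bounded: "AE \<omega> in Q. norm (E1 \<omega>) \<le> (CARD('p) * (n + 2 * real CARD('p)) + CARD('p)) / lam \<and>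
      norm (E2 \<omega>) \<le> ((n + 2 * real CARD('p)) * CARD('p) + real CARD('p) * CARD('p) + 2 * CARD('p)) / lam\<^sup>2 \<and>
      norm (E3 \<omega>) \<le> CARD('p) * (real CARD('m) + CARD('p)) + CARD('p) \<and> norm (L \<omega>) \<le> CARD('p) * ln (1 + k / lam)"
    using AE_S
  proof eventually_elim
    case (elim \<omega>)
    obtain C Ci v where "diagonal_pencil C Ci v lam (S \<omega>) (K \<omega>) (S \<omega> + lam *\<^sub>R K \<omega>)" using pencil[OF elim] by blast
    then interpret diagonal_pencil C Ci v lam "S \<omega>" "K \<omega>" "S \<omega> + lam *\<^sub>R K \<omega>" .
    show ?case
      using by_parts_bounded[of n] by_parts_bounded(3)[of "CARD('m)"] ln_det_ratio_bounded[of k] k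
      unfolding E1_def E2_def E3_def L_def inv_eq by simp
  qed
  have int_E: "integrable Q E1" "integrable Q E2" "integrable Q E3" "integrable Q L"
    using bounded by (auto intro!: Q.integrable_const_bound meas elim: eventually_mono)
  have Q_prod: "integrable (?MX \<Otimes>\<^sub>M ?W) f" if "integrable Q f" for f :: "_ \<Rightarrow> real"
    using that by (simp add: Q_def)
  have W_int: "(\<integral>S'. f S' \<partial>?W) = (\<integral>z. f (scatter {..<n} z) \<partial>?P)" if "f \<in> borel_measurable borel" for f :: "_ \<Rightarrow> real"
    unfolding wishart_scatter[OF \<Sigma>] using that by (intro integral_distr) auto
  have sec: "(\<lambda>S'. f (X, S')) \<in> borel_measurable borel" if "f \<in> borel_measurable Q" for f :: "_ \<Rightarrow> real" and X
  proof -
    have "f \<in> borel_measurable (borel \<Otimes>\<^sub>M borel)" using that by (simp cong: measurable_cong_sets add: setsQ)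
    then show ?thesis by (rule measurable_Pair2) simp
  qed
  have fst_sec: "(\<lambda>X. f (X, S')) \<in> borel_measurable borel" if "f \<in> borel_measurable Q" for f :: "_ \<Rightarrow> real" and S'
  proof -
    have "f \<in> borel_measurable (borel \<Otimes>\<^sub>M borel)" using that by (simp cong: measurable_cong_sets add: setsQ)
    then show ?thesis by (rule measurable_Pair1) simp
  qed
  have eq12: "(\<integral>\<omega>. T1 \<omega> \<partial>Q) = (\<integral>\<omega>. E1 \<omega> \<partial>Q)" "(\<integral>\<omega>. T2 \<omega> \<partial>Q) = (\<integral>\<omega>. E2 \<omega> \<partial>Q)"
  proof -
    have "(\<integral>S'. T1 (X, S') \<partial>?W) = (\<integral>S'. E1 (X, S') \<partial>?W)" for X
      unfolding W_int[OF sec[OF meas(1)]] W_int[OF sec[OF meas(5)]]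
      using integral_by_parts_scatter(1)[OF \<Sigma> n lam0(1), of X]
      by (simp add: T1_def E1_def by_parts1_def A_def S_def K_def)
    then show "(\<integral>\<omega>. T1 \<omega> \<partial>Q) = (\<integral>\<omega>. E1 \<omega> \<partial>Q)"
      using integral_fst'[OF Q_prod[OF int_T1]] integral_fst'[OF Q_prod[OF int_E(1)]] by (simp add: Q_def)
    have "(\<integral>S'. T2 (X, S') \<partial>?W) = (\<integral>S'. E2 (X, S') \<partial>?W)" for X
      unfolding W_int[OF sec[OF meas(2)]] W_int[OF sec[OF meas(6)]]
      using integral_by_parts_scatter(2)[OF \<Sigma> n lam0(1), of X]
      by (simp add: T2_def E2_def by_parts2_def A_def S_def K_def)
    then show "(\<integral>\<omega>. T2 \<omega> \<partial>Q) = (\<integral>\<omega>. E2 \<omega> \<partial>Q)"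
      using integral_fst'[OF Q_prod[OF int_T2]] integral_fst'[OF Q_prod[OF int_E(2)]] by (simp add: Q_def)
  qed
  have eq3: "(\<integral>\<omega>. T3 \<omega> \<partial>Q) = (\<integral>\<omega>. E3 \<omega> \<partial>Q)"
  proof -
    have gram: "transpose (vec_lambda x) ** vec_lambda x = scatter UNIV x" for x :: "'m \<Rightarrow> real ^ 'p"
      by (simp add: gram_outer scatter_def)
    have X_int: "(\<integral>X. f X \<partial>?MX) = (\<integral>x. f (vec_lambda x) \<partial>?PX)" if "f \<in> borel_measurable borel" for f :: "_ \<Rightarrow> real"
      unfolding matrix_normal_rows[OF \<Sigma>] using that by (intro integral_distr) auto
    have slice: "(\<integral>X. T3 (X, S') \<partial>?MX) = (\<integral>X. E3 (X, S') \<partial>?MX)" if "pos_def S'" for S'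
      unfolding X_int[OF fst_sec[OF meas(3)]] X_int[OF fst_sec[OF meas(7)]]
      using integral_by_parts_rows[OF \<Sigma> that lam0(1), of \<Theta>]
      by (simp add: T3_def E3_def by_parts3_def A_def S_def K_def gram scatter_inv_def)
    have "(\<integral>S'. (\<integral>X. T3 (X, S') \<partial>?MX) \<partial>?W) = (\<integral>S'. (\<integral>X. E3 (X, S') \<partial>?MX) \<partial>?W)"
    proof (rule integral_cong_AE)
      have m: "(\<lambda>S'. \<integral>X. f (X, S') \<partial>?MX) \<in> borel_measurable ?W" if "f \<in> borel_measurable Q" for f :: "_ \<Rightarrow> real"
      proof -
        have "(\<lambda>(S', X). f (X, S')) \<in> borel_measurable (?W \<Otimes>\<^sub>M ?MX)"
          using measurable_pair_swap[OF that[unfolded Q_def]] .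
        then show ?thesis by (intro MX.borel_measurable_lebesgue_integral) simp
      qed
      show "(\<lambda>S'. \<integral>X. T3 (X, S') \<partial>?MX) \<in> borel_measurable ?W" "(\<lambda>S'. \<integral>X. E3 (X, S') \<partial>?MX) \<in> borel_measurable ?W"
        by (intro m meas)+
      show "AE S' in ?W. (\<integral>X. T3 (X, S') \<partial>?MX) = (\<integral>X. E3 (X, S') \<partial>?MX)"
        using AE_pos_def_wishart[OF \<Sigma> n] by eventually_elim (rule slice)
    qed
    then show ?thesis
      using integral_snd[of "\<lambda>X S'. T3 (X, S')"] integral_snd[of "\<lambda>X S'. E3 (X, S')"] Q_prod[OF int_T3] Q_prod[OF int_E(3)]
      by (simp add: Q_def)
  qed
  let ?d = "\<lambda>\<omega>. real CARD('m) * k / real n * T1 \<omega> - real CARD('m) * L \<omega> - 2 * k * T3 \<omega> + k\<^sup>2 * (T1 \<omega> - lam * T2 \<omega>)"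
  let ?e = "\<lambda>\<omega>. real CARD('m) * k / real n * E1 \<omega> - real CARD('m) * L \<omega> - 2 * k * E3 \<omega> + k\<^sup>2 * (E1 \<omega> - lam * E2 \<omega>)"
  have d_eq: "loss_diff n k \<Theta> ?M (fst \<omega>) (snd \<omega>) = ?d \<omega>" for \<omega>
    unfolding loss_diff_def Let_def T1_def T2_def T3_def L_def inv_eq K_def S_def lam_def ..
  show "integrable Q (\<lambda>\<omega>. loss_diff n k \<Theta> ?M (fst \<omega>) (snd \<omega>))"
    unfolding d_eq using int_T1 int_T2 int_T3 int_E by simp
  have "(\<integral>\<omega>. loss_diff n k \<Theta> ?M (fst \<omega>) (snd \<omega>) \<partial>Q) = (\<integral>\<omega>. ?e \<omega> \<partial>Q)"
    unfolding d_eq using int_T1 int_T2 int_T3 int_E eq12 eq3 by simp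
  also have "\<dots> < (\<integral>\<omega>. 0 \<partial>Q)"
  proof (rule Q.integral_less_AE_space)
    show "integrable Q ?e" using int_E by simp
    show "emeasure Q (space Q) \<noteq> 0" by (simp add: Q.emeasure_space_1)
    show "AE \<omega> in Q. ?e \<omega> < 0"
      using AE_S
    proof eventually_elim
      case (elim \<omega>)
      obtain C Ci v where "diagonal_pencil C Ci v lam (S \<omega>) (K \<omega>) (S \<omega> + lam *\<^sub>R K \<omega>)" using pencil[OF elim] by blast
      then interpret diagonal_pencil C Ci v lam "S \<omega>" "K \<omega>" "S \<omega> + lam *\<^sub>R K \<omega>" .
      have gap: "0 \<le> CARD('m) - 2 * s + q" by (rule gap_nonneg) (simp add: K_def)
      have L_eq: "L \<omega> = (\<Sum>j\<in>UNIV. ln (1 + k / lam * v $ j))"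
        unfolding L_def inv_eq using k by (intro ln_det_ratio) auto
      have E12: "E1 \<omega> - lam * E2 \<omega> =
          ((n - real CARD('p)) * (s - q) + 2 * s\<^sup>2 - 2 * s * q - s + 3 * q - 2 * r) / lam"
        unfolding E1_def E2_def inv_eq by_parts_eigenvalues using lam_pos
        by (simp add: field_simps power2_eq_square)
      have "real CARD('m) * k / real n * ((s * (real n - real CARD('p) + s) - s + q) / lam)
          - real CARD('m) * (\<Sum>j\<in>UNIV. ln (1 + k / lam * v $ j))
          - 2 * k * ((real CARD('p) - s) * (real CARD('m) - s) - (s - q))
          + k\<^sup>2 * (((n - real CARD('p)) * (s - q) + 2 * s\<^sup>2 - 2 * s * q - s + 3 * q - 2 * r) / lam) < 0"
        using n p gap lam lam0
        by (intro risk_difference_negative) (auto simp: lam_def)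
      then show ?case
        unfolding E12 L_eq unfolding E1_def E3_def inv_eq by_parts_eigenvalues .
    qed
  qed simp
  finally show "(\<integral>\<omega>. loss_diff n k \<Theta> ?M (fst \<omega>) (snd \<omega>) \<partial>Q) < 0" by simp
qed

text \<open>
  The losses are nonnegative, and the one of the usual estimator and \<open>loss_diff\<close> are integrable. So both risks
  are finite and differ by half the integral of \<open>loss_diff\<close>.
\<close>

lemma kl_risk_GB_less:
  fixes \<Theta> :: "real ^ 'p ^ 'm" and \<Sigma> :: "real ^ 'p ^ 'p"
  assumes \<Sigma>: "pos_def \<Sigma>" and n: "CARD('p) \<le> n" and p: "CARD('m) + 1 < CARD('p)"
    and k: "0 < k0 n CARD('m) c" "k0 n CARD('m) c < 1"
    and lam: "real n - real CARD('p) + 2 * real CARD('m) + 1 \<le> (1 - k0 n CARD('m) c) * (real n + real CARD('p) - 1)"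
  shows "kl_risk n (GB_estimator n c) \<Theta> \<Sigma> < kl_risk n (usual_estimator n) \<Theta> \<Sigma>"
proof -
  let ?M = "matrix_inv \<Sigma>" and ?MX = "matrix_normal \<Theta> (mat 1) \<Sigma>" and ?W = "wishart n \<Sigma>"
  define Q where "Q = ?MX \<Otimes>\<^sub>M ?W"
  define k where "k = k0 n CARD('m) c"
  interpret MX: prob_space ?MX by (rule prob_space_matrix_normal[OF \<Sigma>])
  interpret W: prob_space ?W by (rule prob_space_wishart[OF \<Sigma>])
  interpret pair_prob_space ?MX ?W ..
  interpret Q: prob_space Q unfolding Q_def by (rule prob_space_axioms)
  have n0: "0 < n" using n p by linarith
  have setsQ: "sets Q = sets (borel \<Otimes>\<^sub>M borel)"
    unfolding Q_def by (intro sets_pair_measure_cong) auto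
  have fm [measurable]: "fst \<in> borel_measurable Q" and sm [measurable]: "snd \<in> borel_measurable Q"
    by (simp_all cong: measurable_cong_sets add: setsQ)
  have AE_S: "AE \<omega> in Q. pos_def (snd \<omega>)"
    unfolding Q_def by (rule AE_pos_def_snd[OF \<Sigma> n])
  note diff = integral_loss_diff_negative[OF \<Sigma> n p k lam, of \<Theta>, folded Q_def k_def]
  define L0 where "L0 = (\<lambda>\<omega>. kl_formula (fst \<omega>) (Sigma0 n (snd \<omega>)) \<Theta> \<Sigma>)"
  define D where "D = (\<lambda>\<omega>. loss_diff n k \<Theta> ?M (fst \<omega>) (snd \<omega>))"
  define qX where "qX = (\<lambda>X. \<Sum>i\<in>UNIV. (X $ i - \<Theta> $ i) \<bullet> (?M *v (X $ i - \<Theta> $ i)))"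
  define R where "R = (\<lambda>\<omega>. CARD('m) / 2 * (trace (?M ** snd \<omega>) / n + CARD('p) * ln n + ln (det \<Sigma>) - CARD('p)) + qX (fst \<omega>) / 2
    + CARD('m) / 2 * max 0 (- ln (det (snd \<omega>))))"
  have pd0: "pos_def (Sigma0 n S)" if "pos_def S" for S
    unfolding Sigma0_def using n0 that by (intro pos_def_scaleR) auto
  have usual: "kl_loss (usual_estimator n (fst \<omega>) (snd \<omega>)) (\<Theta>, \<Sigma>) = L0 \<omega> \<and> 0 \<le> L0 \<omega>" if "pos_def (snd \<omega>)" for \<omega>
    unfolding usual_estimator_def L0_def using kl_loss_eq[OF pd0[OF that] \<Sigma>] by blast
  have GB: "kl_loss (GB_estimator n c (fst \<omega>) (snd \<omega>)) (\<Theta>, \<Sigma>) = L0 \<omega> + D \<omega> / 2 \<and> 0 \<le> L0 \<omega> + D \<omega> / 2"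
    if "pos_def (snd \<omega>)" for \<omega>
  proof -
    note f = kl_formula_difference(1)[OF \<Sigma> that n0 k_def k[folded k_def], of "fst \<omega>" \<Theta>]
      kl_formula_difference(2)[OF \<Sigma> that n0 k_def k[folded k_def], of "fst \<omega>"]
    show ?thesis
      unfolding GB_estimator_def L0_def D_def f(1)[symmetric] using kl_loss_eq[OF f(2) \<Sigma>] by blast
  qed
  have L0_eq: "L0 \<omega> = CARD('m) / 2 * (trace (?M ** snd \<omega>) / n - ln (det (snd \<omega>)) + CARD('p) * ln n + ln (det \<Sigma>) - CARD('p))
      + qX (fst \<omega>) / 2" if "pos_def (snd \<omega>)" for \<omega>
  proof -
    have ln_eq: "ln (det (Sigma0 n (snd \<omega>))) = ln (det (snd \<omega>)) - CARD('p) * ln n"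
      unfolding Sigma0_def det_scaleR using n0 det_pos_def[OF that]
      by (simp add: ln_mult ln_realpow ln_div)
    have tr_eq: "trace (Sigma0 n (snd \<omega>) ** ?M) = trace (?M ** snd \<omega>) / n"
      unfolding Sigma0_def using trace_mul_sym[of "snd \<omega>" ?M]
      by (simp add: matrix_mult.scaleR_left trace_scaleR)
    show ?thesis
      unfolding L0_def kl_formula_def qX_def ln_eq tr_eq by (simp add: algebra_simps)
  qed
  have intR: "integrable Q R"
  proof -
    have 1: "integrable Q (\<lambda>\<omega>. trace (?M ** snd \<omega>))"
      unfolding Q_def
      by (intro integrable_pair_snd[where g = "\<lambda>S. trace (?M ** S)"] integrable_trace_wishart \<Sigma>
          MX.prob_space_axioms W.prob_space_axioms)
    have 2: "integrable Q (\<lambda>\<omega>. max 0 (- ln (det (snd \<omega>))))"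
      unfolding Q_def
      by (intro integrable_pair_snd[where g = "\<lambda>S. max 0 (- ln (det S))"] integrable_neg_ln_det_wishart \<Sigma> n
          MX.prob_space_axioms W.prob_space_axioms)
    have "integrable ?MX qX"
      unfolding qX_def
      by (intro Bochner_Integration.integrable_sum
          integrable_matrix_normal_row[where g = "\<lambda>y. (y - \<Theta> $ _) \<bullet> (?M *v (y - \<Theta> $ _))", OF \<Sigma>]
          integrable_mvn_quadratic \<Sigma>)
    then have 3: "integrable Q (\<lambda>\<omega>. qX (fst \<omega>))"
      unfolding Q_def by (intro integrable_pair_fst W.prob_space_axioms)
    show ?thesis unfolding R_def using 1 2 3 by simp
  qed
  have meas_L0: "L0 \<in> borel_measurable Q"
  proof -
    have "(\<lambda>\<omega>. (fst \<omega> - \<Theta>) $ i) \<in> borel_measurable Q" for i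
      by (rule measurable_compose[OF _ vec_nth_measurable]) measurable
    then show ?thesis unfolding L0_def kl_formula_def Sigma0_def by measurable
  qed
  have int0: "integrable Q L0"
  proof (rule Bochner_Integration.integrable_bound[OF intR meas_L0])
    show "AE \<omega> in Q. norm (L0 \<omega>) \<le> norm (R \<omega>)"
      using AE_S
    proof eventually_elim
      case (elim \<omega>)
      have "CARD('m) / 2 * (- ln (det (snd \<omega>))) \<le> CARD('m) / 2 * max 0 (- ln (det (snd \<omega>)))"
        by (intro mult_left_mono) auto
      then have "L0 \<omega> \<le> R \<omega>" unfolding L0_eq[OF elim] R_def by (simp add: algebra_simps)
      then show ?case using usual[OF elim] by simp
    qed
  qed
  have int1: "integrable Q (\<lambda>\<omega>. L0 \<omega> + D \<omega> / 2)"
    using int0 diff(1) unfolding D_def by simp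
  have "kl_risk n (GB_estimator n c) \<Theta> \<Sigma> = (\<integral>\<^sup>+\<omega>. ennreal (L0 \<omega> + D \<omega> / 2) \<partial>Q)"
    unfolding kl_risk_def Q_def[symmetric] case_prod_beta
  proof (rule nn_integral_cong_AE)
    show "AE \<omega> in Q. ennreal (kl_loss (GB_estimator n c (fst \<omega>) (snd \<omega>)) (\<Theta>, \<Sigma>)) = ennreal (L0 \<omega> + D \<omega> / 2)"
      using AE_S by eventually_elim (use GB in simp)
  qed
  also have "\<dots> = ennreal (\<integral>\<omega>. L0 \<omega> + D \<omega> / 2 \<partial>Q)"
    by (rule nn_integral_eq_integral[OF int1]) (use AE_S in eventually_elim, use GB in blast)
  finally have risk1: "kl_risk n (GB_estimator n c) \<Theta> \<Sigma> = ennreal (\<integral>\<omega>. L0 \<omega> + D \<omega> / 2 \<partial>Q)" .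
  have "kl_risk n (usual_estimator n) \<Theta> \<Sigma> = (\<integral>\<^sup>+\<omega>. ennreal (L0 \<omega>) \<partial>Q)"
    unfolding kl_risk_def Q_def[symmetric] case_prod_beta
  proof (rule nn_integral_cong_AE)
    show "AE \<omega> in Q. ennreal (kl_loss (usual_estimator n (fst \<omega>) (snd \<omega>)) (\<Theta>, \<Sigma>)) = ennreal (L0 \<omega>)"
      using AE_S by eventually_elim (use usual in simp)
  qed
  also have "\<dots> = ennreal (\<integral>\<omega>. L0 \<omega> \<partial>Q)"
    by (rule nn_integral_eq_integral[OF int0]) (use AE_S in eventually_elim, use usual in blast)
  finally have risk0: "kl_risk n (usual_estimator n) \<Theta> \<Sigma> = ennreal (\<integral>\<omega>. L0 \<omega> \<partial>Q)" .
  have nonneg: "0 \<le> (\<integral>\<omega>. L0 \<omega> + D \<omega> / 2 \<partial>Q)"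
    by (rule integral_nonneg_AE) (use AE_S in eventually_elim, use GB in blast)
  have "(\<integral>\<omega>. L0 \<omega> + D \<omega> / 2 \<partial>Q) = (\<integral>\<omega>. L0 \<omega> \<partial>Q) + (\<integral>\<omega>. D \<omega> \<partial>Q) / 2"
    using int0 diff(1) unfolding D_def by simp
  also have "\<dots> < (\<integral>\<omega>. L0 \<omega> \<partial>Q)" using diff(2) unfolding D_def by simp
  finally show ?thesis
    unfolding risk0 risk1 using nonneg by (simp add: ennreal_less_iff)
qed

text \<open>
  Since \<open>1 - k\<^sub>0 = (c + m + 1) / n\<close>, the bound \<open>c\<^sub>l\<^sub>o\<^sub>w \<le> c\<close> becomes the third inequality when denominators are
  cleared.
\<close>

lemma shrinkage_bounds:
  fixes n m p :: nat and c :: real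
  assumes "p \<le> n" "m + 1 < p" "0 < m" "- 2 < c" "c < real n - 2 * real m" "c_low n m p \<le> c"
  shows "0 < k0 n m c" "k0 n m c < 1"
    "real n - real p + 2 * real m + 1 \<le> (1 - k0 n m c) * (real n + real p - 1)"
proof -
  have n: "0 < real n" using assms by simp
  have np: "0 < real n + p - 1" using assms by simp
  have lam: "1 - k0 n m c = (c + m + 1) / n" using n by (simp add: k0_def field_simps)
  show "0 < k0 n m c" using assms n by (simp add: k0_def)
  show "k0 n m c < 1" using assms n by (simp add: k0_def)
  have "(real n)\<^sup>2 - (real p - real m) * real n - (real p - 1) * (real m + 1) \<le> c * (real n + real p - 1)"
    using assms(6) unfolding c_low_def pos_divide_le_eq[OF np] .
  then have "real n * (real n - p + 2 * m + 1) \<le> (c + m + 1) * (real n + p - 1)"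
    by (simp add: algebra_simps power2_eq_square)
  then show "real n - real p + 2 * real m + 1 \<le> (1 - k0 n m c) * (real n + real p - 1)"
    unfolding lam using n assms by (simp add: field_simps)
qed

text \<open>
  Clearing denominators, the hypothesis on \<open>n\<close> is \<open>c\<^sub>l\<^sub>o\<^sub>w < n - 2 m\<close>. It remains to see that also
  \<open>- 2 < n - 2 m\<close>: for small \<open>m\<close> because \<open>n \<ge> p\<close>, and for large \<open>m\<close> because the bound on \<open>n\<close> is then at least
  \<open>2 m - 2\<close>.
\<close>

lemma shrinkage_exists:
  fixes n m p :: nat
  assumes "p \<le> n" "m + 1 < p" "0 < m"
    and n: "real n > (real p - 1) * (real m - 1) / (2 * real p - 3 * real m - 1)" and p: "real p > (3 * real m + 1) / 2"
  shows "\<exists>c::real. - 2 < c \<and> c < real n - 2 * real m \<and> c_low n m p \<le> c"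
proof -
  have d: "0 < 2 * real p - 3 * real m - 1" using p by (simp add: field_simps)
  have np: "0 < real n + p - 1" using assms by simp
  have "(real p - 1) * (real m - 1) < real n * (2 * real p - 3 * real m - 1)"
    using n d by (simp add: pos_divide_less_eq)
  then have low: "c_low n m p < real n - 2 * m"
    unfolding c_low_def pos_divide_less_eq[OF np] by (simp add: algebra_simps power2_eq_square)
  have two: "- 2 < real n - 2 * m"
  proof (cases "2 * m \<le> p + 1")
    case True
    then have "2 * real m \<le> real n + 1" using assms(1) by linarith
    then show ?thesis by linarith
  next
    case False
    have "(2 * real m - 2) * (2 * real p - 3 * real m - 1) \<le> (real p - 1) * (real m - 1)"
    proof -
      have "real p + 2 \<le> 2 * real m" using False by linarith
      then have "2 * (2 * real p - 3 * real m - 1) \<le> real p - 1" by (simp add: algebra_simps)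
      then have "(real m - 1) * (2 * (2 * real p - 3 * real m - 1)) \<le> (real m - 1) * (real p - 1)"
        using assms(3) by (intro mult_left_mono) auto
      then show ?thesis by (simp add: algebra_simps)
    qed
    then have "2 * real m - 2 \<le> (real p - 1) * (real m - 1) / (2 * real p - 3 * real m - 1)"
      using d by (simp add: pos_le_divide_eq)
    then show ?thesis using n by linarith
  qed
  obtain c where "max (- 2) (c_low n m p) < c" "c < real n - 2 * m"
    using dense[of "max (- 2) (c_low n m p)" "real n - 2 * m"] low two by auto
  then show ?thesis by (intro exI[of _ c]) auto
qed

theorem corollary4p3:
  fixes n m p :: nat
  assumes "m = CARD('m::finite)" and "p = CARD('p::finite)"
    and "n \<ge> p" and "p > m + 1"
  shows "(\<forall>c::real. - 2 < c \<and> c < real n - 2 * real m \<and> c_low n m p \<le> c \<longrightarrow>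
            kl_dominates n
              (GB_estimator n c :: real ^ 'p ^ 'm \<Rightarrow> real ^ 'p ^ 'p \<Rightarrow> (real ^ 'p ^ 'm) \<times> (real ^ 'p ^ 'p))
              (usual_estimator n)) \<and>
         (real n > (real p - 1) * (real m - 1) / (2 * real p - 3 * real m - 1) \<and>
          real p > (3 * real m + 1) / 2 \<longrightarrow>
            (\<exists>c::real. - 2 < c \<and> c < real n - 2 * real m \<and> c_low n m p \<le> c))"
proof (intro conjI allI impI)
  have m: "0 < m" using assms(1) by simp
  fix c :: real
  assume c: "- 2 < c \<and> c < real n - 2 * real m \<and> c_low n m p \<le> c"
  have k: "0 < k0 n CARD('m) c" "k0 n CARD('m) c < 1"
    "real n - real CARD('p) + 2 * real CARD('m) + 1 \<le> (1 - k0 n CARD('m) c) * (real n + real CARD('p) - 1)"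
    using shrinkage_bounds[of p n m c] c assms m by auto
  have less: "kl_risk n (GB_estimator n c) \<Theta> \<Sigma> < kl_risk n (usual_estimator n) \<Theta> \<Sigma>"
    if "pos_def \<Sigma>" for \<Theta> :: "real ^ 'p ^ 'm" and \<Sigma> :: "real ^ 'p ^ 'p"
    using assms by (intro kl_risk_GB_less[OF that] k) auto
  have "pos_def (mat 1 :: real ^ 'p ^ 'p)" by (simp add: pos_def_def)
  then show "kl_dominates n
      (GB_estimator n c :: real ^ 'p ^ 'm \<Rightarrow> real ^ 'p ^ 'p \<Rightarrow> (real ^ 'p ^ 'm) \<times> (real ^ 'p ^ 'p))
      (usual_estimator n)"
    unfolding kl_dominates_def using less less_imp_le by blast
next
  assume "real n > (real p - 1) * (real m - 1) / (2 * real p - 3 * real m - 1) \<and> real p > (3 * real m + 1) / 2"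
  then show "\<exists>c::real. - 2 < c \<and> c < real n - 2 * real m \<and> c_low n m p \<le> c"
    using assms by (intro shrinkage_exists[of p n m]) auto
qed

end
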